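(* Let $T>0$ and $f(z)=\Lambda z$. Assume that the support of $\Theta$ is not bounded, that $\Lambda>0$, and that $cT-M(T)>0$. Then the optimal solution of the insurer program $\sup_{\phi\in\mathcal C}\mathcal U(\phi)$ is given by $$\phi^*(z)=\min\left\{z\,;\ \frac{b}{b-a}\,(z-a)_+\right\}$$ for some thresholds $a,b\in\mathbb R^+$ with $b>a$ satisfying $$\Lambda\int_0^b\left(z-\frac{b}{b-a}(z-a)_+\right)\Theta(dz)=\frac{2M(T)}{B(T)}\,\frac{a}{b-a}.$$
   Context: Let $(\Omega,\mathcal F,(\mathcal F_t)_{t\ge0},\mathbb Q)$ be a filtered probability space satisfying the usual conditions; $\mathbb E$ and $\mathbb V$ denote expectation and variance, $\mathbb R^+=[0,\infty)$, and $x_+=\max(x,0)$. Let $\Theta$ be a measure on $(\mathbb R^+,\mathcal B(\mathbb R^+))$ with finite moments up to order two: $\int_0^\infty(1+z+z^2)\,\Theta(dz)<\infty$. For a $\Theta$-integrable function $g$, $H[g]:=\int_0^\infty g(z)\,\Theta(dz)$, and $\overline\theta:=\int_0^\infty z\,\Theta(dz)$. Let $f(z)=\Lambda z$ with $\Lambda\ge0$ and $H[f]=\Lambda\overline\theta<\beta$, where $\beta$ is a constant. Let $(T_i,Z_i)_{i\ge1}$ be a marked point process (loss times and loss sizes), let $\nu(dt,dz)$ be the associated random counting measure, and assume it is a marked Hawkes process: the compensator of $\nu$ is $\lambda_{t^-}\Theta(dz)\,dt$, where $$\lambda_t=\lambda_0+\beta\int_0^t(\underline\lambda-\lambda_{s^-})\,ds+\int_0^{t^-}\int_{\mathbb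 R^+}f(z)\,\nu(ds,dz),$$ with constant intensities $\lambda_0>\underline\lambda\ge0$. Under these assumptions $\lambda$ is well defined and has finite moments up to order two. Set $m(t)=\mathbb E[\lambda_t]$, $M(t)=\int_0^t m(s)\,ds$, and $$B(T)=2\int_0^T\int_0^t e^{-(\beta-H[f])(t-s)}m(s)\,ds\,dt .$$ The set of reinsurance contracts is $\mathcal C=\{h:\mathbb R^+\to\mathbb R\text{ measurable}:\ 0\le h(z)\le z\ \ \Theta\text{-a.s.}\}$, viewed as a subset of $L^2(\Theta)$ (so contracts are identified when equal $\Theta$-a.e.). The insurer's wealth under $\phi\in\mathcal C$ is $$R_t(\phi)=R_0+\int_0^t\int_0^\infty(\phi(z)-z)\,\nu(ds,dz)+\rho\,\overline\theta\,t-c\,t\int_0^\infty\phi(z)\,\Theta(dz),$$ where $R_0,\rho,c$ are constants, and the criterion is $\mathcal U(\phi)=\mathbb E[R_T(\phi)]-\gamma\,\mathbb V[R_T(\phi)]$ with a constant $\gamma>0$. *)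

theory Defs
  imports "HOL-Probability.Probability"
begin

section \<open>Filtrations, marked point processes and compensators\<close>

abbreviation Rplus :: "real measure"
  where "Rplus \<equiv> restrict_space borel {0..}"

text \<open>Time is \<open>[0,\<infinity>)\<close>; the values \<open>F t\<close> for \<open>t < 0\<close> are irrelevant. The last three assumptions
  are the usual conditions.\<close>

locale filtered_prob_space = prob_space Q for Q :: "'a measure" +
  fixes F :: "real \<Rightarrow> 'a measure"
  assumes subalgebra_F: "0 \<le> t \<Longrightarrow> subalgebra Q (F t)"
    and mono_F: "0 \<le> s \<Longrightarrow> s \<le> t \<Longrightarrow> sets (F s) \<subseteq> sets (F t)"
    and complete_Q: "complete_measure Q"
    and null_sets_F: "null_sets Q \<subseteq> sets (F 0)"
    and right_continuous_F: "0 \<le> t \<Longrightarrow> sets (F t) = (\<Inter>s\<in>{t<..}. sets (F s))"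

text \<open>The random counting measure of the points \<open>(\<tau> i, Z i)\<close> with \<open>\<tau> i < \<infinity>\<close>; the value
  \<open>\<tau> i = \<infinity>\<close> encodes that there are at most \<open>i\<close> losses (indices start at \<open>0\<close>).\<close>

definition counting_measure ::
    "(nat \<Rightarrow> 'a \<Rightarrow> ereal) \<Rightarrow> (nat \<Rightarrow> 'a \<Rightarrow> real) \<Rightarrow> 'a \<Rightarrow> (real \<times> real) measure" where
  "counting_measure \<tau> Z \<omega> =
     distr (count_space {i. \<tau> i \<omega> < \<infinity>}) (Rplus \<Otimes>\<^sub>M Rplus) (\<lambda>i. (real_of_ereal (\<tau> i \<omega>), Z i \<omega>))"

text \<open>Adaptedness is expressed through the counting measure; it says that the \<open>\<tau> i\<close> are stopping times
  and that each mark is known at its time of occurrence.\<close>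

locale marked_point_process = filtered_prob_space Q F for Q :: "'a measure" and F +
  fixes \<tau> :: "nat \<Rightarrow> 'a \<Rightarrow> ereal" and Z :: "nat \<Rightarrow> 'a \<Rightarrow> real"
  assumes measurable_time: "\<tau> i \<in> borel_measurable Q"
    and measurable_mark: "Z i \<in> measurable Q Rplus"
    and time_pos: "\<omega> \<in> space Q \<Longrightarrow> 0 < \<tau> i \<omega>"
    and time_mono: "\<omega> \<in> space Q \<Longrightarrow> \<tau> i \<omega> \<le> \<tau> (Suc i) \<omega>"
    and time_strict: "\<omega> \<in> space Q \<Longrightarrow> \<tau> i \<omega> < \<infinity> \<Longrightarrow> \<tau> i \<omega> < \<tau> (Suc i) \<omega>"
    and no_accumulation: "\<omega> \<in> space Q \<Longrightarrow> (\<lambda>i. \<tau> i \<omega>) \<longlonglongrightarrow> \<infinity>"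
    and adapted: "0 \<le> t \<Longrightarrow> A \<in> sets Rplus \<Longrightarrow>
           (\<lambda>\<omega>. emeasure (counting_measure \<tau> Z \<omega>) ({0<..t} \<times> A)) \<in> borel_measurable (F t)"

definition predictable :: "'a measure \<Rightarrow> (real \<Rightarrow> 'a measure) \<Rightarrow> ('a \<times> real) measure" where
  "predictable Q F = sigma (space Q \<times> {0..})
     ({A \<times> {0} | A. A \<in> sets (F 0)} \<union>
      {A \<times> {s<..t} | A s t. 0 \<le> s \<and> s \<le> t \<and> A \<in> sets (F s)})"

text \<open>\<open>\<mu>\<close> is the compensator (dual predictable projection) of the random measure \<open>\<nu>\<close>: it is a
  predictable random measure, and \<open>\<nu>\<close> and \<open>\<mu>\<close> give the same expected integral to every
  nonnegative predictable integrand \<open>W (\<omega>, t, z)\<close>.\<close>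

definition compensator ::
    "'a measure \<Rightarrow> (real \<Rightarrow> 'a measure) \<Rightarrow> ('a \<Rightarrow> (real \<times> real) measure)
       \<Rightarrow> ('a \<Rightarrow> (real \<times> real) measure) \<Rightarrow> bool" where
  "compensator Q F \<nu> \<mu> \<longleftrightarrow>
     (\<forall>W :: ('a \<times> real) \<times> real \<Rightarrow> ennreal.
        W \<in> borel_measurable (predictable Q F \<Otimes>\<^sub>M Rplus) \<longrightarrow>
          (\<lambda>(\<omega>, t). \<integral>\<^sup>+ (s, z). W ((\<omega>, s), z) * indicator {0..t} s \<partial>\<mu> \<omega>)
             \<in> borel_measurable (predictable Q F) \<and>
          (\<integral>\<^sup>+ \<omega>. (\<integral>\<^sup>+ (s, z). W ((\<omega>, s), z) \<partial>\<nu> \<omega>) \<partial>Q) =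
          (\<integral>\<^sup>+ \<omega>. (\<integral>\<^sup>+ (s, z). W ((\<omega>, s), z) \<partial>\<mu> \<omega>) \<partial>Q))"

section \<open>Marked Hawkes processes\<close>

definition left_limit :: "(real \<Rightarrow> real) \<Rightarrow> real \<Rightarrow> real" where
  "left_limit g t = (if t = 0 then g 0 else Lim (at_left t) g)"

text \<open>The integral equation for the intensity. The integral of \<open>f\<close> is over the open-ended time
  interval \<open>[0,t)\<close>, so that a loss at time \<open>t\<close> does not contribute to the value at \<open>t\<close>.\<close>

definition hawkes_intensity_equation ::
    "'a measure \<Rightarrow> real \<Rightarrow> real \<Rightarrow> real \<Rightarrow> (real \<Rightarrow> real) \<Rightarrow> ('a \<Rightarrow> (real \<times> real) measure)
       \<Rightarrow> (real \<Rightarrow> 'a \<Rightarrow> real) \<Rightarrow> bool" where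
  "hawkes_intensity_equation Q lam0 lam_base \<beta> f \<nu> lam \<longleftrightarrow>
     (AE \<omega> in Q. \<forall>t\<ge>0.
        set_integrable lborel {0..t} (\<lambda>s. left_limit (\<lambda>u. lam u \<omega>) s) \<and>
        lam t \<omega> = lam0 + \<beta> * (LINT s:{0..t}|lborel. lam_base - left_limit (\<lambda>u. lam u \<omega>) s)
                   + (LINT x:{0..<t} \<times> {0..}|\<nu> \<omega>. f (snd x)))"

definition hawkes_compensator ::
    "real measure \<Rightarrow> (real \<Rightarrow> 'a \<Rightarrow> real) \<Rightarrow> 'a \<Rightarrow> (real \<times> real) measure" where
  "hawkes_compensator \<Theta> lam \<omega> =
     density (restrict_space lborel {0..} \<Otimes>\<^sub>M \<Theta>)
       (\<lambda>(t, z). ennreal (left_limit (\<lambda>u. lam u \<omega>) t))"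

locale marked_hawkes_process = marked_point_process Q F \<tau> Z
  for Q :: "'a measure" and F and \<tau> and Z +
  fixes \<Theta> :: "real measure" and lam0 lam_base \<beta> :: real and f :: "real \<Rightarrow> real"
    and lam :: "real \<Rightarrow> 'a \<Rightarrow> real"
  assumes intensity:
      "hawkes_intensity_equation Q lam0 lam_base \<beta> f (counting_measure \<tau> Z) lam"
    and compensator:
      "compensator Q F (counting_measure \<tau> Z) (hawkes_compensator \<Theta> lam)"

definition mean_intensity :: "'a measure \<Rightarrow> (real \<Rightarrow> 'a \<Rightarrow> real) \<Rightarrow> real \<Rightarrow> real" where
  "mean_intensity Q lam t = (\<integral>\<omega>. lam t \<omega> \<partial>Q)"

definition cumulative_intensity :: "'a measure \<Rightarrow> (real \<Rightarrow> 'a \<Rightarrow> real) \<Rightarrow> real \<Rightarrow> real" where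
  "cumulative_intensity Q lam t = (LINT s:{0..t}|lborel. mean_intensity Q lam s)"

definition B_coeff ::
    "'a measure \<Rightarrow> real measure \<Rightarrow> real \<Rightarrow> (real \<Rightarrow> real) \<Rightarrow> (real \<Rightarrow> 'a \<Rightarrow> real) \<Rightarrow> real \<Rightarrow> real"
  where
  "B_coeff Q \<Theta> \<beta> f lam T =
     2 * (LINT t:{0..T}|lborel. LINT s:{0..t}|lborel.
            exp (- (\<beta> - (\<integral>z. f z \<partial>\<Theta>)) * (t - s)) * mean_intensity Q lam s)"

section \<open>The reinsurance problem\<close>

definition contracts :: "real measure \<Rightarrow> (real \<Rightarrow> real) set" where
  "contracts \<Theta> = {h \<in> borel_measurable Rplus. AE z in \<Theta>. 0 \<le> h z \<and> h z \<le> z}"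

definition wealth ::
    "('a \<Rightarrow> (real \<times> real) measure) \<Rightarrow> real measure \<Rightarrow> real \<Rightarrow> real \<Rightarrow> real
       \<Rightarrow> real \<Rightarrow> (real \<Rightarrow> real) \<Rightarrow> 'a \<Rightarrow> real" where
  "wealth \<nu> \<Theta> R0 \<rho> c t \<phi> \<omega> =
     R0 + (LINT x:{0<..t} \<times> {0..}|\<nu> \<omega>. \<phi> (snd x) - snd x)
        + \<rho> * (\<integral>z. z \<partial>\<Theta>) * t - c * t * (\<integral>z. \<phi> z \<partial>\<Theta>)"

definition criterion ::
    "'a measure \<Rightarrow> ('a \<Rightarrow> (real \<times> real) measure) \<Rightarrow> real measure \<Rightarrow> real \<Rightarrow> real \<Rightarrow> real
       \<Rightarrow> real \<Rightarrow> real \<Rightarrow> (real \<Rightarrow> real) \<Rightarrow> real" where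
  "criterion Q \<nu> \<Theta> R0 \<rho> c \<gamma> T \<phi> =
     prob_space.expectation Q (wealth \<nu> \<Theta> R0 \<rho> c T \<phi>)
     - \<gamma> * prob_space.variance Q (wealth \<nu> \<Theta> R0 \<rho> c T \<phi>)"

text \<open>Contracts that agree \<open>\<Theta>\<close>-almost everywhere are the same contract, so uniqueness of the optimal
  contract is meant up to \<open>\<Theta>\<close>-null sets.\<close>

definition is_the_optimal_contract ::
    "real measure \<Rightarrow> ((real \<Rightarrow> real) \<Rightarrow> real) \<Rightarrow> (real \<Rightarrow> real) \<Rightarrow> bool" where
  "is_the_optimal_contract \<Theta> U \<phi> \<longleftrightarrow>
     is_arg_max U (\<lambda>h. h \<in> contracts \<Theta>) \<phi> \<and>
     (\<forall>h. is_arg_max U (\<lambda>h. h \<in> contracts \<Theta>) h \<longrightarrow> (AE z in \<Theta>. h z = \<phi> z))"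

definition threshold_contract :: "real \<Rightarrow> real \<Rightarrow> real \<Rightarrow> real" where
  "threshold_contract a b z = min z (b / (b - a) * max (z - a) 0)"

definition measure_support :: "real measure \<Rightarrow> real set" where
  "measure_support \<Theta> =
     {z \<in> space \<Theta>. \<forall>U. open U \<and> z \<in> U \<longrightarrow> emeasure \<Theta> (U \<inter> space \<Theta>) > 0}"

end

theory Submission
  imports Defs
begin

text \<open>The insurer keeps \<open>g z = z - \<phi> z\<close> of a loss of size \<open>z\<close>, so the terminal wealth is a constant minus the
retained total \<open>N(g)\<close>, the sum of \<open>g\<close> over the losses up to \<open>T\<close>. Write \<open>H[h]\<close> for the integral of \<open>h\<close> against \<open>\<Theta>\<close> and
\<open>\<kappa> = \<beta> - H[f] > 0\<close>.

A unit jump of the intensity at time \<open>s\<close> raises the expected integral of the intensity over \<open>[s,T]\<close> by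
\<open>k(s) = (1 - e^{-\<kappa>(T-s)}) / \<kappa>\<close>. Hence the martingale \<open>E[N(g) | F_t]\<close> jumps by \<open>g(z) + H[g] k(t) \<Lambda> z\<close> when a loss
\<open>z\<close> occurs at time \<open>t\<close>, and its predictable quadratic variation gives
\<open>Var N(g) = \<integral> m(t) H[(g + H[g] k(t) f)^2] dt = M H[g^2] + B \<Lambda> H[g] H[z g] + V H[g]^2\<close>
with \<open>V = \<Lambda>^2 H[z^2] \<integral> k(t)^2 m(t) dt\<close>
(\<open>loss_moments\<close>, \<open>qform_eq\<close>, \<open>B_coeff_eq\<close>). Stochastic integration is avoided. The martingale at \<open>T\<close> is \<open>A - C\<close>
with \<open>A\<close> a sum over the losses and \<open>C\<close> its compensator, and each of \<open>A^2\<close>, \<open>A C\<close>, \<open>C^2\<close> splits according to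
which of its two time variables comes last. Every piece is then a nonnegative integral of a predictable process, to
which the defining identity of the compensator applies; the cross terms cancel in \<open>E[(A - C)^2]\<close>. The
predictability of sums over strictly past losses is \<open>predictable_past_sum\<close>. The cancellation needs second moments,
which come from a Gronwall argument for the total past loss truncated at a level (\<open>past_claims_second_moment\<close>).
The given intensity is almost surely equal, at all times at once, to the explicit solution of its linear equation
(\<open>lam_eq_rate\<close>), and the explicit solution is visibly a predictable process.

The product \<open>H[g] H[z g]\<close> is indefinite, but the variance as a whole is an average of squares, and \<open>k(T) = 0\<close>
makes it positive definite (\<open>qform_definite\<close>). The criterion is therefore strictly concave in \<open>g\<close>, and its
maximiser is determined by a pointwise first-order condition: \<open>g\<close> is the affine function \<open>q - p z\<close> clipped to
\<open>[0,z]\<close>, where \<open>2 M p = B \<Lambda> H[g]\<close> and \<open>2 M q = (c T - M)/\<gamma> - B \<Lambda> H[z g] - 2 V H[g]\<close>. Brouwer's theorem solves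
these two equations for \<open>(p,q)\<close> (\<open>layer_fixed_point\<close>). The positive loading forces \<open>q > 0\<close>, losses away from \<open>0\<close>
force \<open>p > 0\<close>, and \<open>a = q/(1+p)\<close>, \<open>b = q/p\<close> turn the clipped function into the stated contract; the equation for
\<open>p\<close> is the equation for the thresholds.\<close>

section \<open>Sums over the points of a marked point process\<close>

text \<open>The discrete integration by parts: in a square, each pair of terms is counted at its later index.\<close>

lemma power2_suminf_ennreal:
  fixes a :: "nat \<Rightarrow> ennreal"
  shows "(\<Sum>i. a i)\<^sup>2 = (\<Sum>i. 2 * (\<Sum>j<i. a j) * a i + (a i)\<^sup>2)"
proof -
  have partial: "(\<Sum>i<n. a i)\<^sup>2 = (\<Sum>i<n. 2 * (\<Sum>j<i. a j) * a i + (a i)\<^sup>2)" for n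
    by (induction n) (auto simp: power2_eq_square algebra_simps mult_2)
  have inc: "incseq (\<lambda>n. \<Sum>i<n. a i)"
    by (intro monoI sum_mono2) auto
  have "(\<Sum>i. a i)\<^sup>2 = (SUP m. SUP n. (\<Sum>i<n. a i) * (\<Sum>i<m. a i))"
    by (simp add: suminf_eq_SUP power2_eq_square SUP_mult_left_ennreal SUP_mult_right_ennreal)
  also have "\<dots> = (SUP n. (\<Sum>i<n. a i)\<^sup>2)"
  proof (rule antisym)
    show "(SUP m. SUP n. (\<Sum>i<n. a i) * (\<Sum>i<m. a i)) \<le> (SUP n. (\<Sum>i<n. a i)\<^sup>2)"
    proof (intro SUP_least)
      fix m n :: nat
      have "(\<Sum>i<n. a i) * (\<Sum>i<m. a i) \<le> (\<Sum>i<max m n. a i)\<^sup>2"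
        unfolding power2_eq_square by (intro mult_mono incseqD[OF inc]) auto
      also have "\<dots> \<le> (SUP n. (\<Sum>i<n. a i)\<^sup>2)" by (rule SUP_upper) simp
      finally show "(\<Sum>i<n. a i) * (\<Sum>i<m. a i) \<le> (SUP n. (\<Sum>i<n. a i)\<^sup>2)" .
    qed
    show "(SUP n. (\<Sum>i<n. a i)\<^sup>2) \<le> (SUP m. SUP n. (\<Sum>i<n. a i) * (\<Sum>i<m. a i))"
      by (intro SUP_least) (auto intro!: SUP_upper2 simp: power2_eq_square)
  qed
  also have "\<dots> = (\<Sum>i. 2 * (\<Sum>j<i. a j) * a i + (a i)\<^sup>2)"
    unfolding partial by (rule suminf_eq_SUP[symmetric])
  finally show ?thesis .
qed

context marked_point_process
begin

abbreviation \<nu> :: "'a \<Rightarrow> (real \<times> real) measure" where "\<nu> \<equiv> counting_measure \<tau> Z"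

definition jump :: "(real \<times> real \<Rightarrow> ennreal) \<Rightarrow> nat \<Rightarrow> 'a \<Rightarrow> ennreal" where
  "jump u i \<omega> = (if \<tau> i \<omega> < \<infinity> then u (real_of_ereal (\<tau> i \<omega>), Z i \<omega>) else 0)"

text \<open>The inequality \<open>r < s\<close> is strict, so \<open>s \<mapsto> past_sum u s \<omega>\<close> is left-continuous; evaluated at the time of a
loss it contains only the earlier losses.\<close>

definition past_sum :: "(real \<times> real \<Rightarrow> ennreal) \<Rightarrow> real \<Rightarrow> 'a \<Rightarrow> ennreal" where
  "past_sum u s \<omega> = (\<integral>\<^sup>+ x. u x * indicator {..<s} (fst x) \<partial>\<nu> \<omega>)"

lemma real_time:
  assumes "\<omega> \<in> space Q" "\<tau> i \<omega> < \<infinity>"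
  obtains r where "\<tau> i \<omega> = ereal r" "0 < r"
  using time_pos[OF assms(1), of i] assms(2) by (cases "\<tau> i \<omega>") auto

lemma point_space:
  assumes "\<omega> \<in> space Q" "\<tau> i \<omega> < \<infinity>"
  shows "(real_of_ereal (\<tau> i \<omega>), Z i \<omega>) \<in> space (Rplus \<Otimes>\<^sub>M Rplus)"
proof -
  have "Z i \<omega> \<in> space Rplus" using measurable_mark assms(1) by (rule measurable_space)
  moreover obtain r where "\<tau> i \<omega> = ereal r" "0 < r" using real_time[OF assms] .
  ultimately show ?thesis by (simp add: space_pair_measure)
qed

lemma ereal_real_time:
  assumes "\<omega> \<in> space Q" "\<tau> i \<omega> < \<infinity>"
  shows "ereal (real_of_ereal (\<tau> i \<omega>)) = \<tau> i \<omega>"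
proof -
  obtain r where "\<tau> i \<omega> = ereal r" "0 < r" using real_time[OF assms] .
  then show ?thesis by simp
qed

lemma real_time_less_iff:
  assumes "\<omega> \<in> space Q" "\<tau> i \<omega> < \<infinity>"
  shows "real_of_ereal (\<tau> i \<omega>) < s \<longleftrightarrow> \<tau> i \<omega> < ereal s"
  by (subst (2) ereal_real_time[OF assms, symmetric]) simp

lemma sets_counting [measurable_cong, simp]: "sets (\<nu> \<omega>) = sets (Rplus \<Otimes>\<^sub>M Rplus)"
  by (simp add: counting_measure_def)

lemma space_counting [simp]: "space (\<nu> \<omega>) = {0..} \<times> {0..}"
  by (simp add: counting_measure_def space_pair_measure)

lemma point_measurable:
  assumes "\<omega> \<in> space Q"
  shows "(\<lambda>i. (real_of_ereal (\<tau> i \<omega>), Z i \<omega>))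
     \<in> measurable (count_space {i. \<tau> i \<omega> < \<infinity>}) (Rplus \<Otimes>\<^sub>M Rplus)"
  using point_space[OF assms] by (auto simp: measurable_count_space_eq1)

lemma nn_integral_counting:
  assumes "\<omega> \<in> space Q" and [measurable]: "u \<in> borel_measurable (Rplus \<Otimes>\<^sub>M Rplus)"
  shows "(\<integral>\<^sup>+ x. u x \<partial>\<nu> \<omega>) = (\<Sum>i. jump u i \<omega>)"
proof -
  let ?p = "\<lambda>i. (real_of_ereal (\<tau> i \<omega>), Z i \<omega>)"
  have "(\<integral>\<^sup>+ x. u x \<partial>\<nu> \<omega>) = (\<integral>\<^sup>+ i. u (?p i) \<partial>count_space {i. \<tau> i \<omega> < \<infinity>})"
    unfolding counting_measure_def
    by (rule nn_integral_distr[OF point_measurable[OF assms(1)]]) simp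
  also have "\<dots> = (\<integral>\<^sup>+ i. u (?p i) * indicator {i. \<tau> i \<omega> < \<infinity>} i \<partial>count_space UNIV)"
    by (simp add: nn_integral_restrict_space[symmetric] restrict_count_space)
  also have "\<dots> = (\<Sum>i. jump u i \<omega>)"
    unfolding nn_integral_count_space_nat
    by (intro suminf_cong) (auto simp: jump_def)
  finally show ?thesis .
qed

lemma finite_points:
  assumes "\<omega> \<in> space Q"
  shows "finite {i. \<tau> i \<omega> \<le> ereal t}"
proof -
  have "eventually (\<lambda>i. ereal t < \<tau> i \<omega>) sequentially"
    using no_accumulation[OF assms] by (simp add: order_tendsto_iff)
  then obtain N where "\<And>i. N \<le> i \<Longrightarrow> ereal t < \<tau> i \<omega>"
    by (auto simp: eventually_sequentially)
  then have "{i. \<tau> i \<omega> \<le> ereal t} \<subseteq> {..<N}"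
    by (auto simp: not_less intro: leI dest: leD)
  then show ?thesis by (rule finite_subset) simp
qed

lemma measurable_fst_Rplus [measurable]:
  "(\<lambda>x. fst x) \<in> borel_measurable (Rplus \<Otimes>\<^sub>M (Rplus::real measure))"
  by (rule measurable_compose[OF measurable_fst]) (simp add: measurable_restrict_space1)

lemma measurable_past_sum_integrand [measurable]:
  fixes u :: "real \<times> real \<Rightarrow> ennreal"
  assumes [measurable]: "u \<in> borel_measurable (Rplus \<Otimes>\<^sub>M Rplus)"
  shows "(\<lambda>x. u x * indicator {..<s} (fst x)) \<in> borel_measurable (Rplus \<Otimes>\<^sub>M Rplus)"
proof -
  have [measurable]: "(\<lambda>x. indicator {..<s} (fst x) :: ennreal) \<in> borel_measurable (Rplus \<Otimes>\<^sub>M Rplus)"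
    by (rule measurable_compose[OF measurable_fst_Rplus]) simp
  show ?thesis by measurable
qed

lemma past_sum_suminf:
  assumes "\<omega> \<in> space Q" "u \<in> borel_measurable (Rplus \<Otimes>\<^sub>M Rplus)"
  shows "past_sum u s \<omega> = (\<Sum>i. jump u i \<omega> * indicator {\<omega>. \<tau> i \<omega> < ereal s} \<omega>)"
  unfolding past_sum_def
  by (subst nn_integral_counting[OF assms(1) measurable_past_sum_integrand[OF assms(2)]])
     (intro suminf_cong, auto simp: jump_def indicator_def real_time_less_iff[OF assms(1)])

text \<open>Points do not accumulate, so only finitely many terms are present.\<close>

lemma past_sum_finite:
  assumes "\<omega> \<in> space Q" "u \<in> borel_measurable (Rplus \<Otimes>\<^sub>M Rplus)"
    and "\<And>x. u x < \<infinity>"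
  shows "past_sum u s \<omega> < \<infinity>"
proof -
  have "past_sum u s \<omega> = (\<Sum>i\<in>{i. \<tau> i \<omega> \<le> ereal s}. jump u i \<omega> * indicator {\<omega>. \<tau> i \<omega> < ereal s} \<omega>)"
    unfolding past_sum_suminf[OF assms(1,2)]
    by (rule suminf_finite) (auto simp: finite_points[OF assms(1)])
  also have "\<dots> < \<infinity>"
    using assms(3) finite_points[OF assms(1)]
    unfolding infinity_ennreal_def by (subst ennreal_sum_less_top) (auto simp: jump_def indicator_def)
  finally show ?thesis .
qed

lemma past_sum_mono: "s \<le> t \<Longrightarrow> past_sum u s \<omega> \<le> past_sum u t \<omega>"
  unfolding past_sum_def by (intro nn_integral_mono) (auto simp: indicator_def)

lemma time_less_iff:
  assumes "\<omega> \<in> space Q" "\<tau> i \<omega> < \<infinity>"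
  shows "\<tau> j \<omega> < \<tau> i \<omega> \<longleftrightarrow> j < i"
proof -
  have mono: "\<tau> m \<omega> \<le> \<tau> n \<omega>" if "m \<le> n" for m n
    using that by (rule lift_Suc_mono_le[of "\<lambda>i. \<tau> i \<omega>", OF time_mono[OF assms(1)]])
  show ?thesis
  proof
    assume "\<tau> j \<omega> < \<tau> i \<omega>"
    then show "j < i" using mono[of i j] by (meson leD not_le_imp_less)
  next
    assume "j < i"
    then have "\<tau> j \<omega> < \<infinity>" using mono[of j i] assms(2) by auto
    then have "\<tau> j \<omega> < \<tau> (Suc j) \<omega>" by (rule time_strict[OF assms(1)])
    also have "\<dots> \<le> \<tau> i \<omega>" using \<open>j < i\<close> by (intro mono) simp
    finally show "\<tau> j \<omega> < \<tau> i \<omega>" .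
  qed
qed

lemma past_sum_at_point:
  assumes "\<omega> \<in> space Q" "\<tau> i \<omega> < \<infinity>" "u \<in> borel_measurable (Rplus \<Otimes>\<^sub>M Rplus)"
  shows "past_sum u (real_of_ereal (\<tau> i \<omega>)) \<omega> = (\<Sum>j<i. jump u j \<omega>)"
proof -
  note ereal_real_time[OF assms(1,2)]
  then have "past_sum u (real_of_ereal (\<tau> i \<omega>)) \<omega> = (\<Sum>j. jump u j \<omega> * (if j < i then 1 else 0))"
    unfolding past_sum_suminf[OF assms(1,3)]
    by (intro suminf_cong) (auto simp: indicator_def time_less_iff[OF assms(1,2)])
  also have "\<dots> = (\<Sum>j<i. jump u j \<omega>)"
    by (subst suminf_finite[of "{..<i}"]) auto
  finally show ?thesis .
qed

lemma measurable_past_sum_time [measurable]: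
  assumes "\<omega> \<in> space Q" "u \<in> borel_measurable (Rplus \<Otimes>\<^sub>M Rplus)"
  shows "(\<lambda>s. past_sum u s \<omega>) \<in> borel_measurable borel"
proof -
  have "(\<lambda>s. jump u i \<omega> * indicator {\<omega>. \<tau> i \<omega> < ereal s} \<omega>) \<in> borel_measurable borel" for i
  proof -
    have *: "{s. \<tau> i \<omega> < ereal s} \<in> sets borel" by measurable
    have "(\<lambda>s. jump u i \<omega> * indicator {s. \<tau> i \<omega> < ereal s} s) \<in> borel_measurable borel"
      using * by measurable
    then show ?thesis by (simp add: indicator_def)
  qed
  then show ?thesis unfolding past_sum_suminf[OF assms] by measurable
qed

text \<open>The change of the square of a pure jump process, summed over its jumps. No two points share a time,
hence the sum before point \<open>i\<close> is the sum over the smaller indices.\<close>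

lemma nn_integral_counting_square:
  assumes \<omega>: "\<omega> \<in> space Q" and [measurable]: "u \<in> borel_measurable (Rplus \<Otimes>\<^sub>M Rplus)"
  shows "(\<integral>\<^sup>+ x. u x \<partial>\<nu> \<omega>)\<^sup>2 = (\<integral>\<^sup>+ x. 2 * past_sum u (fst x) \<omega> * u x + (u x)\<^sup>2 \<partial>\<nu> \<omega>)"
proof -
  note [measurable] = measurable_past_sum_time[OF \<omega>]
  have "(\<integral>\<^sup>+ x. u x \<partial>\<nu> \<omega>)\<^sup>2 = (\<Sum>i. 2 * (\<Sum>j<i. jump u j \<omega>) * jump u i \<omega> + (jump u i \<omega>)\<^sup>2)"
    by (simp add: nn_integral_counting[OF \<omega>] power2_suminf_ennreal)
  also have "\<dots> = (\<Sum>i. jump (\<lambda>x. 2 * past_sum u (fst x) \<omega> * u x + (u x)\<^sup>2) i \<omega>)"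
    using past_sum_at_point[OF \<omega>, of _ u] by (intro suminf_cong) (simp add: jump_def)
  also have "\<dots> = (\<integral>\<^sup>+ x. 2 * past_sum u (fst x) \<omega> * u x + (u x)\<^sup>2 \<partial>\<nu> \<omega>)"
    by (rule nn_integral_counting[OF \<omega>, symmetric]) measurable
  finally show ?thesis .
qed

abbreviation leb :: "real measure" where "leb \<equiv> restrict_space lborel {0..}"

lemma measurable_tail_integrals:
  assumes [measurable]: "w \<in> borel_measurable leb"
  shows "(\<lambda>x. \<integral>\<^sup>+ s. w s * indicator {..fst x} s \<partial>leb) \<in> borel_measurable (Rplus \<Otimes>\<^sub>M (Rplus :: real measure))"
    and "(\<lambda>x. \<integral>\<^sup>+ s. w s * indicator {fst x<..} s \<partial>leb) \<in> borel_measurable (Rplus \<Otimes>\<^sub>M (Rplus :: real measure))"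
proof -
  interpret sigma_finite_measure leb
    by (rule sigma_finite_measure_restrict_space) (auto simp: lborel.sigma_finite_measure_axioms)
  have [measurable]: "(\<lambda>x. snd x) \<in> borel_measurable (borel \<Otimes>\<^sub>M leb)"
    by (rule measurable_compose[OF measurable_snd]) (simp add: measurable_restrict_space1)
  have "(\<lambda>(t,s). w s * indicator {x. snd x \<le> fst x} (t,s)) \<in> borel_measurable (borel \<Otimes>\<^sub>M leb)"
    "(\<lambda>(t,s). w s * indicator {x. fst x < snd x} (t,s)) \<in> borel_measurable (borel \<Otimes>\<^sub>M leb)"
    by measurable
  then have "(\<lambda>t. \<integral>\<^sup>+ s. w s * indicator {x. snd x \<le> fst x} (t,s) \<partial>leb) \<in> borel_measurable borel"
    "(\<lambda>t. \<integral>\<^sup>+ s. w s * indicator {x. fst x < snd x} (t,s) \<partial>leb) \<in> borel_measurable borel"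
    by (auto intro!: borel_measurable_nn_integral)
  then have [measurable]: "(\<lambda>t. \<integral>\<^sup>+ s. w s * indicator {..t} s \<partial>leb) \<in> borel_measurable borel"
    "(\<lambda>t. \<integral>\<^sup>+ s. w s * indicator {t<..} s \<partial>leb) \<in> borel_measurable borel"
    by (simp_all add: indicator_def)
  show "(\<lambda>x. \<integral>\<^sup>+ s. w s * indicator {..fst x} s \<partial>leb) \<in> borel_measurable (Rplus \<Otimes>\<^sub>M (Rplus :: real measure))"
    and "(\<lambda>x. \<integral>\<^sup>+ s. w s * indicator {fst x<..} s \<partial>leb) \<in> borel_measurable (Rplus \<Otimes>\<^sub>M (Rplus :: real measure))"
    by measurable
qed

text \<open>Exchange of the sum over the points with the integral over the times after them.\<close>

lemma nn_integral_past_sum: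
  assumes \<omega>: "\<omega> \<in> space Q" and [measurable]: "u \<in> borel_measurable (Rplus \<Otimes>\<^sub>M Rplus)"
    and [measurable]: "w \<in> borel_measurable leb"
  shows "(\<integral>\<^sup>+ s. past_sum u s \<omega> * w s \<partial>leb) =
    (\<integral>\<^sup>+ x. u x * (\<integral>\<^sup>+ s. w s * indicator {fst x<..} s \<partial>leb) \<partial>\<nu> \<omega>)"
proof -
  have [measurable]: "indicator {a<..} \<in> borel_measurable leb" for a :: real
    by (auto intro!: measurable_restrict_space1)
  have "(\<integral>\<^sup>+ s. past_sum u s \<omega> * w s \<partial>leb) =
     (\<integral>\<^sup>+ s. (\<Sum>i. jump u i \<omega> * indicator {\<omega>. \<tau> i \<omega> < ereal s} \<omega> * w s) \<partial>leb)"
    by (intro nn_integral_cong) (simp add: past_sum_suminf[OF \<omega>])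
  also have "\<dots> = (\<Sum>i. (\<integral>\<^sup>+ s. jump u i \<omega> * indicator {\<omega>. \<tau> i \<omega> < ereal s} \<omega> * w s \<partial>leb))"
  proof (rule nn_integral_suminf)
    fix i
    have [measurable]: "{s. \<tau> i \<omega> < ereal s} \<in> sets borel" by measurable
    have [measurable]: "(\<lambda>s. indicator {s. \<tau> i \<omega> < ereal s} s :: ennreal) \<in> borel_measurable leb"
      by (intro measurable_restrict_space1) measurable
    have "(\<lambda>s. jump u i \<omega> * indicator {s. \<tau> i \<omega> < ereal s} s * w s) \<in> borel_measurable leb"
      by measurable
    then show "(\<lambda>s. jump u i \<omega> * indicator {\<omega>. \<tau> i \<omega> < ereal s} \<omega> * w s) \<in> borel_measurable leb"
      by (simp add: indicator_def)
  qed
  also have "\<dots> = (\<Sum>i. jump (\<lambda>x. u x * (\<integral>\<^sup>+ s. w s * indicator {fst x<..} s \<partial>leb)) i \<omega>)"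
  proof (rule suminf_cong)
    fix i
    show "(\<integral>\<^sup>+ s. jump u i \<omega> * indicator {\<omega>. \<tau> i \<omega> < ereal s} \<omega> * w s \<partial>leb) =
       jump (\<lambda>x. u x * (\<integral>\<^sup>+ s. w s * indicator {fst x<..} s \<partial>leb)) i \<omega>" (is "?B = _")
    proof (cases "\<tau> i \<omega> < \<infinity>")
      case True
      obtain r where r: "\<tau> i \<omega> = ereal r" "0 < r" using real_time[OF \<omega> True] .
      have "?B = (\<integral>\<^sup>+ s. jump u i \<omega> * (w s * indicator {r<..} s) \<partial>leb)"
        by (intro nn_integral_cong) (auto simp: r indicator_def)
      also have "\<dots> = jump u i \<omega> * (\<integral>\<^sup>+ s. w s * indicator {r<..} s \<partial>leb)"
        by (rule nn_integral_cmult) measurable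
      finally show ?thesis by (simp add: jump_def r)
    qed (simp add: jump_def)
  qed
  also have "\<dots> = (\<integral>\<^sup>+ x. u x * (\<integral>\<^sup>+ s. w s * indicator {fst x<..} s \<partial>leb) \<partial>\<nu> \<omega>)"
    by (rule nn_integral_counting[OF \<omega>, symmetric]) (use measurable_tail_integrals[OF assms(3)] in measurable)
  finally show ?thesis .
qed

text \<open>Integration by parts for a sum over points and an absolutely continuous increasing process: the time
integral is cut at each point.\<close>

lemma nn_integral_counting_product:
  assumes \<omega>: "\<omega> \<in> space Q" and [measurable]: "u \<in> borel_measurable (Rplus \<Otimes>\<^sub>M Rplus)"
    and [measurable]: "w \<in> borel_measurable leb"
  shows "(\<integral>\<^sup>+ x. u x \<partial>\<nu> \<omega>) * (\<integral>\<^sup>+ s. w s \<partial>leb) =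
     (\<integral>\<^sup>+ x. (\<integral>\<^sup>+ s. w s * indicator {..fst x} s \<partial>leb) * u x \<partial>\<nu> \<omega>)
     + (\<integral>\<^sup>+ s. past_sum u s \<omega> * w s \<partial>leb)"
proof -
  note [measurable] = measurable_tail_integrals[OF assms(3)]
  have [measurable]: "indicator {..a} \<in> borel_measurable leb" "indicator {a<..} \<in> borel_measurable leb"
    for a :: real by (auto intro!: measurable_restrict_space1)
  have halves: "(\<integral>\<^sup>+ s. w s \<partial>leb) = (\<integral>\<^sup>+ s. w s * indicator {..r} s \<partial>leb) + (\<integral>\<^sup>+ s. w s * indicator {r<..} s \<partial>leb)" for r
  proof -
    have "(\<integral>\<^sup>+ s. w s \<partial>leb) = (\<integral>\<^sup>+ s. w s * indicator {..r} s + w s * indicator {r<..} s \<partial>leb)"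
      by (intro nn_integral_cong) (auto simp: indicator_def)
    also have "\<dots> = (\<integral>\<^sup>+ s. w s * indicator {..r} s \<partial>leb) + (\<integral>\<^sup>+ s. w s * indicator {r<..} s \<partial>leb)"
      by (rule nn_integral_add) measurable
    finally show ?thesis .
  qed
  have split: "u x * (\<integral>\<^sup>+ s. w s \<partial>leb) = (\<integral>\<^sup>+ s. w s * indicator {..fst x} s \<partial>leb) * u x
      + u x * (\<integral>\<^sup>+ s. w s * indicator {fst x<..} s \<partial>leb)" for x
    unfolding halves[of "fst x"] by (simp only: distrib_left mult.commute[of _ "u x"])
  have "(\<integral>\<^sup>+ x. u x \<partial>\<nu> \<omega>) * (\<integral>\<^sup>+ s. w s \<partial>leb) =
     (\<integral>\<^sup>+ x. (\<integral>\<^sup>+ s. w s * indicator {..fst x} s \<partial>leb) * u x + u x * (\<integral>\<^sup>+ s. w s * indicator {fst x<..} s \<partial>leb) \<partial>\<nu> \<omega>)"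
    by (subst nn_integral_multc[symmetric]) (auto simp: split intro!: nn_integral_cong)
  then show ?thesis
    by (simp add: nn_integral_add nn_integral_past_sum[OF assms])
qed

end

section \<open>Predictability of sums over past points\<close>

lemma sets_Rplus: "sets Rplus = sigma_sets {0..} (range (\<lambda>a::real. {0..} \<inter> {..a}))"
proof -
  have "sets Rplus = (\<inter>) {0..} ` sigma_sets UNIV (range (\<lambda>a::real. {..a}))"
    by (simp add: sets_restrict_space borel_eq_atMost)
  also have "\<dots> = sigma_sets {0..} ((\<inter>) {0..} ` range (\<lambda>a::real. {..a}))"
  proof (rule sigma_sets_Int)
    have "{0::real..} \<in> sets (sigma UNIV (range (\<lambda>a::real. {..a})))"
      unfolding borel_eq_atMost[symmetric] by simp
    then show "{0::real..} \<in> sigma_sets UNIV (range (\<lambda>a::real. {..a}))" by simp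
  qed simp
  finally show ?thesis by (simp add: image_image)
qed

context marked_point_process
begin

abbreviation "Pred \<equiv> predictable Q F"

lemma space_F: "0 \<le> t \<Longrightarrow> space (F t) = space Q"
  using subalgebra_F by (simp add: subalgebra_def)

lemma sets_F_subset: "0 \<le> t \<Longrightarrow> sets (F t) \<subseteq> sets Q"
  using subalgebra_F by (simp add: subalgebra_def)

lemma predictable_gen:
  "{A \<times> {0} | A. A \<in> sets (F 0)} \<union> {A \<times> {s<..t} | A s t. 0 \<le> s \<and> s \<le> t \<and> A \<in> sets (F s)}
     \<subseteq> Pow (space Q \<times> {0::real..})"
  using sets_F_subset sets.sets_into_space[of _ Q] by fastforce

lemma space_Pred [simp]: "space Pred = space Q \<times> {0..}"
  unfolding predictable_def by (rule space_measure_of[OF predictable_gen])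

lemma sets_Pred: "sets Pred = sigma_sets (space Q \<times> {0..}) ({A \<times> {0} | A. A \<in> sets (F 0)} \<union>
      {A \<times> {s<..t} | A s t. 0 \<le> s \<and> s \<le> t \<and> A \<in> sets (F s)})"
  unfolding predictable_def by (rule sets_measure_of[OF predictable_gen])

lemma predictable_after:
  assumes "0 \<le> q" "B \<in> sets (F q)"
  shows "B \<times> {q<..} \<in> sets Pred"
proof -
  have "B \<times> {q<..q + real n} \<in> sets Pred" for n
    unfolding sets_Pred using assms by (intro sigma_sets.Basic UnI2) fastforce
  then have "(\<Union>n. B \<times> {q<..q + real n}) \<in> sets Pred" by blast
  also have "(\<Union>n. B \<times> {q<..q + real n}) = B \<times> {q<..}"
  proof -
    have "\<exists>n. x \<le> q + real n" for x
      using real_arch_simple[of "x - q"] by (simp add: algebra_simps)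
    then show ?thesis by fastforce
  qed
  finally show ?thesis .
qed

lemma predictable_subset: "sets Pred \<subseteq> sets (Q \<Otimes>\<^sub>M Rplus)"
proof -
  have iv: "{s<..t} \<in> sets Rplus" if "0 \<le> s" for s t :: real
    using that by (auto simp: sets_restrict_space_iff)
  have 0: "{0} \<in> sets (Rplus :: real measure)"
    by (auto simp: sets_restrict_space_iff)
  have sp: "space Q \<times> {0..} = space (Q \<Otimes>\<^sub>M (Rplus :: real measure))"
    by (simp add: space_pair_measure)
  show ?thesis
    unfolding sets_Pred sp
    using iv 0 sets_F_subset by (intro sets.sigma_sets_subset) (auto intro!: pair_measureI)
qed

lemma predictable_imp_measurable:
  assumes "W \<in> measurable Pred M" shows "W \<in> measurable (Q \<Otimes>\<^sub>M Rplus) M"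
  using assms predictable_subset by (auto simp: measurable_def space_pair_measure)

lemma emeasure_counting:
  assumes "\<omega> \<in> space Q" "E \<in> sets (Rplus \<Otimes>\<^sub>M Rplus)"
  shows "emeasure (\<nu> \<omega>) E = (\<Sum>i. jump (indicator E) i \<omega>)"
  using nn_integral_counting[OF assms(1), of "indicator E"] assms(2)
  by simp

text \<open>The elementary left-continuous adapted processes: they start immediately after the time at which they are known.\<close>

lemma predictable_if_after:
  fixes g :: "'a \<Rightarrow> ennreal"
  assumes "0 \<le> q" "g \<in> borel_measurable (F q)"
  shows "(\<lambda>(\<omega>, s). if q < s then g \<omega> else 0) \<in> borel_measurable Pred"
proof (rule measurableI)
  fix S :: "ennreal set" assume "S \<in> sets borel"
  then have 1: "(g -` S \<inter> space Q) \<times> {q<..} \<in> sets Pred"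
    using measurable_sets[OF assms(2)] by (intro predictable_after assms) (simp add: space_F[OF assms(1)])
  have 2: "space Pred - (space Q) \<times> {q<..} \<in> sets Pred"
    using predictable_after[OF assms(1), of "space Q"] space_F[OF assms(1)] sets.top[of "F q"]
    by (intro sets.compl_sets) simp
  have "(\<lambda>(\<omega>, s). if q < s then g \<omega> else 0) -` S \<inter> space Pred =
     (g -` S \<inter> space Q) \<times> {q<..} \<union> (if 0 \<in> S then space Pred - (space Q) \<times> {q<..} else {})"
    using assms(1) by (auto split: if_splits)
  also have "\<dots> \<in> sets Pred" using 1 2 by auto
  finally show "(\<lambda>(\<omega>, s). if q < s then g \<omega> else 0) -` S \<inter> space Pred \<in> sets Pred" .
qed simp

text \<open>The process is a countable supremum of elementary ones. Only finitely many points precede \<open>s\<close>, so some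
rational \<open>q < s\<close> has already seen all of them.\<close>

lemma predictable_count_rectangle:
  assumes A: "A \<in> sets Rplus"
  shows "(\<lambda>(\<omega>, s). emeasure (\<nu> \<omega>) ((({0..} \<inter> {..b}) \<times> A) \<inter> {x. fst x < s})) \<in> borel_measurable Pred"
proof -
  let ?I = "{q \<in> \<rat>. 0 \<le> q}"
  let ?g = "\<lambda>q \<omega>. emeasure (\<nu> \<omega>) ({0<..min q b} \<times> A)"
  have Rm: "X \<in> sets (Rplus :: real measure)" if "X \<in> sets borel" "X \<subseteq> {0..}" for X :: "real set"
    using that by (auto simp: sets_restrict_space_iff)
  have g: "?g q \<in> borel_measurable (F q)" if "0 \<le> q" for q
  proof (cases "0 \<le> min q b")
    case True
    have "?g q \<in> borel_measurable (F (min q b))" by (rule adapted[OF True A])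
    moreover have "subalgebra (F q) (F (min q b))"
      unfolding subalgebra_def using mono_F[OF True] space_F[OF True] space_F[OF that] by simp
    ultimately show ?thesis by (rule measurable_from_subalg[rotated])
  next
    case False
    then have "{0<..min q b} \<times> A = {}" by auto
    then show ?thesis by (simp only: emeasure_empty) simp
  qed
  have eq: "emeasure (\<nu> \<omega>) ((({0..} \<inter> {..b}) \<times> A) \<inter> {x. fst x < s}) =
      (SUP q\<in>?I. if q < s then ?g q \<omega> else 0)" (is "emeasure _ ?E = ?R") if "\<omega> \<in> space Q" "0 \<le> s" for \<omega> s
  proof (rule antisym)
    have "?E = ({0..b} \<inter> {..<s}) \<times> A" by auto
    moreover have "{0..b} \<inter> {..<s} \<in> sets (Rplus::real measure)" by (intro Rm) auto
    ultimately have E: "?E \<in> sets (Rplus \<Otimes>\<^sub>M Rplus)"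
      using A by (simp add: pair_measureI)
    have E2: "{0<..min q b} \<times> A \<in> sets (Rplus \<Otimes>\<^sub>M Rplus)" for q
      using A by (intro pair_measureI[OF Rm]) auto
    show "?R \<le> emeasure (\<nu> \<omega>) ?E"
      using E by (intro SUP_least) (auto intro!: emeasure_mono)
    show "emeasure (\<nu> \<omega>) ?E \<le> ?R"
    proof (cases "s = 0")
      case True
      then have "?E = {}" by auto
      then show ?thesis by simp
    next
      case False
      then have s: "0 < s" using that by simp
      define P where "P = insert 0 ((\<lambda>i. real_of_ereal (\<tau> i \<omega>)) ` {i. \<tau> i \<omega> < ereal s})"
      have fin: "finite P"
        unfolding P_def using finite_points[OF that(1), of s]
        by (auto elim!: rev_finite_subset)
      have lt: "\<forall>p\<in>P. p < s"
      proof
        fix p assume "p \<in> P"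
        then consider "p = 0" | i where "p = real_of_ereal (\<tau> i \<omega>)" "\<tau> i \<omega> < ereal s"
          by (auto simp: P_def)
        then show "p < s"
        proof cases
          case 2
          then have "\<tau> i \<omega> < \<infinity>" by auto
          from real_time_less_iff[OF that(1) this, of s] 2 show ?thesis by simp
        qed (use s in simp)
      qed
      have "Max P < s" using fin lt by (subst Max_less_iff) (auto simp: P_def)
      then obtain q where q: "q \<in> \<rat>" "Max P < q" "q < s" using Rats_dense_in_real by blast
      have Pq: "p < q" if "p \<in> P" for p
        using Max_ge[OF fin that] q by linarith
      have q0: "0 < q" by (rule Pq) (simp add: P_def)
      have "emeasure (\<nu> \<omega>) ?E \<le> ?g q \<omega>"
        unfolding emeasure_counting[OF that(1) E] emeasure_counting[OF that(1) E2]
      proof (rule suminf_le)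
        fix i
        show "jump (indicator ?E) i \<omega> \<le> jump (indicator ({0<..min q b} \<times> A)) i \<omega>"
        proof (cases "\<tau> i \<omega> < ereal s")
          case True
          then have "real_of_ereal (\<tau> i \<omega>) < q" by (intro Pq) (auto simp: P_def)
          moreover have "0 < real_of_ereal (\<tau> i \<omega>)" if "\<tau> i \<omega> < \<infinity>"
            using real_time[OF \<open>\<omega> \<in> space Q\<close> that] by (metis real_of_ereal.simps(1))
          ultimately show ?thesis by (auto simp: jump_def indicator_def)
        next
          case False
          then show ?thesis using real_time_less_iff[OF that(1), of i s]
            by (auto simp: jump_def indicator_def)
        qed
      qed auto
      also have "\<dots> = (if q < s then ?g q \<omega> else 0)" using q by simp
      also have "\<dots> \<le> ?R" using q q0 by (intro SUP_upper) auto
      finally show ?thesis .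
    qed
  qed
  have "(\<lambda>x. SUP q\<in>?I. (\<lambda>(\<omega>, s). if q < s then ?g q \<omega> else 0) x) \<in> borel_measurable Pred"
    by (intro borel_measurable_SUP predictable_if_after g)
       (auto intro: countable_subset[OF _ countable_rat])
  then show ?thesis
    by (subst measurable_cong) (auto simp: eq split_beta)
qed

lemma counting_before_finite:
  assumes "\<omega> \<in> space Q" "E \<in> sets (Rplus \<Otimes>\<^sub>M Rplus)"
  shows "emeasure (\<nu> \<omega>) (E \<inter> {x. fst x < s}) = past_sum (indicator E) s \<omega>"
    and "emeasure (\<nu> \<omega>) (E \<inter> {x. fst x < s}) < \<infinity>"
proof -
  have [measurable]: "E \<in> sets (Rplus \<Otimes>\<^sub>M Rplus)" by fact
  have "E \<inter> {x. fst x < s} = {x \<in> space (Rplus \<Otimes>\<^sub>M Rplus). x \<in> E \<and> fst x < s}"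
    using sets.sets_into_space[OF assms(2)] by auto
  also have "\<dots> \<in> sets (Rplus \<Otimes>\<^sub>M Rplus)" by measurable
  finally have "E \<inter> {x. fst x < s} \<in> sets (\<nu> \<omega>)" by simp
  then have "emeasure (\<nu> \<omega>) (E \<inter> {x. fst x < s}) = (\<integral>\<^sup>+ x. indicator (E \<inter> {x. fst x < s}) x \<partial>\<nu> \<omega>)"
    by simp
  also have "\<dots> = past_sum (indicator E) s \<omega>"
    unfolding past_sum_def by (intro nn_integral_cong) (simp add: indicator_def)
  finally show 1: "emeasure (\<nu> \<omega>) (E \<inter> {x. fst x < s}) = past_sum (indicator E) s \<omega>" .
  show "emeasure (\<nu> \<omega>) (E \<inter> {x. fst x < s}) < \<infinity>"
    unfolding 1 by (rule past_sum_finite[OF assms(1)]) (auto simp: indicator_def)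
qed

text \<open>A Dynkin argument from rectangles. Complements are covered because the number of points before \<open>s\<close>
is finite, which allows subtraction.\<close>

lemma predictable_count:
  assumes "E \<in> sets (Rplus \<Otimes>\<^sub>M Rplus)"
  shows "(\<lambda>(\<omega>, s). emeasure (\<nu> \<omega>) (E \<inter> {x. fst x < s})) \<in> borel_measurable Pred"
proof -
  let ?G = "{a \<times> b | a b. a \<in> range (\<lambda>a::real. {0..} \<inter> {..a}) \<and> b \<in> sets (Rplus :: real measure)}"
  let ?S = "{0..} \<times> {0..} :: (real \<times> real) set"
  let ?P = "Rplus \<Otimes>\<^sub>M Rplus :: (real \<times> real) measure"
  have sp: "space ?P = ?S" by (simp add: space_pair_measure)
  have "\<exists>n. x \<le> real n" for x by (rule real_arch_simple)
  then have cover: "(\<Union>n. {0..} \<inter> {..real n}) = {0..}" by auto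
  have sets1: "sets ?P = sets (sigma (space Rplus \<times> space Rplus) ?G)"
  proof (rule sets_pair_eq[where Ca="range (\<lambda>n. {0..} \<inter> {..real n})" and Cb="{space Rplus}"])
    show "\<Union> (range (\<lambda>n. {0..} \<inter> {..real n})) = space Rplus" using cover by simp
    show "sets Rplus = sigma_sets (space Rplus) (range (\<lambda>a::real. {0..} \<inter> {..a}))"
      using sets_Rplus by simp
    show "sets Rplus = sigma_sets (space Rplus) (sets Rplus)"
      by (rule sets.sigma_sets_eq[symmetric])
    show "sets Rplus \<subseteq> Pow (space Rplus)" by (rule sets.space_closed)
    show "{space Rplus} \<subseteq> sets Rplus" by (simp only: sets.top insert_subset) simp
  qed auto
  have "b \<subseteq> {0..}" if "b \<in> sets (Rplus :: real measure)" for b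
    using sets.sets_into_space[OF that] by simp
  then have GP: "?G \<subseteq> Pow ?S" by blast
  have sets: "sets ?P = sigma_sets ?S ?G"
    unfolding sets1 using GP by (simp add: sets_measure_of)
  have stable: "Int_stable ?G"
  proof (rule Int_stableI)
    fix a b assume "a \<in> ?G" "b \<in> ?G"
    then obtain x A y B where ab: "a = ({0..} \<inter> {..x}) \<times> A" "b = ({0..} \<inter> {..y}) \<times> B"
      and AB: "A \<in> sets Rplus" "B \<in> sets Rplus" by blast
    have "a \<inter> b = ({0..} \<inter> {..min x y}) \<times> (A \<inter> B)" unfolding ab by auto
    with AB show "a \<inter> b \<in> ?G" by blast
  qed
  have total: "(\<lambda>(\<omega>, s). emeasure (\<nu> \<omega>) (?S \<inter> {x. fst x < s})) \<in> borel_measurable Pred"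
  proof -
    let ?E = "\<lambda>n. ({0..} \<inter> {..real n}) \<times> {0..}"
    have m: "?E n \<in> sets ?P" for n
      by (intro pair_measureI) (auto simp: sets_restrict_space_iff)
    have "(\<lambda>x. SUP n. (\<lambda>(\<omega>, s). emeasure (\<nu> \<omega>) (?E n \<inter> {x. fst x < s})) x) \<in> borel_measurable Pred"
      by (intro borel_measurable_SUP predictable_count_rectangle) (auto simp: sets_restrict_space_iff)
    moreover have "(SUP n. emeasure (\<nu> \<omega>) (?E n \<inter> {x. fst x < s})) =
        emeasure (\<nu> \<omega>) (?S \<inter> {x. fst x < s})" for \<omega> s
    proof -
      have "(SUP n. emeasure (\<nu> \<omega>) (?E n \<inter> {x. fst x < s})) =
         emeasure (\<nu> \<omega>) (\<Union>n. ?E n \<inter> {x. fst x < s})"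
      proof (rule SUP_emeasure_incseq)
        have "({0..real n} \<inter> {..<s}) \<times> {0..} \<in> sets ?P" for n
          by (intro pair_measureI) (auto simp: sets_restrict_space_iff)
        moreover have "({0..real n} \<inter> {..<s}) \<times> {0..} = ?E n \<inter> {x. fst x < s}" for n by auto
        ultimately have "?E n \<inter> {x. fst x < s} \<in> sets ?P" for n by metis
        then show "range (\<lambda>n. ?E n \<inter> {x. fst x < s}) \<subseteq> sets (\<nu> \<omega>)"
          by (simp only: sets_counting image_subset_iff) simp
        show "incseq (\<lambda>n. ?E n \<inter> {x. fst x < s})"
          by (auto simp: incseq_def)
      qed
      also have "(\<Union>n. ?E n \<inter> {x. fst x < s}) = ?S \<inter> {x. fst x < s}"
        using cover by blast
      finally show ?thesis .
    qed
    ultimately show ?thesis by (simp add: split_beta)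
  qed
  from assms have "E \<in> sigma_sets ?S ?G" unfolding sets .
  from stable GP this show ?thesis
  proof (induction rule: sigma_sets_induct_disjoint)
    case (basic A)
    then show ?case using predictable_count_rectangle by blast
  next
    case empty
    then show ?case by simp
  next
    case (compl A)
    have A: "A \<in> sets ?P" using compl(1) sets by simp
    have "(\<lambda>x. (\<lambda>(\<omega>, s). emeasure (\<nu> \<omega>) (?S \<inter> {x. fst x < s})) x - (\<lambda>(\<omega>, s). emeasure (\<nu> \<omega>) (A \<inter> {x. fst x < s})) x)
       \<in> borel_measurable Pred"
      using total compl(2) by (rule borel_measurable_minus_ennreal)
    moreover have "emeasure (\<nu> \<omega>) (?S \<inter> {x. fst x < s}) - emeasure (\<nu> \<omega>) (A \<inter> {x. fst x < s})
       = emeasure (\<nu> \<omega>) ((?S - A) \<inter> {x. fst x < s})" if "\<omega> \<in> space Q" for \<omega> s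
    proof -
      have [measurable]: "A \<in> sets ?P" by fact
      have "A \<inter> {x. fst x < s} = {x \<in> space ?P. x \<in> A \<and> fst x < s}"
        using sets.sets_into_space[OF A] by auto
      also have "\<dots> \<in> sets ?P" by measurable
      finally have Am: "A \<inter> {x. fst x < s} \<in> sets ?P" .
      have "?S \<inter> {x. fst x < s} = {x \<in> space ?P. fst x < s}"
        by (auto simp: sp)
      also have "\<dots> \<in> sets ?P" by measurable
      finally have Sm: "?S \<inter> {x. fst x < s} \<in> sets ?P" .
      have "emeasure (\<nu> \<omega>) (?S \<inter> {x. fst x < s} - A \<inter> {x. fst x < s}) =
         emeasure (\<nu> \<omega>) (?S \<inter> {x. fst x < s}) - emeasure (\<nu> \<omega>) (A \<inter> {x. fst x < s})"
        using sets.sets_into_space[OF A] counting_before_finite(2)[OF that A, of s] Am Sm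
        by (intro emeasure_Diff) (auto simp: sp)
      also have "?S \<inter> {x. fst x < s} - A \<inter> {x. fst x < s} = (?S - A) \<inter> {x. fst x < s}" by auto
      finally show ?thesis ..
    qed
    ultimately show ?case by (subst measurable_cong) (auto simp: split_beta)
  next
    case (union A)
    have "(\<lambda>x. \<Sum>i. (\<lambda>(\<omega>, s). emeasure (\<nu> \<omega>) (A i \<inter> {x. fst x < s})) x) \<in> borel_measurable Pred"
      using union by (intro borel_measurable_suminf_order) auto
    moreover have "(\<Sum>i. emeasure (\<nu> \<omega>) (A i \<inter> {x. fst x < s})) =
       emeasure (\<nu> \<omega>) (\<Union> (range A) \<inter> {x. fst x < s})" for \<omega> s
    proof -
      have m: "A i \<inter> {x. fst x < s} \<in> sets ?P" for i
      proof -
        have A[measurable]: "A i \<in> sets ?P" using union(2) sets by auto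
        have "A i \<inter> {x. fst x < s} = {x \<in> space ?P. x \<in> A i \<and> fst x < s}"
          using sets.sets_into_space[OF A] by auto
        also have "\<dots> \<in> sets ?P" by measurable
        finally show ?thesis .
      qed
      have "(\<Sum>i. emeasure (\<nu> \<omega>) (A i \<inter> {x. fst x < s})) = emeasure (\<nu> \<omega>) (\<Union>i. A i \<inter> {x. fst x < s})"
        using union(1) m by (intro suminf_emeasure) (auto simp: disjoint_family_on_def)
      also have "(\<Union>i. A i \<inter> {x. fst x < s}) = \<Union> (range A) \<inter> {x. fst x < s}" by auto
      finally show ?thesis .
    qed
    ultimately show ?case by (simp add: split_beta)
  qed
qed

text \<open>This is what makes the compensator identity applicable to products of a loss with the past of the
process.\<close>

lemma predictable_past_sum:
  assumes "u \<in> borel_measurable (Rplus \<Otimes>\<^sub>M Rplus)"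
  shows "(\<lambda>(\<omega>, s). past_sum u s \<omega>) \<in> borel_measurable Pred"
  using assms
proof (induction rule: borel_measurable_induct)
  case (cong f g)
  have "past_sum f s \<omega> = past_sum g s \<omega>" for s \<omega>
    unfolding past_sum_def using cong(3) by (intro nn_integral_cong) (simp add: space_pair_measure)
  then show ?case using cong by simp
next
  case (set A)
  then show ?case
    using predictable_count[OF set]
    by (subst measurable_cong[of _ _ "\<lambda>(\<omega>, s). emeasure (\<nu> \<omega>) (A \<inter> {x. fst x < s})"])
       (auto simp: counting_before_finite(1))
next
  case (mult u c)
  have "past_sum (\<lambda>x. c * u x) s \<omega> = c * past_sum u s \<omega>" for s \<omega>
    unfolding past_sum_def using mult(2) by (subst nn_integral_cmult[symmetric]) (auto simp: mult.assoc)
  then show ?case using mult by (simp add: split_beta)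
next
  case (add u v)
  have "past_sum (\<lambda>x. v x + u x) s \<omega> = past_sum v s \<omega> + past_sum u s \<omega>" for s \<omega>
    unfolding past_sum_def using add by (subst nn_integral_add[symmetric]) (auto simp: distrib_right)
  then show ?case using add by (simp add: split_beta)
next
  case (seq U)
  have [measurable]: "U i \<in> borel_measurable (Rplus \<Otimes>\<^sub>M Rplus)" for i by (rule seq)
  have "past_sum (\<lambda>x. SUP i. U i x) s \<omega> = (SUP i. past_sum (U i) s \<omega>)" for s \<omega>
  proof -
    have "past_sum (\<lambda>x. SUP i. U i x) s \<omega> = (\<integral>\<^sup>+ x. (SUP i. U i x * indicator {..<s} (fst x)) \<partial>\<nu> \<omega>)"
      unfolding past_sum_def by (simp add: SUP_mult_right_ennreal)
    also have "\<dots> = (SUP i. past_sum (U i) s \<omega>)"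
      unfolding past_sum_def using seq(3)
      by (intro nn_integral_monotone_convergence_SUP)
         (auto simp: incseq_def le_fun_def intro!: mult_right_mono)
    finally show ?thesis .
  qed
  moreover have "(\<lambda>x. SUP i. (\<lambda>(\<omega>, s). past_sum (U i) s \<omega>) x) \<in> borel_measurable Pred"
    using seq by (intro borel_measurable_SUP) auto
  ultimately show ?case by (simp add: split_beta image_comp SUP_apply[abs_def])
qed

lemma mark_nonneg: "\<omega> \<in> space Q \<Longrightarrow> 0 \<le> Z i \<omega>"
  using measurable_space[OF measurable_mark] by fastforce

lemma past_sum_eq_sum:
  fixes v :: "real \<times> real \<Rightarrow> real"
  assumes \<omega>: "\<omega> \<in> space Q" and [measurable]: "v \<in> borel_measurable (Rplus \<Otimes>\<^sub>M Rplus)"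
    and v: "\<And>x. x \<in> space (Rplus \<Otimes>\<^sub>M Rplus) \<Longrightarrow> 0 \<le> v x"
  shows "past_sum (\<lambda>x. ennreal (v x)) t \<omega> = ennreal (\<Sum>i\<in>{i \<in> {i. \<tau> i \<omega> < \<infinity>}. real_of_ereal (\<tau> i \<omega>) < t}.
     v (real_of_ereal (\<tau> i \<omega>), Z i \<omega>))"
    and "finite {i \<in> {i. \<tau> i \<omega> < \<infinity>}. real_of_ereal (\<tau> i \<omega>) < t}"
proof -
  let ?N = "{i \<in> {i. \<tau> i \<omega> < \<infinity>}. real_of_ereal (\<tau> i \<omega>) < t}"
  have "?N \<subseteq> {i. \<tau> i \<omega> \<le> ereal t}"
    using real_time_less_iff[OF \<omega>] by (auto intro: less_imp_le)
  then show fin: "finite ?N" using finite_points[OF \<omega>] by (rule finite_subset)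
  have "past_sum (\<lambda>x. ennreal (v x)) t \<omega> = (\<Sum>i\<in>?N. ennreal (v (real_of_ereal (\<tau> i \<omega>), Z i \<omega>)))"
  proof -
    have "past_sum (\<lambda>x. ennreal (v x)) t \<omega> = (\<Sum>i. jump (\<lambda>x. ennreal (v x)) i \<omega> * indicator {\<omega>. \<tau> i \<omega> < ereal t} \<omega>)"
      by (rule past_sum_suminf[OF \<omega>]) measurable
    also have "\<dots> = (\<Sum>i\<in>?N. jump (\<lambda>x. ennreal (v x)) i \<omega> * indicator {\<omega>. \<tau> i \<omega> < ereal t} \<omega>)"
      using fin real_time_less_iff[OF \<omega>] by (intro suminf_finite) (auto simp: jump_def)
    also have "\<dots> = (\<Sum>i\<in>?N. ennreal (v (real_of_ereal (\<tau> i \<omega>), Z i \<omega>)))"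
      using real_time_less_iff[OF \<omega>] by (intro sum.cong) (auto simp: jump_def)
    finally show ?thesis .
  qed
  also have "\<dots> = ennreal (\<Sum>i\<in>?N. v (real_of_ereal (\<tau> i \<omega>), Z i \<omega>))"
    using v point_space[OF \<omega>] by (intro sum_ennreal) auto
  finally show "past_sum (\<lambda>x. ennreal (v x)) t \<omega> = ennreal (\<Sum>i\<in>?N. v (real_of_ereal (\<tau> i \<omega>), Z i \<omega>))" .
qed

lemma measurable_snd_Rplus [measurable]:
  "(\<lambda>x. snd x) \<in> borel_measurable ((Rplus::real measure) \<Otimes>\<^sub>M Rplus)"
  by (rule measurable_compose[OF measurable_snd]) (simp add: measurable_restrict_space1)

lemma measurable_id_predictable: "(\<lambda>x. x) \<in> measurable (Q \<Otimes>\<^sub>M Rplus) Pred"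
  by (rule predictable_imp_measurable) simp

lemma measurable_predictable_times:
  assumes "W \<in> measurable (Pred \<Otimes>\<^sub>M Rplus) M"
  shows "W \<in> measurable ((Q \<Otimes>\<^sub>M Rplus) \<Otimes>\<^sub>M Rplus) M"
proof -
  have "(\<lambda>x. (fst x, snd x)) \<in> measurable ((Q \<Otimes>\<^sub>M Rplus) \<Otimes>\<^sub>M Rplus) (Pred \<Otimes>\<^sub>M Rplus)"
    by (intro measurable_Pair measurable_compose[OF measurable_fst measurable_id_predictable] measurable_snd)
  then have "(\<lambda>x. x) \<in> measurable ((Q \<Otimes>\<^sub>M Rplus) \<Otimes>\<^sub>M Rplus) (Pred \<Otimes>\<^sub>M Rplus)" by simp
  from measurable_compose[OF this assms] show ?thesis .
qed

lemma measurable_time_predictable: "(\<lambda>x. snd x) \<in> measurable Pred Rplus"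
proof (rule measurable_restrict_space2)
  show "(\<lambda>x. snd x) \<in> borel_measurable Pred"
  proof (rule borel_measurableI_greater)
    fix a :: real
    show "{x \<in> space Pred. a < snd x} \<in> sets Pred"
    proof (cases "0 \<le> a")
      case True
      then have "space Q \<times> {a<..} \<in> sets Pred"
        using sets.top[of "F a"] by (intro predictable_after) (auto simp: space_F)
      also have "space Q \<times> {a<..} = {x \<in> space Pred. a < snd x}" using True by auto
      finally show ?thesis .
    next
      case False
      then have "{x \<in> space Pred. a < snd x} = space Pred" by auto
      then show ?thesis by (metis sets.top)
    qed
  qed
qed auto

lemma measurable_time_predictable': "(\<lambda>x. snd x) \<in> borel_measurable Pred"
  using measurable_time_predictable by (simp add: measurable_restrict_space2_iff)

lemma measurable_predictable_fst_pair:
  assumes "(\<lambda>(\<omega>, s). X s \<omega>) \<in> borel_measurable Pred"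
  shows "(\<lambda>x. X (snd (fst x)) (fst (fst x))) \<in> borel_measurable (Pred \<Otimes>\<^sub>M (Rplus :: real measure))"
  using measurable_compose[OF measurable_fst assms] by (simp add: split_beta')

lemma measurable_det_predictable_pair:
  assumes "u \<in> borel_measurable (Rplus \<Otimes>\<^sub>M Rplus)"
  shows "(\<lambda>x. u (snd (fst x), snd x)) \<in> borel_measurable (Pred \<Otimes>\<^sub>M (Rplus :: real measure))"
proof -
  have "(\<lambda>x. (snd (fst x), snd x)) \<in> measurable (Pred \<Otimes>\<^sub>M (Rplus :: real measure)) (Rplus \<Otimes>\<^sub>M Rplus)"
    by (intro measurable_Pair measurable_compose[OF measurable_fst measurable_time_predictable] measurable_snd)
  from measurable_compose[OF this assms] show ?thesis .
qed

lemma measurable_omega_predictable: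
  assumes "(\<lambda>(\<omega>, s). X s \<omega>) \<in> borel_measurable Pred" "0 \<le> s"
  shows "(\<lambda>\<omega>. X s \<omega>) \<in> borel_measurable Q"
proof -
  have "(\<lambda>\<omega>. (\<omega>, s)) \<in> measurable Q (Q \<Otimes>\<^sub>M Rplus)"
    using assms(2) by (intro measurable_Pair) auto
  from measurable_compose[OF this predictable_imp_measurable[OF assms(1)]] show ?thesis by simp
qed

lemma past_sum_mono_fun:
  assumes "\<And>r z. 0 \<le> r \<Longrightarrow> r < s \<Longrightarrow> 0 \<le> z \<Longrightarrow> u (r, z) \<le> v (r, z)"
  shows "past_sum u s \<omega> \<le> past_sum v s \<omega>"
  unfolding past_sum_def using assms by (intro nn_integral_mono) (auto simp: indicator_def)

lemma past_sum_cmult: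
  assumes [measurable]: "u \<in> borel_measurable (Rplus \<Otimes>\<^sub>M Rplus)"
  shows "past_sum (\<lambda>x. c * u x) s \<omega> = c * past_sum u s \<omega>"
  unfolding past_sum_def by (subst nn_integral_cmult[symmetric]) (auto simp: mult.assoc)

text \<open>Integrands that depend on the past of the process still give random variables after summation over the points.\<close>

lemma measurable_counting_integral:
  assumes X: "(\<lambda>(\<omega>, s). X s \<omega>) \<in> borel_measurable Pred"
    and u[measurable]: "u \<in> borel_measurable (Rplus \<Otimes>\<^sub>M Rplus)"
  shows "(\<lambda>\<omega>. \<integral>\<^sup>+ x. X (fst x) \<omega> * u x \<partial>\<nu> \<omega>) \<in> borel_measurable Q"
proof -
  have XQ: "(\<lambda>x. X (snd x) (fst x)) \<in> borel_measurable (Q \<Otimes>\<^sub>M Rplus)"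
    using predictable_imp_measurable[OF X] by (simp add: split_beta')
  have eq: "(\<integral>\<^sup>+ x. X (fst x) \<omega> * u x \<partial>\<nu> \<omega>) = (\<Sum>i. jump (\<lambda>x. X (fst x) \<omega> * u x) i \<omega>)"
    if \<omega>: "\<omega> \<in> space Q" for \<omega>
  proof (rule nn_integral_counting[OF \<omega>])
    have "(\<lambda>s. X s \<omega>) \<in> borel_measurable Rplus"
      using measurable_compose[OF measurable_Pair1'[OF \<omega>] XQ] by simp
    then have [measurable]: "(\<lambda>x. X (fst x) \<omega>) \<in> borel_measurable (Rplus \<Otimes>\<^sub>M (Rplus :: real measure))"
      by (rule measurable_compose[OF measurable_fst])
    show "(\<lambda>x. X (fst x) \<omega> * u x) \<in> borel_measurable (Rplus \<Otimes>\<^sub>M Rplus)" by measurable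
  qed
  have "(\<lambda>\<omega>. jump (\<lambda>x. X (fst x) \<omega> * u x) i \<omega>) \<in> borel_measurable Q" for i
  proof -
    have [measurable]: "\<tau> i \<in> borel_measurable Q" by (rule measurable_time)
    have t: "(\<lambda>\<omega>. real_of_ereal (\<tau> i \<omega>)) \<in> measurable Q Rplus"
    proof (rule measurable_restrict_space2)
      show "(\<lambda>\<omega>. real_of_ereal (\<tau> i \<omega>)) \<in> space Q \<rightarrow> {0..}"
        using real_of_ereal_pos[OF less_imp_le[OF time_pos]] by auto
    qed measurable
    have "(\<lambda>\<omega>. (\<omega>, real_of_ereal (\<tau> i \<omega>))) \<in> measurable Q (Q \<Otimes>\<^sub>M Rplus)"
      by (intro measurable_Pair t) simp
    from measurable_compose[OF this XQ]
    have [measurable]: "(\<lambda>\<omega>. X (real_of_ereal (\<tau> i \<omega>)) \<omega>) \<in> borel_measurable Q" by simp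
    have [measurable]: "(\<lambda>\<omega>. u (real_of_ereal (\<tau> i \<omega>), Z i \<omega>)) \<in> borel_measurable Q"
      by (rule measurable_compose[OF measurable_Pair[OF t measurable_mark] u])
    show ?thesis unfolding jump_def fst_conv by measurable
  qed
  then have "(\<lambda>\<omega>. \<Sum>i. jump (\<lambda>x. X (fst x) \<omega> * u x) i \<omega>) \<in> borel_measurable Q" by measurable
  then show ?thesis by (rule measurable_cong[THEN iffD1, rotated]) (simp add: eq)
qed

end

section \<open>Gronwall estimate and the linear intensity equation\<close>

text \<open>Integrating the hypothesis against the weight \<open>e^{-2 K s}\<close> bounds the weighted integral of \<open>u\<close> by \<open>C T\<close> plus
half of itself; finiteness of the integral is what allows the half to be subtracted. The constant is not sharp.\<close>

lemma gronwall_ennreal: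
  fixes u :: "real \<Rightarrow> ennreal" and C K T :: real
  assumes [measurable]: "u \<in> borel_measurable borel"
    and C: "0 \<le> C" and K: "0 < K"
    and bound: "\<And>t. 0 \<le> t \<Longrightarrow> t \<le> T \<Longrightarrow>
        u t \<le> ennreal C + ennreal K * (\<integral>\<^sup>+ s. u s * indicator {0..t} s \<partial>lborel)"
    and fin: "(\<integral>\<^sup>+ s. u s * indicator {0..T} s \<partial>lborel) < \<infinity>"
    and t: "0 \<le> t" "t \<le> T"
  shows "u t \<le> ennreal (C * (1 + 2 * K * T * exp (2 * K * T)))"
proof -
  define e where "e s = ennreal (exp (- (2 * K) * s))" for s
  have [measurable]: "e \<in> borel_measurable borel" unfolding e_def by measurable
  let ?A = "\<integral>\<^sup>+ s. e s * u s * indicator {0..T} s \<partial>lborel"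
  have T: "0 \<le> T" using t by linarith
  have A_fin: "?A < \<infinity>"
  proof -
    have "?A \<le> (\<integral>\<^sup>+ s. u s * indicator {0..T} s \<partial>lborel)"
    proof (rule nn_integral_mono)
      fix s :: real
      have "e s * u s \<le> 1 * u s" if "0 \<le> s"
        using that K by (intro mult_right_mono) (auto simp: e_def)
      then show "e s * u s * indicator {0..T} s \<le> u s * indicator {0..T} s"
        by (auto simp: indicator_def)
    qed
    then show ?thesis using fin by auto
  qed
  have int_e: "(\<integral>\<^sup>+ s. e s * indicator {r..T} s \<partial>lborel) \<le> ennreal (1 / (2 * K)) * e r" if "r \<le> T" for r
  proof -
    have "(\<integral>\<^sup>+ s. ennreal (exp (- (2 * K) * s)) * indicator {r..T} s \<partial>lborel) =
        ennreal (- exp (- (2 * K) * T) / (2 * K) - (- exp (- (2 * K) * r) / (2 * K)))"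
      using that K by (intro nn_integral_FTC_Icc) (auto intro!: derivative_eq_intros)
    also have "\<dots> \<le> ennreal (1 / (2 * K) * exp (- (2 * K) * r))"
      using K by (intro ennreal_leI) (simp add: field_simps)
    finally show ?thesis unfolding e_def using K by (simp add: ennreal_mult[symmetric])
  qed
  have swap: "(\<integral>\<^sup>+ s. e s * (\<integral>\<^sup>+ r. u r * indicator {0..s} r \<partial>lborel) * indicator {0..T} s \<partial>lborel)
      \<le> ennreal (1 / (2 * K)) * ?A"
  proof -
    have "(\<integral>\<^sup>+ s. e s * (\<integral>\<^sup>+ r. u r * indicator {0..s} r \<partial>lborel) * indicator {0..T} s \<partial>lborel) =
       (\<integral>\<^sup>+ s. (\<integral>\<^sup>+ r. e s * indicator {0..T} s * (u r * indicator {x. 0 \<le> fst x \<and> fst x \<le> snd x} (r, s)) \<partial>lborel) \<partial>lborel)"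
      by (intro nn_integral_cong, subst nn_integral_cmult) (auto simp: indicator_def ac_simps)
    also have "\<dots> = (\<integral>\<^sup>+ r. (\<integral>\<^sup>+ s. e s * indicator {0..T} s * (u r * indicator {x. 0 \<le> fst x \<and> fst x \<le> snd x} (r, s)) \<partial>lborel) \<partial>lborel)"
      by (rule lborel_pair.Fubini') measurable
    also have "\<dots> \<le> (\<integral>\<^sup>+ r. ennreal (1 / (2 * K)) * (e r * u r * indicator {0..T} r) \<partial>lborel)"
    proof (rule nn_integral_mono)
      fix r :: real
      have "(\<integral>\<^sup>+ s. e s * indicator {0..T} s * (u r * indicator {x. 0 \<le> fst x \<and> fst x \<le> snd x} (r, s)) \<partial>lborel)
        = (\<integral>\<^sup>+ s. (u r * indicator {0..T} r) * (e s * indicator {r..T} s) \<partial>lborel)"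
        by (intro nn_integral_cong) (auto simp: indicator_def mult.commute)
      also have "\<dots> = u r * indicator {0..T} r * (\<integral>\<^sup>+ s. e s * indicator {r..T} s \<partial>lborel)"
        by (rule nn_integral_cmult) measurable
      also have "\<dots> \<le> u r * indicator {0..T} r * (ennreal (1 / (2 * K)) * e r)"
        using int_e[of r] by (cases "r \<le> T") (auto simp: indicator_def intro: mult_left_mono)
      finally show "(\<integral>\<^sup>+ s. e s * indicator {0..T} s * (u r * indicator {x. 0 \<le> fst x \<and> fst x \<le> snd x} (r, s)) \<partial>lborel)
        \<le> ennreal (1 / (2 * K)) * (e r * u r * indicator {0..T} r)" by (simp add: ac_simps)
    qed
    also have "\<dots> = ennreal (1 / (2 * K)) * ?A" by (rule nn_integral_cmult) measurable
    finally show ?thesis .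
  qed
  have "?A \<le> (\<integral>\<^sup>+ s. ennreal C * indicator {0..T} s + ennreal K *
      (e s * (\<integral>\<^sup>+ r. u r * indicator {0..s} r \<partial>lborel) * indicator {0..T} s) \<partial>lborel)"
  proof (rule nn_integral_mono)
    fix s :: real
    show "e s * u s * indicator {0..T} s \<le> ennreal C * indicator {0..T} s + ennreal K *
      (e s * (\<integral>\<^sup>+ r. u r * indicator {0..s} r \<partial>lborel) * indicator {0..T} s)"
    proof (cases "s \<in> {0..T}")
      case True
      then have "e s * u s \<le> e s * (ennreal C + ennreal K * (\<integral>\<^sup>+ r. u r * indicator {0..s} r \<partial>lborel))"
        by (intro mult_left_mono bound) auto
      also have "\<dots> = e s * ennreal C + ennreal K * (e s * (\<integral>\<^sup>+ r. u r * indicator {0..s} r \<partial>lborel))"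
        by (simp add: algebra_simps)
      also have "e s * ennreal C \<le> 1 * ennreal C"
        using True K by (intro mult_right_mono) (auto simp: e_def)
      finally show ?thesis using True by simp
    qed simp
  qed
  also have "\<dots> = ennreal C * ennreal T + ennreal K *
      (\<integral>\<^sup>+ s. (e s * (\<integral>\<^sup>+ r. u r * indicator {0..s} r \<partial>lborel) * indicator {0..T} s) \<partial>lborel)"
  proof -
    have "(\<lambda>s. \<integral>\<^sup>+ r. u r * indicator {x. 0 \<le> snd x \<and> snd x \<le> fst x} (s, r) \<partial>lborel) \<in> borel_measurable borel"
      by measurable
    then have [measurable]: "(\<lambda>s. \<integral>\<^sup>+ r. u r * indicator {0..s} r \<partial>lborel) \<in> borel_measurable borel"
      by (simp add: indicator_def)
    show ?thesis using T
      by (subst nn_integral_add) (auto simp: nn_integral_cmult)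
  qed
  also have "\<dots> \<le> ennreal C * ennreal T + ennreal K * (ennreal (1 / (2 * K)) * ?A)"
    by (intro add_mono mult_left_mono swap) auto
  also have "ennreal K * (ennreal (1 / (2 * K)) * ?A) = ennreal (1 / 2) * ?A"
    using K by (simp add: mult.assoc[symmetric] ennreal_mult'[symmetric] del: ennreal_half)
  finally have "?A \<le> ennreal C * ennreal T + ennreal (1 / 2) * ?A" .
  then have A_le: "?A \<le> ennreal (2 * C * T)"
  proof (cases ?A)
    case (real a)
    then have "a \<le> C * T + 1 / 2 * a"
      using \<open>?A \<le> ennreal C * ennreal T + ennreal (1 / 2) * ?A\<close> C T
      by (simp add: ennreal_mult'[symmetric] ennreal_plus[symmetric] del: ennreal_plus ennreal_half)
    then show ?thesis using real by (simp add: ennreal_leI)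
  qed (use A_fin in simp)
  have int_u: "(\<integral>\<^sup>+ s. u s * indicator {0..T} s \<partial>lborel) \<le> ennreal (exp (2 * K * T)) * ?A"
  proof -
    have "(\<integral>\<^sup>+ s. u s * indicator {0..T} s \<partial>lborel) \<le> (\<integral>\<^sup>+ s. ennreal (exp (2 * K * T)) * (e s * u s * indicator {0..T} s) \<partial>lborel)"
    proof (rule nn_integral_mono)
      fix s :: real
      have "1 * u s \<le> (ennreal (exp (2 * K * T)) * e s) * u s" if "s \<le> T"
      proof (rule mult_right_mono)
        have "1 \<le> exp (2 * K * T) * exp (- (2 * K) * s)"
          using that K by (simp add: exp_add[symmetric])
        then show "1 \<le> ennreal (exp (2 * K * T)) * e s"
          by (simp add: e_def ennreal_mult'[symmetric])
      qed simp
      then show "u s * indicator {0..T} s \<le> ennreal (exp (2 * K * T)) * (e s * u s * indicator {0..T} s)"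
        by (auto simp: indicator_def mult.assoc)
    qed
    also have "\<dots> = ennreal (exp (2 * K * T)) * ?A" by (rule nn_integral_cmult) measurable
    finally show ?thesis .
  qed
  have "u t \<le> ennreal C + ennreal K * (\<integral>\<^sup>+ s. u s * indicator {0..t} s \<partial>lborel)"
    by (rule bound[OF t])
  also have "(\<integral>\<^sup>+ s. u s * indicator {0..t} s \<partial>lborel) \<le> (\<integral>\<^sup>+ s. u s * indicator {0..T} s \<partial>lborel)"
    using t by (intro nn_integral_mono) (auto simp: indicator_def)
  also have "\<dots> \<le> ennreal (exp (2 * K * T)) * ?A" by (rule int_u)
  also have "\<dots> \<le> ennreal (exp (2 * K * T)) * ennreal (2 * C * T)"
    by (intro mult_left_mono A_le) simp
  finally have "u t \<le> ennreal C + ennreal K * (ennreal (exp (2 * K * T)) * ennreal (2 * C * T))"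
    by (simp add: mult_left_mono)
  also have "\<dots> = ennreal (C * (1 + 2 * K * T * exp (2 * K * T)))"
    using C K T by (simp add: ennreal_mult'[symmetric] ennreal_plus[symmetric] algebra_simps del: ennreal_plus)
  finally show ?thesis .
qed

lemma has_integral_exp_after:
  fixes \<beta> \<theta> t :: real
  assumes "0 < \<beta>" "0 \<le> \<theta>" "\<theta> < t"
  shows "has_bochner_integral lborel
    (\<lambda>s. indicator {0..t} s *\<^sub>R (if \<theta> < s then exp (- \<beta> * (s - \<theta>)) else 0)) ((1 - exp (- \<beta> * (t - \<theta>))) / \<beta>)"
proof -
  have "has_bochner_integral lborel (\<lambda>s. exp (- \<beta> * (s - \<theta>)) * indicator {\<theta>..t} s)
     (- exp (- \<beta> * (t - \<theta>)) / \<beta> - (- exp (- \<beta> * (\<theta> - \<theta>)) / \<beta>))"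
    using assms by (intro has_bochner_integral_FTC_Icc_real) (auto intro!: derivative_eq_intros continuous_intros)
  moreover have "AE s in lborel. s \<noteq> \<theta>" by (rule AE_lborel_singleton)
  then have "AE s in lborel. exp (- \<beta> * (s - \<theta>)) * indicator {\<theta>..t} s =
     indicator {0..t} s *\<^sub>R (if \<theta> < s then exp (- \<beta> * (s - \<theta>)) else 0)"
    by eventually_elim (use assms in \<open>auto simp: indicator_def\<close>)
  ultimately show ?thesis
    by (subst has_bochner_integral_cong_AE[symmetric]) (auto simp: field_simps diff_divide_distrib)
qed

text \<open>Between jumps the equation is \<open>x' = \<beta> (lb - x)\<close>, so each jump decays exponentially. The integral is
continuous and the jump sum includes only strictly earlier jumps, so a solution is left-continuous and its left limits
may be replaced by its values. The difference \<open>d\<close> of two solutions then satisfies \<open>d(t) = - \<beta> \<integral> d\<close> over \<open>[0,t]\<close>, and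
the Gronwall estimate with \<open>C = 0\<close> gives \<open>d = 0\<close>.\<close>

lemma jump_equation_solution:
  fixes x :: "real \<Rightarrow> real" and \<theta> c :: "nat \<Rightarrow> real" and P :: "nat set"
    and \<beta> lam0 lb :: real
  assumes \<beta>: "0 < \<beta>"
    and \<theta>: "\<And>i. i \<in> P \<Longrightarrow> 0 < \<theta> i" and fin: "\<And>t. finite {i \<in> P. \<theta> i < t}"
    and int: "\<And>t. 0 \<le> t \<Longrightarrow> set_integrable lborel {0..t} (left_limit x)"
    and eq: "\<And>t. 0 \<le> t \<Longrightarrow>
      x t = lam0 + \<beta> * (LINT s:{0..t}|lborel. lb - left_limit x s) + (\<Sum>i\<in>{i\<in>P. \<theta> i < t}. c i)"
    and t: "0 \<le> t"
  shows "left_limit x t = x t"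
    and "x t = lb + (lam0 - lb) * exp (- \<beta> * t) + (\<Sum>i\<in>{i\<in>P. \<theta> i < t}. exp (- \<beta> * (t - \<theta> i)) * c i)"
proof -
  have const: "set_integrable lborel {0..t} (\<lambda>s. lb)" for t :: real
    by (rule borel_integrable_atLeastAtMost') simp
  have int2: "set_integrable lborel {0..t} (\<lambda>s. lb - left_limit x s)" if "0 \<le> t" for t
    using int[OF that] const by (rule set_integral_diff(1)[rotated])
  have left: "left_limit x t = x t" if t: "0 \<le> t" for t
  proof (cases "t = 0")
    case False
    then have t0: "0 < t" using t by simp
    \<comment> \<open>there are no jumps between the last one before \<open>t\<close> and \<open>t\<close>; the value \<open>0\<close> is added only to make the maximum exist\<close>
    have ev: "eventually (\<lambda>s. {i\<in>P. \<theta> i < s} = {i\<in>P. \<theta> i < t}) (at_left t)"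
    proof -
      define m where "m = Max (insert 0 (\<theta> ` {i\<in>P. \<theta> i < t}))"
      have "m < t" unfolding m_def using fin t0 by (subst Max_less_iff) auto
      moreover have "\<theta> i \<le> m" if "i \<in> P" "\<theta> i < t" for i
        unfolding m_def using fin that by (intro Max_ge) auto
      ultimately show ?thesis
        by (intro eventually_at_leftI[of m]) force+
    qed
    have cont: "continuous_on {0..t} (\<lambda>s. integral {0..s} (\<lambda>s. lb - left_limit x s))"
      by (intro indefinite_integral_continuous_1 set_borel_integral_eq_integral(1) int2 t)
    have "((\<lambda>s. integral {0..s} (\<lambda>s. lb - left_limit x s)) \<longlongrightarrow> integral {0..t} (\<lambda>s. lb - left_limit x s)) (at t within {0..t})"
      using cont t by (auto simp: continuous_on_def)
    then have "((\<lambda>s. integral {0..s} (\<lambda>s. lb - left_limit x s)) \<longlongrightarrow> integral {0..t} (\<lambda>s. lb - left_limit x s)) (at_left t)"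
      using t0 by (simp add: at_within_Icc_at_left)
    then have "((\<lambda>s. lam0 + \<beta> * integral {0..s} (\<lambda>s. lb - left_limit x s) + (\<Sum>i\<in>{i\<in>P. \<theta> i < t}. c i)) \<longlongrightarrow>
        lam0 + \<beta> * integral {0..t} (\<lambda>s. lb - left_limit x s) + (\<Sum>i\<in>{i\<in>P. \<theta> i < t}. c i)) (at_left t)"
      by (intro tendsto_intros)
    also have "lam0 + \<beta> * integral {0..t} (\<lambda>s. lb - left_limit x s) + (\<Sum>i\<in>{i\<in>P. \<theta> i < t}. c i) = x t"
      using eq[OF t] set_borel_integral_eq_integral(2)[OF int2[OF t]] by simp
    finally have "((\<lambda>s. lam0 + \<beta> * integral {0..s} (\<lambda>s. lb - left_limit x s) + (\<Sum>i\<in>{i\<in>P. \<theta> i < t}. c i)) \<longlongrightarrow> x t) (at_left t)" .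
    moreover have "eventually (\<lambda>s. lam0 + \<beta> * integral {0..s} (\<lambda>s. lb - left_limit x s) + (\<Sum>i\<in>{i\<in>P. \<theta> i < t}. c i) = x s) (at_left t)"
      using ev eventually_at_leftI[of 0 t "\<lambda>s. 0 < s", OF _ t0, simplified]
    proof eventually_elim
      case (elim s)
      then show ?case
        using eq[of s] set_borel_integral_eq_integral(2)[OF int2[of s]] by simp
    qed
    ultimately have "(x \<longlongrightarrow> x t) (at_left t)" by (rule Lim_transform_eventually)
    then have "Lim (at_left t) x = x t" by (intro tendsto_Lim) auto
    then show ?thesis using False by (simp add: left_limit_def)
  qed (simp add: left_limit_def)
  then show "left_limit x t = x t" using t .
  define y where "y t = lb + (lam0 - lb) * exp (- \<beta> * t) + (\<Sum>i\<in>{i\<in>P. \<theta> i < t}. exp (- \<beta> * (t - \<theta> i)) * c i)" for t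
  have y_int: "has_bochner_integral lborel (\<lambda>s. indicator {0..t} s *\<^sub>R y s)
      (lb * t + (lam0 - lb) * ((1 - exp (- \<beta> * t)) / \<beta>) + (\<Sum>i\<in>{i\<in>P. \<theta> i < t}. ((1 - exp (- \<beta> * (t - \<theta> i))) / \<beta>) * c i))"
    if t: "0 \<le> t" for t
  proof -
    have 1: "has_bochner_integral lborel (\<lambda>s. indicator {0..t} s *\<^sub>R exp (- \<beta> * s)) ((1 - exp (- \<beta> * t)) / \<beta>)"
    proof -
      have "has_bochner_integral lborel (\<lambda>s. exp (- \<beta> * s) * indicator {0..t} s)
       (- exp (- \<beta> * t) / \<beta> - (- exp (- \<beta> * 0) / \<beta>))"
        using t \<beta> by (intro has_bochner_integral_FTC_Icc_real) (auto intro!: derivative_eq_intros continuous_intros)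
      then show ?thesis by (simp add: mult.commute diff_divide_distrib)
    qed
    have 2: "has_bochner_integral lborel (\<lambda>s. indicator {0..t} s *\<^sub>R 1) t"
      using t by (simp add: has_bochner_integral_iff)
    have "has_bochner_integral lborel (\<lambda>s. lb * (indicator {0..t} s *\<^sub>R 1) + (lam0 - lb) * (indicator {0..t} s *\<^sub>R exp (- \<beta> * s)) +
       (\<Sum>i\<in>{i\<in>P. \<theta> i < t}. (indicator {0..t} s *\<^sub>R (if \<theta> i < s then exp (- \<beta> * (s - \<theta> i)) else 0)) * c i))
       (lb * t + (lam0 - lb) * ((1 - exp (- \<beta> * t)) / \<beta>) + (\<Sum>i\<in>{i\<in>P. \<theta> i < t}. ((1 - exp (- \<beta> * (t - \<theta> i))) / \<beta>) * c i))"
      using \<theta> \<beta> 1 2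
      by (intro has_bochner_integral_add has_bochner_integral_mult_right has_bochner_integral_sum
          has_bochner_integral_mult_left has_integral_exp_after) (auto intro: less_imp_le)
    moreover have "lb * (indicator {0..t} s *\<^sub>R 1) + (lam0 - lb) * (indicator {0..t} s *\<^sub>R exp (- \<beta> * s)) +
       (\<Sum>i\<in>{i\<in>P. \<theta> i < t}. (indicator {0..t} s *\<^sub>R (if \<theta> i < s then exp (- \<beta> * (s - \<theta> i)) else 0)) * c i) =
       indicator {0..t} s *\<^sub>R y s" for s
    proof (cases "s \<in> {0..t}")
      case True
      then have "(\<Sum>i\<in>{i\<in>P. \<theta> i < t}. (if \<theta> i < s then exp (- \<beta> * (s - \<theta> i)) else 0) * c i) =
         (\<Sum>i\<in>{i\<in>P. \<theta> i < s}. exp (- \<beta> * (s - \<theta> i)) * c i)"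
        by (intro sum.mono_neutral_cong_right fin) auto
      then show ?thesis using True by (simp add: y_def)
    qed simp
    ultimately show ?thesis by simp
  qed
  have y_eq: "y t = lam0 + \<beta> * (lb * t - (LINT s:{0..t}|lborel. y s)) + (\<Sum>i\<in>{i\<in>P. \<theta> i < t}. c i)" if "0 \<le> t" for t
  proof -
    have "(\<Sum>i\<in>{i\<in>P. \<theta> i < t}. ((1 - exp (- \<beta> * (t - \<theta> i))) / \<beta>) * c i) =
        ((\<Sum>i\<in>{i\<in>P. \<theta> i < t}. c i) - (\<Sum>i\<in>{i\<in>P. \<theta> i < t}. exp (- \<beta> * (t - \<theta> i)) * c i)) / \<beta>"
      by (simp add: sum_subtractf[symmetric] sum_divide_distrib algebra_simps)
    then show ?thesis
      using has_bochner_integral_integral_eq[OF y_int[OF that]] \<beta>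
      unfolding set_lebesgue_integral_def y_def by (simp add: field_simps)
  qed
  \<comment> \<open>the indicator makes \<open>u\<close> measurable on the whole line\<close>
  define u where "u s = ennreal (indicator {0..t} s * \<bar>x s - y s\<bar>)" for s
  have d_int: "set_integrable lborel {0..s} (\<lambda>r. x r - y r)" if "0 \<le> s" for s
  proof (rule set_integral_diff(1))
    have "set_integrable lborel {0..s} (left_limit x) \<longleftrightarrow> set_integrable lborel {0..s} x"
      using left by (intro set_integrable_cong) auto
    then show "set_integrable lborel {0..s} x" using int[OF that] by simp
    show "set_integrable lborel {0..s} y"
      using y_int[OF that] unfolding set_integrable_def by (auto simp: has_bochner_integral_iff)
  qed
  have bound: "u s \<le> ennreal 0 + ennreal \<beta> * (\<integral>\<^sup>+ r. u r * indicator {0..s} r \<partial>lborel)" if s: "0 \<le> s" "s \<le> t" for s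
  proof -
    have yi: "set_integrable lborel {0..s} y"
      using y_int[OF s(1)] unfolding set_integrable_def by (auto simp: has_bochner_integral_iff)
    have "(LINT r:{0..s}|lborel. lb - left_limit x r) = (LINT r:{0..s}|lborel. lb - x r)"
      using left by (intro set_lebesgue_integral_cong) auto
    also have "\<dots> = (LINT r:{0..s}|lborel. (lb - y r) - (x r - y r))" by simp
    also have "\<dots> = (LINT r:{0..s}|lborel. lb - y r) - (LINT r:{0..s}|lborel. x r - y r)"
      by (rule set_integral_diff(2)[OF set_integral_diff(1)[OF const yi] d_int[OF s(1)]])
    also have "(LINT r:{0..s}|lborel. lb - y r) = lb * s - (LINT r:{0..s}|lborel. y r)"
      using s by (subst set_integral_diff(2)[OF const yi]) (simp add: set_lebesgue_integral_def)
    finally have "x s = lam0 + \<beta> * (lb * s - (LINT r:{0..s}|lborel. y r) - (LINT r:{0..s}|lborel. x r - y r))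
        + (\<Sum>i\<in>{i\<in>P. \<theta> i < s}. c i)"
      using eq[OF s(1)] by simp
    then have "x s - y s = - \<beta> * (LINT r:{0..s}|lborel. x r - y r)"
      using y_eq[OF s(1)] by (simp add: algebra_simps)
    then have "ennreal \<bar>x s - y s\<bar> = ennreal \<beta> * ennreal (norm (LINT r:{0..s}|lborel. x r - y r))"
      using \<beta> by (simp add: abs_mult ennreal_mult')
    also have "ennreal (norm (LINT r:{0..s}|lborel. x r - y r)) \<le> (\<integral>\<^sup>+ r. norm (indicator {0..s} r *\<^sub>R (x r - y r)) \<partial>lborel)"
      using d_int[OF s(1)] unfolding set_lebesgue_integral_def set_integrable_def
      by (rule integral_norm_bound_ennreal)
    also have "\<dots> = (\<integral>\<^sup>+ r. u r * indicator {0..s} r \<partial>lborel)"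
      using s by (intro nn_integral_cong) (auto simp: u_def indicator_def)
    finally show ?thesis using s by (simp add: u_def mult_left_mono)
  qed
  have di: "integrable lborel (\<lambda>r. indicator {0..t} r *\<^sub>R (x r - y r))"
    using d_int[OF t] by (simp add: set_integrable_def)
  have "(\<lambda>r. ennreal (norm (indicator {0..t} r *\<^sub>R (x r - y r)))) \<in> borel_measurable lborel"
    using di by measurable
  then have um: "u \<in> borel_measurable borel" by (simp add: u_def[abs_def] abs_mult)
  have "(\<integral>\<^sup>+ s. u s * indicator {0..t} s \<partial>lborel) = (\<integral>\<^sup>+ r. norm (indicator {0..t} r *\<^sub>R (x r - y r)) \<partial>lborel)"
    by (intro nn_integral_cong) (auto simp: u_def indicator_def)
  also have "\<dots> < \<infinity>" using di by (simp add: integrable_iff_bounded)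
  finally have "u t \<le> ennreal (0 * (1 + 2 * \<beta> * t * exp (2 * \<beta> * t)))"
    using t by (intro gronwall_ennreal[OF um order.refl \<beta> bound]) auto
  then have "x t = y t" using t by (simp add: u_def)
  then show "x t = lb + (lam0 - lb) * exp (- \<beta> * t) + (\<Sum>i\<in>{i\<in>P. \<theta> i < t}. exp (- \<beta> * (t - \<theta> i)) * c i)"
    by (simp add: y_def)
qed

section \<open>Integrals against the loss size distribution\<close>

text \<open>The part of the argument that concerns only the loss sizes; \<open>\<Theta>\<close> is a finite measure, not normalised.\<close>

locale loss_severity =
  fixes \<Theta> :: "real measure"
  assumes sets_\<Theta> [measurable_cong]: "sets \<Theta> = sets Rplus"
    and moments: "(\<integral>\<^sup>+ z. ennreal (1 + z + z\<^sup>2) \<partial>\<Theta>) < \<infinity>"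
begin

lemma space_\<Theta>: "space \<Theta> = {0..}"
  using sets_eq_imp_space_eq[OF sets_\<Theta>] by simp

lemma measurable_\<Theta> [measurable]: "(\<lambda>z. z) \<in> borel_measurable \<Theta>"
  by (subst measurable_cong_sets[OF sets_\<Theta> refl]) (simp add: measurable_restrict_space1)

lemma finite_measure_\<Theta>: "finite_measure \<Theta>"
proof
  have "emeasure \<Theta> (space \<Theta>) = (\<integral>\<^sup>+ z. 1 \<partial>\<Theta>)" by simp
  also have "\<dots> \<le> (\<integral>\<^sup>+ z. ennreal (1 + z + z\<^sup>2) \<partial>\<Theta>)"
    by (intro nn_integral_mono) (auto simp: space_\<Theta>)
  finally show "emeasure \<Theta> (space \<Theta>) \<noteq> \<infinity>" using moments by auto
qed

sublocale \<Theta>: finite_measure \<Theta> by (rule finite_measure_\<Theta>)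

lemma integrable_\<Theta>_moment:
  assumes [measurable]: "h \<in> borel_measurable \<Theta>"
    and h: "\<And>z. 0 \<le> z \<Longrightarrow> \<bar>h z\<bar> \<le> C * (1 + z + z\<^sup>2)"
  shows "integrable \<Theta> (h :: real \<Rightarrow> real)"
proof (rule Bochner_Integration.integrable_bound)
  have "integrable \<Theta> (\<lambda>z. 1 + z + z\<^sup>2)"
    using moments by (intro integrableI_nonneg) (auto simp: space_\<Theta>)
  then show "integrable \<Theta> (\<lambda>z. C * (1 + z + z\<^sup>2))" by simp
  show "AE z in \<Theta>. norm (h z) \<le> norm (C * (1 + z + z\<^sup>2))"
    using h by (intro AE_I2) (fastforce simp: space_\<Theta>)
qed measurable

lemma integrable_z [simp]: "integrable \<Theta> (\<lambda>z. z)" "integrable \<Theta> (\<lambda>z. z\<^sup>2)"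
  by (auto intro!: integrable_\<Theta>_moment[where C=1])

definition "mark_mean = (\<integral>z. z \<partial>\<Theta>)"
definition "mark_square = (\<integral>z. z\<^sup>2 \<partial>\<Theta>)"

lemma mark_moments_nonneg: "0 \<le> mark_mean" "0 \<le> mark_square"
  unfolding mark_mean_def mark_square_def by (auto intro!: integral_nonneg_AE AE_I2 simp: space_\<Theta>)

lemma nn_integral_z: "(\<integral>\<^sup>+ z. ennreal z \<partial>\<Theta>) = ennreal mark_mean"
  "(\<integral>\<^sup>+ z. ennreal (z\<^sup>2) \<partial>\<Theta>) = ennreal mark_square"
  unfolding mark_mean_def mark_square_def by (auto intro!: nn_integral_eq_integral AE_I2 simp: space_\<Theta>)

lemma integrable_product:
  fixes d e :: "real \<Rightarrow> real"
  assumes [measurable]: "d \<in> borel_measurable \<Theta>" "e \<in> borel_measurable \<Theta>"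
    and d: "\<And>z. 0 \<le> z \<Longrightarrow> \<bar>d z\<bar> \<le> z" and e: "\<And>z. 0 \<le> z \<Longrightarrow> \<bar>e z\<bar> \<le> z"
  shows "integrable \<Theta> (\<lambda>z. d z * e z)"
proof (rule integrable_\<Theta>_moment[where C=1])
  fix z :: real assume z: "0 \<le> z"
  have "\<bar>d z * e z\<bar> \<le> z * z" unfolding abs_mult using d[OF z] e[OF z] z by (intro mult_mono) auto
  also have "\<dots> \<le> 1 * (1 + z + z\<^sup>2)" using z by (simp add: power2_eq_square)
  finally show "\<bar>d z * e z\<bar> \<le> 1 * (1 + z + z\<^sup>2)" .
qed measurable

text \<open>Retained losses and differences of two of them satisfy \<open>\<bar>d z\<bar> \<le> z\<close>, and this bound gives all integrability below.\<close>

lemma integrable_single: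
  fixes d :: "real \<Rightarrow> real"
  assumes [measurable]: "d \<in> borel_measurable \<Theta>" and d: "\<And>z. 0 \<le> z \<Longrightarrow> \<bar>d z\<bar> \<le> z"
  shows "integrable \<Theta> d" "integrable \<Theta> (\<lambda>z. z * d z)" "integrable \<Theta> (\<lambda>z. (d z)\<^sup>2)"
proof -
  show "integrable \<Theta> d"
  proof (rule integrable_\<Theta>_moment[where C=1])
    fix z :: real assume z: "0 \<le> z"
    have "z \<le> 1 * (1 + z + z\<^sup>2)" by simp
    then show "\<bar>d z\<bar> \<le> 1 * (1 + z + z\<^sup>2)" using d[OF z] by linarith
  qed measurable
  show "integrable \<Theta> (\<lambda>z. z * d z)" by (rule integrable_product) (use d in auto)
  show "integrable \<Theta> (\<lambda>z. (d z)\<^sup>2)"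
    unfolding power2_eq_square by (rule integrable_product) (use d in auto)
qed

lemma shifted_square:
  fixes d :: "real \<Rightarrow> real"
  assumes d: "d \<in> borel_measurable \<Theta>" "\<And>z. 0 \<le> z \<Longrightarrow> \<bar>d z\<bar> \<le> z"
  shows "integrable \<Theta> (\<lambda>z. (d z + c * z)\<^sup>2)"
    and "(\<integral>z. (d z + c * z)\<^sup>2 \<partial>\<Theta>) = (\<integral>z. (d z)\<^sup>2 \<partial>\<Theta>) + 2 * c * (\<integral>z. z * d z \<partial>\<Theta>) + c\<^sup>2 * mark_square"
proof -
  have "(\<lambda>z. (d z + c * z)\<^sup>2) = (\<lambda>z. (d z)\<^sup>2 + 2 * c * (z * d z) + c\<^sup>2 * z\<^sup>2)"
    by (simp add: power2_eq_square algebra_simps)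
  then show "integrable \<Theta> (\<lambda>z. (d z + c * z)\<^sup>2)"
    and "(\<integral>z. (d z + c * z)\<^sup>2 \<partial>\<Theta>) = (\<integral>z. (d z)\<^sup>2 \<partial>\<Theta>) + 2 * c * (\<integral>z. z * d z \<partial>\<Theta>) + c\<^sup>2 * mark_square"
    using integrable_single[OF d] by (simp_all add: mark_square_def)
qed

end

section \<open>Explicit intensity and the compensation formula\<close>

locale linear_hawkes = marked_hawkes_process Q F \<tau> Z \<Theta> lam0 lam_base \<beta> "\<lambda>z. \<Lambda> * z" lam
  + loss_severity \<Theta>
  for Q :: "'a measure" and F and \<tau> and Z and \<Theta> and lam0 lam_base \<beta> \<Lambda> :: real and lam +
  assumes \<Lambda>_pos: "0 < \<Lambda>" and subcritical: "(\<integral>z. \<Lambda> * z \<partial>\<Theta>) < \<beta>"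
    and base_less: "lam_base < lam0" and base_nonneg: "0 \<le> lam_base"
begin

definition "\<kappa> = \<beta> - \<Lambda> * mark_mean"

lemma \<kappa>_pos: "0 < \<kappa>" using subcritical by (simp add: \<kappa>_def mark_mean_def)

lemma \<beta>_pos: "0 < \<beta>"
proof -
  have "0 \<le> \<Lambda> * mark_mean" using \<Lambda>_pos mark_moments_nonneg by simp
  then show ?thesis using \<kappa>_pos unfolding \<kappa>_def by linarith
qed

text \<open>The intensity in the absence of losses.\<close>

definition "baseline s = lam_base + (lam0 - lam_base) * exp (- \<beta> * s)"

lemma baseline_pos: "0 < baseline s"
  unfolding baseline_def using base_less base_nonneg by (intro add_nonneg_pos) auto

lemma baseline_le: "0 \<le> s \<Longrightarrow> baseline s \<le> lam0"
proof -
  assume "0 \<le> s"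
  then have "(lam0 - lam_base) * exp (- \<beta> * s) \<le> (lam0 - lam_base) * 1"
    using base_less \<beta>_pos by (intro mult_left_mono) auto
  then show ?thesis by (simp add: baseline_def)
qed

lemma measurable_baseline [measurable]: "baseline \<in> borel_measurable borel"
  unfolding baseline_def by measurable

text \<open>The contribution \<open>e^{-\<beta>(s-r)} \<Lambda> z\<close> of a loss \<open>z\<close> at time \<open>r\<close> to the intensity at time \<open>s\<close> is split into
\<open>e^{-\<beta> s}\<close> and a factor that depends on \<open>(r,z)\<close> alone, so that the intensity is expressed by a single past sum.\<close>

definition "kernel_mark = (\<lambda>x :: real \<times> real. ennreal (exp (\<beta> * fst x) * \<Lambda> * snd x))"

definition "rate s \<omega> = ennreal (baseline s) + ennreal (exp (- \<beta> * s)) * past_sum kernel_mark s \<omega>"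

lemma measurable_kernel_mark [measurable]: "kernel_mark \<in> borel_measurable (Rplus \<Otimes>\<^sub>M Rplus)"
  unfolding kernel_mark_def by measurable

lemma rate_finite: "\<omega> \<in> space Q \<Longrightarrow> rate s \<omega> < \<infinity>"
  unfolding rate_def using past_sum_finite[of \<omega> kernel_mark s]
  by (auto simp: ennreal_mult_less_top kernel_mark_def[THEN fun_cong])

text \<open>The process \<open>lam\<close> is known only through its integral equation, path by path. The explicit solution
replaces it in everything that follows, because its measurability can be read off.\<close>

lemma lam_eq_rate:
  "AE \<omega> in Q. \<forall>s\<ge>0. left_limit (\<lambda>u. lam u \<omega>) s = lam s \<omega> \<and> 0 \<le> lam s \<omega> \<and> ennreal (lam s \<omega>) = rate s \<omega>"
  using intensity AE_space unfolding hawkes_intensity_equation_def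
proof eventually_elim
  case (elim \<omega>)
  then have \<omega>: "\<omega> \<in> space Q" by simp
  let ?P = "{i. \<tau> i \<omega> < \<infinity>}" and ?\<theta> = "\<lambda>i. real_of_ereal (\<tau> i \<omega>)" and ?c = "\<lambda>i. \<Lambda> * Z i \<omega>"
  have fin: "finite {i \<in> ?P. ?\<theta> i < t}" for t
    by (rule past_sum_eq_sum(2)[OF \<omega>, of "\<lambda>_. 0"]) auto
  have sum: "(LINT x:{0..<t} \<times> {0..}|\<nu> \<omega>. \<Lambda> * snd x) = (\<Sum>i\<in>{i \<in> ?P. ?\<theta> i < t}. ?c i)" for t
  proof -
    have [measurable]: "{0..<t} \<times> {0..} \<in> sets (\<nu> \<omega>)"
      unfolding sets_counting by (intro pair_measureI) (auto simp: sets_restrict_space_iff)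
    have "(LINT x:{0..<t} \<times> {0..}|\<nu> \<omega>. \<Lambda> * snd x) =
       enn2real (\<integral>\<^sup>+ x. ennreal (indicator ({0..<t} \<times> {0..}) x *\<^sub>R (\<Lambda> * snd x)) \<partial>\<nu> \<omega>)"
      unfolding set_lebesgue_integral_def using \<Lambda>_pos
      by (intro integral_eq_nn_integral) (auto simp: indicator_def)
    also have "(\<integral>\<^sup>+ x. ennreal (indicator ({0..<t} \<times> {0..}) x *\<^sub>R (\<Lambda> * snd x)) \<partial>\<nu> \<omega>)
       = past_sum (\<lambda>x. ennreal (\<Lambda> * snd x)) t \<omega>"
      unfolding past_sum_def by (intro nn_integral_cong) (auto simp: indicator_def)
    also have "\<dots> = ennreal (\<Sum>i\<in>{i \<in> ?P. ?\<theta> i < t}. ?c i)"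
      using \<Lambda>_pos by (subst past_sum_eq_sum(1)[OF \<omega>]) (auto simp: space_pair_measure)
    also have "enn2real \<dots> = (\<Sum>i\<in>{i \<in> ?P. ?\<theta> i < t}. ?c i)"
      using \<Lambda>_pos mark_nonneg[OF \<omega>] by (intro enn2real_ennreal sum_nonneg) auto
    finally show ?thesis .
  qed
  have pos: "0 < ?\<theta> i" if "i \<in> ?P" for i
  proof -
    from that have "\<tau> i \<omega> < \<infinity>" by simp
    then obtain r where "\<tau> i \<omega> = ereal r" "0 < r" by (rule real_time[OF \<omega>])
    then show ?thesis by simp
  qed
  have sol: "left_limit (\<lambda>u. lam u \<omega>) t = lam t \<omega>"
    "lam t \<omega> = lam_base + (lam0 - lam_base) * exp (- \<beta> * t) +
       (\<Sum>i\<in>{i\<in>?P. ?\<theta> i < t}. exp (- \<beta> * (t - ?\<theta> i)) * ?c i)" if "0 \<le> t" for t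
    using elim(1) unfolding sum
    by (intro jump_equation_solution[OF \<beta>_pos pos fin _ _ that]; simp)+
  have rate: "rate t \<omega> = ennreal (baseline t + (\<Sum>i\<in>{i\<in>?P. ?\<theta> i < t}. exp (- \<beta> * (t - ?\<theta> i)) * ?c i))"
    and nn: "0 \<le> (\<Sum>i\<in>{i\<in>?P. ?\<theta> i < t}. exp (- \<beta> * (t - ?\<theta> i)) * ?c i)" for t
  proof -
    have "past_sum kernel_mark t \<omega> = ennreal (\<Sum>i\<in>{i \<in> ?P. ?\<theta> i < t}. exp (\<beta> * ?\<theta> i) * \<Lambda> * Z i \<omega>)"
      using \<Lambda>_pos unfolding kernel_mark_def by (subst past_sum_eq_sum(1)[OF \<omega>]) (auto simp: space_pair_measure)
    moreover have "exp (- \<beta> * t) * (\<Sum>i\<in>{i \<in> ?P. ?\<theta> i < t}. exp (\<beta> * ?\<theta> i) * \<Lambda> * Z i \<omega>) =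
      (\<Sum>i\<in>{i\<in>?P. ?\<theta> i < t}. exp (- \<beta> * (t - ?\<theta> i)) * ?c i)"
      unfolding sum_distrib_left by (intro sum.cong) (auto simp: exp_diff algebra_simps exp_minus field_simps)
    moreover show nn: "0 \<le> (\<Sum>i\<in>{i\<in>?P. ?\<theta> i < t}. exp (- \<beta> * (t - ?\<theta> i)) * ?c i)"
      using \<Lambda>_pos mark_nonneg[OF \<omega>] by (intro sum_nonneg) auto
    ultimately show "rate t \<omega> = ennreal (baseline t + (\<Sum>i\<in>{i\<in>?P. ?\<theta> i < t}. exp (- \<beta> * (t - ?\<theta> i)) * ?c i))"
      using baseline_pos[of t] by (simp add: rate_def ennreal_mult'[symmetric] ennreal_plus[symmetric] del: ennreal_plus)
  qed
  show ?case
  proof (intro allI impI conjI)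
    fix s :: real assume s: "0 \<le> s"
    show "left_limit (\<lambda>u. lam u \<omega>) s = lam s \<omega>" by (rule sol(1)[OF s])
    show "ennreal (lam s \<omega>) = rate s \<omega>" unfolding rate sol(2)[OF s] baseline_def ..
    show "0 \<le> lam s \<omega>" using nn[of s] baseline_pos[of s] sol(2)[OF s] unfolding baseline_def by linarith
  qed
qed

abbreviation "\<mu> \<equiv> hawkes_compensator \<Theta> lam"

lemma measurable_rate_time: "\<omega> \<in> space Q \<Longrightarrow> (\<lambda>s. rate s \<omega>) \<in> borel_measurable borel"
  unfolding rate_def using measurable_past_sum_time[OF _ measurable_kernel_mark] by measurable

lemma measurable_rate [measurable]: "(\<lambda>(\<omega>, s). rate s \<omega>) \<in> borel_measurable Pred"
proof -
  have [measurable]: "(\<lambda>x. past_sum kernel_mark (snd x) (fst x)) \<in> borel_measurable Pred"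
    using predictable_past_sum[OF measurable_kernel_mark] by (simp add: split_beta')
  have time: "(\<lambda>x. snd x) \<in> borel_measurable Pred"
    using measurable_time_predictable by (simp add: measurable_restrict_space2_iff)
  have [measurable]: "(\<lambda>x. baseline (snd x)) \<in> borel_measurable Pred"
    "(\<lambda>x. exp (- \<beta> * snd x)) \<in> borel_measurable Pred"
    by (rule measurable_compose[OF time]; measurable)+
  show ?thesis unfolding rate_def split_beta by measurable
qed

sublocale leb: sigma_finite_measure leb
  by (rule sigma_finite_measure_restrict_space) (auto simp: lborel.sigma_finite_measure_axioms)

lemma sets_leb [measurable_cong]: "sets leb = sets Rplus"
  by (simp add: sets_restrict_space)

text \<open>The exceptional set does not depend on \<open>W\<close>, which allows time-dependent families of integrands on the
same path.\<close>

lemma nn_integral_compensator: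
  "AE \<omega> in Q. \<forall>W\<in>borel_measurable (Rplus \<Otimes>\<^sub>M Rplus).
     (\<integral>\<^sup>+ x. W x \<partial>\<mu> \<omega>) = (\<integral>\<^sup>+ s. rate s \<omega> * (\<integral>\<^sup>+ z. W (s, z) \<partial>\<Theta>) \<partial>leb)"
  using lam_eq_rate AE_space
proof eventually_elim
  case (elim \<omega>)
  then have \<omega>: "\<omega> \<in> space Q" by simp
  have [measurable]: "(\<lambda>s. rate s \<omega>) \<in> borel_measurable leb"
    using measurable_rate_time[OF \<omega>] by (simp add: measurable_restrict_space1)
  have e: "ennreal (left_limit (\<lambda>u. lam u \<omega>) s) = rate s \<omega>" if "0 \<le> s" for s
    using elim that by simp
  have r: "(\<lambda>(t, z). rate t \<omega>) \<in> borel_measurable (leb \<Otimes>\<^sub>M \<Theta>)"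
    unfolding split_beta by (rule measurable_compose[OF measurable_fst]) fact
  have l: "(\<lambda>(t, z). ennreal (left_limit (\<lambda>u. lam u \<omega>) t)) \<in> borel_measurable (leb \<Otimes>\<^sub>M \<Theta>)"
  proof (rule measurable_cong[THEN iffD2, OF _ r])
    fix x assume "x \<in> space (leb \<Otimes>\<^sub>M \<Theta>)"
    then have "0 \<le> fst x" by (auto simp: space_pair_measure)
    then show "(\<lambda>(t, z). ennreal (left_limit (\<lambda>u. lam u \<omega>) t)) x = (\<lambda>(t, z). rate t \<omega>) x"
      using e by (simp add: split_beta)
  qed
  have eq: "\<mu> \<omega> = density (leb \<Otimes>\<^sub>M \<Theta>) (\<lambda>(t, z). rate t \<omega>)"
    unfolding hawkes_compensator_def
    by (intro density_cong l r AE_I2) (auto simp: space_pair_measure e)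
  show ?case
  proof
    fix W :: "real \<times> real \<Rightarrow> ennreal" assume W: "W \<in> borel_measurable (Rplus \<Otimes>\<^sub>M Rplus)"
    then have [measurable]: "W \<in> borel_measurable (leb \<Otimes>\<^sub>M \<Theta>)"
      by (subst measurable_cong_sets[OF sets_pair_measure_cong[OF sets_leb sets_\<Theta>] refl])
    have "(\<integral>\<^sup>+ x. W x \<partial>\<mu> \<omega>) = (\<integral>\<^sup>+ x. (\<lambda>(t, z). rate t \<omega>) x * W x \<partial>(leb \<Otimes>\<^sub>M \<Theta>))"
      unfolding eq by (rule nn_integral_density) measurable
    also have "\<dots> = (\<integral>\<^sup>+ s. \<integral>\<^sup>+ z. rate s \<omega> * W (s, z) \<partial>\<Theta> \<partial>leb)"
      by (subst \<Theta>.nn_integral_fst[symmetric]) simp_all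
    also have "\<dots> = (\<integral>\<^sup>+ s. rate s \<omega> * (\<integral>\<^sup>+ z. W (s, z) \<partial>\<Theta>) \<partial>leb)"
    proof (rule nn_integral_cong)
      fix s :: real assume "s \<in> space leb"
      then show "(\<integral>\<^sup>+ z. rate s \<omega> * W (s, z) \<partial>\<Theta>) = rate s \<omega> * (\<integral>\<^sup>+ z. W (s, z) \<partial>\<Theta>)"
        by (intro nn_integral_cmult) measurable
    qed
    finally show "(\<integral>\<^sup>+ x. W x \<partial>\<mu> \<omega>) = (\<integral>\<^sup>+ s. rate s \<omega> * (\<integral>\<^sup>+ z. W (s, z) \<partial>\<Theta>) \<partial>leb)" .
  qed
qed

text \<open>The expected sum of a predictable integrand over the losses is the expected integral against the
explicit intensity. Every expectation below is computed from this identity.\<close>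

lemma compensation_formula:
  assumes "(\<lambda>((\<omega>, s), z). W \<omega> (s, z)) \<in> borel_measurable (Pred \<Otimes>\<^sub>M Rplus)"
  shows "(\<integral>\<^sup>+ \<omega>. (\<integral>\<^sup>+ x. W \<omega> x \<partial>\<nu> \<omega>) \<partial>Q) =
     (\<integral>\<^sup>+ \<omega>. (\<integral>\<^sup>+ s. rate s \<omega> * (\<integral>\<^sup>+ z. W \<omega> (s, z) \<partial>\<Theta>) \<partial>leb) \<partial>Q)"
proof -
  have "(\<integral>\<^sup>+ \<omega>. (\<integral>\<^sup>+ x. W \<omega> x \<partial>\<nu> \<omega>) \<partial>Q) = (\<integral>\<^sup>+ \<omega>. (\<integral>\<^sup>+ x. W \<omega> x \<partial>\<mu> \<omega>) \<partial>Q)"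
    using compensator[unfolded compensator_def, THEN spec, THEN mp, OF assms, THEN conjunct2]
    by (simp add: split_beta)
  also have "\<dots> = (\<integral>\<^sup>+ \<omega>. (\<integral>\<^sup>+ s. rate s \<omega> * (\<integral>\<^sup>+ z. W \<omega> (s, z) \<partial>\<Theta>) \<partial>leb) \<partial>Q)"
  proof (rule nn_integral_cong_AE)
    show "AE \<omega> in Q. (\<integral>\<^sup>+ x. W \<omega> x \<partial>\<mu> \<omega>) = (\<integral>\<^sup>+ s. rate s \<omega> * (\<integral>\<^sup>+ z. W \<omega> (s, z) \<partial>\<Theta>) \<partial>leb)"
      using nn_integral_compensator AE_space
    proof eventually_elim
      case (elim \<omega>)
      have "(\<lambda>x. ((\<omega>, fst x), snd x)) \<in> measurable (Rplus \<Otimes>\<^sub>M Rplus) ((Q \<Otimes>\<^sub>M Rplus) \<Otimes>\<^sub>M Rplus)"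
        using elim(2) by measurable
      from measurable_compose[OF this measurable_predictable_times[OF assms]]
      have "W \<omega> \<in> borel_measurable (Rplus \<Otimes>\<^sub>M Rplus)" by simp
      then show ?case using elim(1) by simp
    qed
  qed
  finally show ?thesis .
qed

end

section \<open>Second moments\<close>

context linear_hawkes
begin

sublocale Q_leb: pair_sigma_finite Q leb
  by (intro pair_sigma_finite.intro) (rule sigma_finite_measure_axioms leb.sigma_finite_measure_axioms)+

lemma predictable_swap:
  assumes "(\<lambda>(\<omega>, s). X s \<omega>) \<in> borel_measurable Pred"
  shows "(\<integral>\<^sup>+ \<omega>. (\<integral>\<^sup>+ s. X s \<omega> \<partial>leb) \<partial>Q) = (\<integral>\<^sup>+ s. (\<integral>\<^sup>+ \<omega>. X s \<omega> \<partial>Q) \<partial>leb)"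
    and "(\<lambda>s. \<integral>\<^sup>+ \<omega>. X s \<omega> \<partial>Q) \<in> borel_measurable leb"
    and "\<omega> \<in> space Q \<Longrightarrow> (\<lambda>s. X s \<omega>) \<in> borel_measurable leb"
    and "(\<lambda>\<omega>. \<integral>\<^sup>+ s. X s \<omega> \<partial>leb) \<in> borel_measurable Q"
proof -
  have m: "(\<lambda>x. X (snd x) (fst x)) \<in> borel_measurable (Q \<Otimes>\<^sub>M leb)"
    using predictable_imp_measurable[OF assms]
    by (simp add: measurable_cong_sets[OF sets_pair_measure_cong[OF refl sets_leb] refl] split_beta')
  show "(\<integral>\<^sup>+ \<omega>. (\<integral>\<^sup>+ s. X s \<omega> \<partial>leb) \<partial>Q) = (\<integral>\<^sup>+ s. (\<integral>\<^sup>+ \<omega>. X s \<omega> \<partial>Q) \<partial>leb)"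
    using Q_leb.Fubini[OF m] by simp
  show "(\<lambda>s. \<integral>\<^sup>+ \<omega>. X s \<omega> \<partial>Q) \<in> borel_measurable leb"
    using measurable_pair_swap[OF m] by (intro borel_measurable_nn_integral) simp
  show "(\<lambda>\<omega>. \<integral>\<^sup>+ s. X s \<omega> \<partial>leb) \<in> borel_measurable Q"
    using m by (intro leb.borel_measurable_nn_integral) (simp add: split_beta')
  show "(\<lambda>s. X s \<omega>) \<in> borel_measurable leb" if "\<omega> \<in> space Q"
    using measurable_compose[OF measurable_Pair1'[OF that] m] by simp
qed

text \<open>The total size of the past losses. Since \<open>f\<close> is linear it dominates the intensity (\<open>rate_le\<close>), so its
moments control everything else.\<close>

definition "past_claims = past_sum (\<lambda>x. ennreal (snd x))"

lemma measurable_mark_fun [measurable]: "(\<lambda>x. ennreal (snd x)) \<in> borel_measurable ((Rplus::real measure) \<Otimes>\<^sub>M Rplus)"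
  by measurable

lemma predictable_past_claims: "(\<lambda>(\<omega>, s). past_claims s \<omega>) \<in> borel_measurable Pred"
  unfolding past_claims_def by (rule predictable_past_sum) measurable

lemma past_claims_finite: "\<omega> \<in> space Q \<Longrightarrow> past_claims s \<omega> < \<infinity>"
  unfolding past_claims_def by (rule past_sum_finite) auto

lemma past_claims_mono: "s \<le> t \<Longrightarrow> past_claims s \<omega> \<le> past_claims t \<omega>"
  unfolding past_claims_def by (rule past_sum_mono)

lemma rate_le:
  assumes "0 \<le> s"
  shows "rate s \<omega> \<le> ennreal lam0 + ennreal \<Lambda> * past_claims s \<omega>"
proof -
  have "ennreal (exp (- \<beta> * s)) * past_sum kernel_mark s \<omega> = past_sum (\<lambda>x. ennreal (exp (- \<beta> * s)) * kernel_mark x) s \<omega>"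
    by (rule past_sum_cmult[symmetric]) measurable
  also have "\<dots> \<le> past_sum (\<lambda>x. ennreal \<Lambda> * ennreal (snd x)) s \<omega>"
  proof (rule past_sum_mono_fun)
    fix r z :: real assume r: "0 \<le> r" "r < s" "0 \<le> z"
    have "\<beta> * r \<le> \<beta> * s" using r \<beta>_pos by simp
    then have "exp (- \<beta> * s) * exp (\<beta> * r) \<le> 1"
      by (simp add: exp_add[symmetric])
    then have "exp (- \<beta> * s) * exp (\<beta> * r) * (\<Lambda> * z) \<le> 1 * (\<Lambda> * z)"
      using \<Lambda>_pos r by (intro mult_right_mono) auto
    then show "ennreal (exp (- \<beta> * s)) * kernel_mark (r, z) \<le> ennreal \<Lambda> * ennreal (snd (r, z))"
      using \<Lambda>_pos r by (simp add: kernel_mark_def ennreal_mult[symmetric] mult.assoc)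
  qed
  also have "\<dots> = ennreal \<Lambda> * past_claims s \<omega>"
    unfolding past_claims_def by (rule past_sum_cmult) measurable
  finally show ?thesis unfolding rate_def by (intro add_mono ennreal_leI baseline_le assms)
qed

lemma one_plus_square_le: "(1 + y)\<^sup>2 \<le> 2 * (1 + y\<^sup>2)" for y :: ennreal
proof (cases y)
  case (real r)
  have "(1 + r)\<^sup>2 \<le> 2 * (1 + r\<^sup>2)"
    using zero_le_power2[of "1 - r"] by (simp add: power2_eq_square algebra_simps)
  then have "ennreal ((1 + r)\<^sup>2) \<le> ennreal (2 * (1 + r\<^sup>2))" by (rule ennreal_leI)
  then show ?thesis using real
    by (simp add: ennreal_power[symmetric] ennreal_mult')
qed (simp add: power2_eq_square)

lemma jump_moment_bound:
  fixes y :: ennreal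
  shows "(ennreal lam0 + ennreal \<Lambda> * y) * (2 * y * ennreal mark_mean + ennreal mark_square)
    \<le> ennreal (2 * (lam0 + \<Lambda>) * (2 * mark_mean + mark_square)) * (1 + y\<^sup>2)"
proof -
  have l0: "0 \<le> lam0" using base_less base_nonneg by simp
  have "(ennreal lam0 + ennreal \<Lambda> * y) * (2 * y * ennreal mark_mean + ennreal mark_square)
     \<le> (ennreal (lam0 + \<Lambda>) * (1 + y)) * (ennreal (2 * mark_mean + mark_square) * (1 + y))"
  proof (rule mult_mono)
    show "ennreal lam0 + ennreal \<Lambda> * y \<le> ennreal (lam0 + \<Lambda>) * (1 + y)"
      using l0 \<Lambda>_pos by (simp add: algebra_simps add_increasing2)
    have "2 * y * ennreal mark_mean + ennreal mark_square \<le> ennreal (2 * mark_mean) * y + ennreal mark_square + (ennreal (2 * mark_mean) + ennreal mark_square * y)"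
      using mark_moments_nonneg by (simp add: ennreal_mult' ac_simps)
    also have "\<dots> = ennreal (2 * mark_mean + mark_square) * (1 + y)"
      using mark_moments_nonneg by (simp add: algebra_simps)
    finally show "2 * y * ennreal mark_mean + ennreal mark_square \<le> ennreal (2 * mark_mean + mark_square) * (1 + y)" .
  qed auto
  also have "\<dots> = ennreal ((lam0 + \<Lambda>) * (2 * mark_mean + mark_square)) * (1 + y)\<^sup>2"
    using l0 \<Lambda>_pos mark_moments_nonneg by (simp add: ennreal_mult power2_eq_square ac_simps)
  also have "\<dots> \<le> ennreal ((lam0 + \<Lambda>) * (2 * mark_mean + mark_square)) * (2 * (1 + y\<^sup>2))"
    by (intro mult_left_mono one_plus_square_le) auto
  also have "\<dots> = ennreal (2 * (lam0 + \<Lambda>) * (2 * mark_mean + mark_square)) * (1 + y\<^sup>2)"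
    using l0 \<Lambda>_pos mark_moments_nonneg by (simp add: ennreal_mult' algebra_simps)
  finally show ?thesis .
qed

text \<open>Past claims increase, so if their value at \<open>t\<close> is at most \<open>c\<close>, then the same holds at every earlier
loss. Truncating each increment in its predictable left limit is therefore no loss.\<close>

lemma truncated_square_le:
  assumes \<omega>: "\<omega> \<in> space Q"
  shows "(past_claims t \<omega>)\<^sup>2 * indicator {..c} (past_claims t \<omega>) \<le>
    (\<integral>\<^sup>+ x. (2 * past_claims (fst x) \<omega> * ennreal (snd x) + (ennreal (snd x))\<^sup>2) * (indicator {..<t} (fst x) * indicator {..c} (past_claims (fst x) \<omega>)) \<partial>\<nu> \<omega>)"
proof (cases "past_claims t \<omega> \<le> c")
  case True
  let ?u = "\<lambda>x :: real \<times> real. ennreal (snd x) * indicator {..<t} (fst x)"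
  have [measurable]: "?u \<in> borel_measurable (Rplus \<Otimes>\<^sub>M Rplus)" by measurable
  have "(past_claims t \<omega>)\<^sup>2 = (\<integral>\<^sup>+ x. ?u x \<partial>\<nu> \<omega>)\<^sup>2" by (simp add: past_claims_def past_sum_def)
  also have "\<dots> = (\<integral>\<^sup>+ x. 2 * past_sum ?u (fst x) \<omega> * ?u x + (?u x)\<^sup>2 \<partial>\<nu> \<omega>)"
    by (rule nn_integral_counting_square[OF \<omega>]) measurable
  also have "\<dots> \<le> (\<integral>\<^sup>+ x. (2 * past_claims (fst x) \<omega> * ennreal (snd x) + (ennreal (snd x))\<^sup>2) * (indicator {..<t} (fst x) * indicator {..c} (past_claims (fst x) \<omega>)) \<partial>\<nu> \<omega>)"
  proof (rule nn_integral_mono)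
    fix x :: "real \<times> real"
    have "past_sum ?u (fst x) \<omega> \<le> past_claims (fst x) \<omega>"
      unfolding past_claims_def by (rule past_sum_mono_fun) (auto simp: indicator_def)
    moreover have "past_claims (fst x) \<omega> \<le> c" if "fst x < t"
      using past_claims_mono[of "fst x" t \<omega>] that True by (auto intro: order_trans)
    ultimately show "2 * past_sum ?u (fst x) \<omega> * ?u x + (?u x)\<^sup>2 \<le>
      (2 * past_claims (fst x) \<omega> * ennreal (snd x) + (ennreal (snd x))\<^sup>2) * (indicator {..<t} (fst x) * indicator {..c} (past_claims (fst x) \<omega>))"
      by (auto simp: indicator_def intro!: add_mono mult_right_mono mult_left_mono)
  qed
  finally show ?thesis using True by simp
qed simp

text \<open>The bound does not depend on the truncation level \<open>c\<close>. The level enters only through the finiteness of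
the truncated moment, which starts the Gronwall argument.\<close>

lemma past_claims_truncated_bound:
  assumes t: "0 \<le> t" "t \<le> T" and c: "c < \<infinity>"
  defines "K \<equiv> 1 + 2 * (lam0 + \<Lambda>) * (2 * mark_mean + mark_square)"
  shows "(\<integral>\<^sup>+ \<omega>. (past_claims t \<omega>)\<^sup>2 * indicator {..c} (past_claims t \<omega>) \<partial>Q) \<le> ennreal (K * T * (1 + 2 * K * T * exp (2 * K * T)))"
proof -
  let ?V = "\<lambda>s \<omega>. (past_claims s \<omega>)\<^sup>2 * indicator {..c} (past_claims s \<omega>)"
  define y where "y s = (\<integral>\<^sup>+ \<omega>. ?V s \<omega> \<partial>Q)" for s
  have [measurable]: "(\<lambda>x. past_claims (snd x) (fst x)) \<in> borel_measurable Pred"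
    using predictable_past_claims by (simp add: split_beta')
  have V: "(\<lambda>(\<omega>, s). ?V s \<omega>) \<in> borel_measurable Pred"
    unfolding split_beta' by measurable
  have l0: "0 \<le> lam0" using base_less base_nonneg by simp
  have K: "0 < K" unfolding K_def using l0 \<Lambda>_pos mark_moments_nonneg by (intro add_pos_nonneg mult_nonneg_nonneg) auto
  have T: "0 \<le> T" using t by simp
  have step: "y s \<le> ennreal K * (\<integral>\<^sup>+ r. (1 + y r) * indicator {..<s} r \<partial>leb)" if s: "0 \<le> s" for s
  proof -
    let ?W = "\<lambda>\<omega> x. (2 * past_claims (fst x) \<omega> * ennreal (snd x) + (ennreal (snd x))\<^sup>2) * (indicator {..<s} (fst x) * indicator {..c} (past_claims (fst x) \<omega>))"
    note [measurable] = measurable_predictable_fst_pair[OF predictable_past_claims]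
      measurable_compose[OF measurable_fst measurable_time_predictable]
    have t1: "(\<lambda>x. snd (fst x)) \<in> borel_measurable (Pred \<Otimes>\<^sub>M (Rplus :: real measure))"
      by (rule measurable_compose[OF measurable_fst measurable_time_predictable'])
    have t2: "(\<lambda>x. snd x) \<in> borel_measurable (Pred \<Otimes>\<^sub>M (Rplus :: real measure))"
      using measurable_snd by (simp add: measurable_restrict_space2_iff)
    have [measurable]: "(\<lambda>x. indicator {..<s} (snd (fst x)) :: ennreal) \<in> borel_measurable (Pred \<Otimes>\<^sub>M (Rplus :: real measure))"
      by (rule measurable_compose[OF t1]) simp
    have [measurable]: "(\<lambda>x. ennreal (snd x)) \<in> borel_measurable (Pred \<Otimes>\<^sub>M (Rplus :: real measure))"
      by (rule measurable_compose[OF t2]) simp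
    have W: "(\<lambda>((\<omega>, s), z). ?W \<omega> (s, z)) \<in> borel_measurable (Pred \<Otimes>\<^sub>M Rplus)"
      unfolding split_beta' by simp
    have "y s \<le> (\<integral>\<^sup>+ \<omega>. (\<integral>\<^sup>+ x. ?W \<omega> x \<partial>\<nu> \<omega>) \<partial>Q)"
      unfolding y_def by (intro nn_integral_mono truncated_square_le)
    also have "\<dots> = (\<integral>\<^sup>+ \<omega>. (\<integral>\<^sup>+ r. rate r \<omega> * (\<integral>\<^sup>+ z. ?W \<omega> (r, z) \<partial>\<Theta>) \<partial>leb) \<partial>Q)"
      by (rule compensation_formula[OF W])
    also have "\<dots> \<le> (\<integral>\<^sup>+ \<omega>. (\<integral>\<^sup>+ r. ennreal K * ((1 + ?V r \<omega>) * indicator {..<s} r) \<partial>leb) \<partial>Q)"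
    proof (intro nn_integral_mono)
      fix \<omega> r assume "\<omega> \<in> space Q" "r \<in> space leb"
      then have r: "0 \<le> r" by simp
      have "(\<integral>\<^sup>+ z. ?W \<omega> (r, z) \<partial>\<Theta>) =
          (\<integral>\<^sup>+ z. (2 * past_claims r \<omega> * ennreal z + ennreal (z\<^sup>2)) \<partial>\<Theta>) * (indicator {..<s} r * indicator {..c} (past_claims r \<omega>))"
        by (subst nn_integral_multc[symmetric]) (auto simp: ennreal_power space_\<Theta> intro!: nn_integral_cong)
      also have "(\<integral>\<^sup>+ z. (2 * past_claims r \<omega> * ennreal z + ennreal (z\<^sup>2)) \<partial>\<Theta>) = 2 * past_claims r \<omega> * ennreal mark_mean + ennreal mark_square"
        by (subst nn_integral_add) (auto simp: nn_integral_cmult nn_integral_z)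
      finally have "rate r \<omega> * (\<integral>\<^sup>+ z. ?W \<omega> (r, z) \<partial>\<Theta>) =
         (rate r \<omega> * (2 * past_claims r \<omega> * ennreal mark_mean + ennreal mark_square)) * (indicator {..<s} r * indicator {..c} (past_claims r \<omega>))"
        by (simp add: mult.assoc)
      also have "\<dots> \<le> (ennreal (2 * (lam0 + \<Lambda>) * (2 * mark_mean + mark_square)) * (1 + (past_claims r \<omega>)\<^sup>2)) * (indicator {..<s} r * indicator {..c} (past_claims r \<omega>))"
        by (intro mult_right_mono order_trans[OF mult_right_mono[OF rate_le[OF r]] jump_moment_bound]) auto
      also have "\<dots> \<le> (ennreal K * (1 + (past_claims r \<omega>)\<^sup>2)) * (indicator {..<s} r * indicator {..c} (past_claims r \<omega>))"
        unfolding K_def by (intro mult_right_mono ennreal_leI) auto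
      also have "\<dots> \<le> ennreal K * ((1 + ?V r \<omega>) * indicator {..<s} r)"
        by (auto simp: indicator_def)
      finally show "rate r \<omega> * (\<integral>\<^sup>+ z. ?W \<omega> (r, z) \<partial>\<Theta>) \<le> ennreal K * ((1 + ?V r \<omega>) * indicator {..<s} r)" .
    qed
    also have "\<dots> = (\<integral>\<^sup>+ r. (\<integral>\<^sup>+ \<omega>. ennreal K * ((1 + ?V r \<omega>) * indicator {..<s} r) \<partial>Q) \<partial>leb)"
    proof (rule predictable_swap(1))
      have [measurable]: "(\<lambda>x. indicator {..<s} (snd x) :: ennreal) \<in> borel_measurable Pred"
        by (rule measurable_compose[OF measurable_time_predictable']) simp
      have [measurable]: "(\<lambda>x. ?V (snd x) (fst x)) \<in> borel_measurable Pred" using V by (simp add: split_beta')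
      show "(\<lambda>(\<omega>, r). ennreal K * ((1 + ?V r \<omega>) * indicator {..<s} r)) \<in> borel_measurable Pred"
        unfolding split_beta' by measurable
    qed
    also have "\<dots> = (\<integral>\<^sup>+ r. ennreal K * ((1 + y r) * indicator {..<s} r) \<partial>leb)"
    proof (rule nn_integral_cong)
      fix r assume "r \<in> space leb"
      then have [measurable]: "(\<lambda>\<omega>. ?V r \<omega>) \<in> borel_measurable Q"
        by (intro measurable_omega_predictable[OF V]) auto
      have "(\<integral>\<^sup>+ \<omega>. ennreal K * ((1 + ?V r \<omega>) * indicator {..<s} r) \<partial>Q) =
        ennreal K * ((\<integral>\<^sup>+ \<omega>. 1 + ?V r \<omega> \<partial>Q) * indicator {..<s} r)"
        by (simp add: nn_integral_cmult nn_integral_multc)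
      also have "(\<integral>\<^sup>+ \<omega>. 1 + ?V r \<omega> \<partial>Q) = 1 + y r"
        unfolding y_def by (subst nn_integral_add) (auto simp: emeasure_space_1)
      finally show "(\<integral>\<^sup>+ \<omega>. ennreal K * ((1 + ?V r \<omega>) * indicator {..<s} r) \<partial>Q) = ennreal K * ((1 + y r) * indicator {..<s} r)" .
    qed
    also have "\<dots> = ennreal K * (\<integral>\<^sup>+ r. (1 + y r) * indicator {..<s} r \<partial>leb)"
    proof (rule nn_integral_cmult)
      have [measurable]: "y \<in> borel_measurable leb" unfolding y_def by (rule predictable_swap(2)[OF V])
      have [measurable]: "indicator {..<s} \<in> borel_measurable leb" by (auto intro!: measurable_restrict_space1)
      show "(\<lambda>r. (1 + y r) * indicator {..<s} r) \<in> borel_measurable leb" by measurable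
    qed
    finally show ?thesis .
  qed
  \<comment> \<open>extension by zero to negative times, since the Gronwall lemma speaks of functions on the real line\<close>
  define u where "u s = y s * indicator {0..} s" for s
  have um[measurable]: "u \<in> borel_measurable borel"
  proof -
    have "y \<in> borel_measurable (restrict_space borel {0..})"
      using predictable_swap(2)[OF V] unfolding y_def
      by (simp add: measurable_cong_sets[OF sets_leb refl])
    then show ?thesis unfolding u_def by (subst (asm) borel_measurable_restrict_space_iff_ennreal) auto
  qed
  have u_le: "u s \<le> c\<^sup>2" for s
  proof -
    have "y s \<le> (\<integral>\<^sup>+ \<omega>. c\<^sup>2 \<partial>Q)"
      unfolding y_def by (intro nn_integral_mono) (auto simp: indicator_def intro!: power_mono)
    then show ?thesis by (auto simp: u_def indicator_def emeasure_space_1)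
  qed
  have "u t \<le> ennreal (K * T * (1 + 2 * K * T * exp (2 * K * T)))"
  proof (rule gronwall_ennreal[OF um _ K _ _ t])
    show "0 \<le> K * T" using K T by simp
    have "(\<integral>\<^sup>+ s. u s * indicator {0..T} s \<partial>lborel) \<le> (\<integral>\<^sup>+ s. c\<^sup>2 * indicator {0..T} s \<partial>lborel)"
      by (intro nn_integral_mono mult_right_mono u_le) auto
    also have "\<dots> < \<infinity>" using c T by (simp add: nn_integral_cmult ennreal_mult_less_top power2_eq_square)
    finally show "(\<integral>\<^sup>+ s. u s * indicator {0..T} s \<partial>lborel) < \<infinity>" .
    fix s assume s: "0 \<le> s" "s \<le> T"
    have "u s = y s" using s by (simp add: u_def)
    also have "\<dots> \<le> ennreal K * (\<integral>\<^sup>+ r. (1 + y r) * indicator {..<s} r \<partial>leb)" by (rule step[OF s(1)])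
    also have "(\<integral>\<^sup>+ r. (1 + y r) * indicator {..<s} r \<partial>leb) \<le> (\<integral>\<^sup>+ r. indicator {0..s} r + u r * indicator {0..s} r \<partial>lborel)"
      by (subst nn_integral_restrict_space) (auto intro!: nn_integral_mono simp: u_def indicator_def)
    also have "\<dots> = ennreal s + (\<integral>\<^sup>+ r. u r * indicator {0..s} r \<partial>lborel)"
      using s by (subst nn_integral_add) auto
    finally have "u s \<le> ennreal K * (ennreal s + (\<integral>\<^sup>+ r. u r * indicator {0..s} r \<partial>lborel))"
      by (simp add: mult_left_mono)
    also have "\<dots> \<le> ennreal (K * T) + ennreal K * (\<integral>\<^sup>+ r. u r * indicator {0..s} r \<partial>lborel)"
      using s K by (auto simp: distrib_left ennreal_mult'[symmetric] intro!: add_mono ennreal_leI)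
    finally show "u s \<le> ennreal (K * T) + ennreal K * (\<integral>\<^sup>+ r. u r * indicator {0..s} r \<partial>lborel)" .
  qed
  then show ?thesis using t by (simp add: u_def y_def)
qed

lemma past_claims_second_moment:
  assumes "0 \<le> t"
  shows "(\<integral>\<^sup>+ \<omega>. (past_claims t \<omega>)\<^sup>2 \<partial>Q) < \<infinity>"
proof -
  let ?V = "\<lambda>n \<omega>. (past_claims t \<omega>)\<^sup>2 * indicator {..of_nat n} (past_claims t \<omega>)"
  have [measurable]: "past_claims t \<in> borel_measurable Q"
    by (rule measurable_omega_predictable[OF predictable_past_claims assms])
  have "(\<integral>\<^sup>+ \<omega>. (past_claims t \<omega>)\<^sup>2 \<partial>Q) \<le> (\<integral>\<^sup>+ \<omega>. (SUP n. ?V n \<omega>) \<partial>Q)"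
  proof (rule nn_integral_mono)
    fix \<omega> assume "\<omega> \<in> space Q"
    then have "past_claims t \<omega> < \<infinity>" by (rule past_claims_finite)
    then obtain n where "past_claims t \<omega> < of_nat n"
      using ennreal_Ex_less_of_nat by (auto simp: less_top)
    then have "(past_claims t \<omega>)\<^sup>2 = ?V n \<omega>" by simp
    also have "\<dots> \<le> (SUP n. ?V n \<omega>)" by (rule SUP_upper) simp
    finally show "(past_claims t \<omega>)\<^sup>2 \<le> (SUP n. ?V n \<omega>)" .
  qed
  also have "\<dots> = (SUP n. \<integral>\<^sup>+ \<omega>. ?V n \<omega> \<partial>Q)"
  proof (rule nn_integral_monotone_convergence_SUP)
    have "?V m \<omega> \<le> ?V n \<omega>" if "m \<le> n" for m n \<omega>
    proof -
      have "(of_nat m :: ennreal) \<le> of_nat n" using that by simp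
      then have "past_claims t \<omega> \<le> of_nat n" if "past_claims t \<omega> \<le> of_nat m" by (rule order_trans[OF that])
      then show ?thesis by (cases "past_claims t \<omega> \<le> of_nat m") (simp_all add: indicator_def)
    qed
    then show "incseq ?V" by (auto simp: incseq_def le_fun_def)
  qed measurable
  also have "\<dots> \<le> ennreal ((1 + 2 * (lam0 + \<Lambda>) * (2 * mark_mean + mark_square)) * t *
      (1 + 2 * (1 + 2 * (lam0 + \<Lambda>) * (2 * mark_mean + mark_square)) * t * exp (2 * (1 + 2 * (lam0 + \<Lambda>) * (2 * mark_mean + mark_square)) * t)))"
    using assms by (intro SUP_least past_claims_truncated_bound) (auto simp: of_nat_less_top)
  also have "\<dots> < \<infinity>" by simp
  finally show ?thesis .
qed

end

section \<open>The mean intensity\<close>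

lemma (in complete_measure) borel_measurable_AE_eq:
  assumes f: "f \<in> measurable M N" and ae: "AE x in M. g x = f x" and g: "g \<in> space M \<rightarrow> space N"
  shows "g \<in> measurable M N"
proof (rule measurableI)
  fix S assume "S \<in> sets N"
  then have "f -` S \<inter> space M \<in> sets M" using f by (rule measurable_sets[rotated])
  then show "g -` S \<inter> space M \<in> sets M"
    by (rule in_sets_AE[rotated]) (use ae in \<open>auto elim!: eventually_mono\<close>)
qed (use g in auto)

context linear_hawkes
begin

lemma AE_leb_neq: "AE s in leb. s \<noteq> a"
  by (subst AE_restrict_space_iff) (auto intro: AE_mp[OF AE_lborel_singleton[of a]])

text \<open>The continuous analogue of the square of a sum; the diagonal is a null set.\<close>

lemma nn_integral_leb_square:
  assumes [measurable]: "w \<in> borel_measurable leb"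
  shows "(\<integral>\<^sup>+ s. w s \<partial>leb)\<^sup>2 = 2 * (\<integral>\<^sup>+ s. w s * (\<integral>\<^sup>+ r. w r * indicator {..s} r \<partial>leb) \<partial>leb)"
proof -
  interpret LL: pair_sigma_finite leb leb
    by (intro pair_sigma_finite.intro leb.sigma_finite_measure_axioms)
  have [measurable]: "indicator {..a} \<in> borel_measurable leb" "indicator {a<..} \<in> borel_measurable leb" "indicator {..<a} \<in> borel_measurable leb"
    for a :: real by (auto intro!: measurable_restrict_space1)
  have fs: "(\<lambda>x. fst x) \<in> borel_measurable (leb \<Otimes>\<^sub>M leb)" "(\<lambda>x. snd x) \<in> borel_measurable (leb \<Otimes>\<^sub>M leb)"
    by (auto intro!: measurable_compose[OF measurable_snd] measurable_compose[OF measurable_fst] measurable_restrict_space1)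
  note [measurable] = fs
  have W[measurable]: "(\<lambda>(s, r). w s * w r * indicator {x. fst x < snd x} (s, r)) \<in> borel_measurable (leb \<Otimes>\<^sub>M leb)"
    by measurable
  have W2[measurable]: "(\<lambda>(s, r). w s * w r * indicator {x. snd x \<le> fst x} (s, r)) \<in> borel_measurable (leb \<Otimes>\<^sub>M leb)"
    by measurable
  let ?P = "\<integral>\<^sup>+ s. w s * (\<integral>\<^sup>+ r. w r * indicator {..s} r \<partial>leb) \<partial>leb"
  have P: "?P = (\<integral>\<^sup>+ s. \<integral>\<^sup>+ r. w s * w r * indicator {x. snd x \<le> fst x} (s, r) \<partial>leb \<partial>leb)"
    by (intro nn_integral_cong, subst nn_integral_cmult[symmetric]) (auto simp: indicator_def mult.assoc)
  have "(\<integral>\<^sup>+ s. \<integral>\<^sup>+ r. w s * w r * indicator {x. fst x < snd x} (s, r) \<partial>leb \<partial>leb) =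
     (\<integral>\<^sup>+ r. \<integral>\<^sup>+ s. w s * w r * indicator {x. fst x < snd x} (s, r) \<partial>leb \<partial>leb)"
    using LL.Fubini[OF W] by (simp add: split_beta')
  also have "\<dots> = (\<integral>\<^sup>+ r. \<integral>\<^sup>+ s. w r * w s * indicator {x. snd x \<le> fst x} (r, s) \<partial>leb \<partial>leb)"
  proof (rule nn_integral_cong, rule nn_integral_cong_AE)
    fix r :: real
    show "AE s in leb. w s * w r * indicator {x. fst x < snd x} (s, r) = w r * w s * indicator {x. snd x \<le> fst x} (r, s)"
      using AE_leb_neq[of r] by eventually_elim (auto simp: indicator_def mult.commute)
  qed
  finally have N: "(\<integral>\<^sup>+ s. \<integral>\<^sup>+ r. w s * w r * indicator {x. fst x < snd x} (s, r) \<partial>leb \<partial>leb) = ?P"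
    unfolding P .
  have "(\<integral>\<^sup>+ s. w s \<partial>leb)\<^sup>2 = (\<integral>\<^sup>+ s. \<integral>\<^sup>+ r. w s * w r \<partial>leb \<partial>leb)"
    by (simp add: power2_eq_square nn_integral_cmult nn_integral_multc)
  also have "\<dots> = (\<integral>\<^sup>+ s. (\<integral>\<^sup>+ r. w s * w r * indicator {x. snd x \<le> fst x} (s, r) \<partial>leb) +
      (\<integral>\<^sup>+ r. w s * w r * indicator {x. fst x < snd x} (s, r) \<partial>leb) \<partial>leb)"
  proof (rule nn_integral_cong)
    fix s assume s: "s \<in> space leb"
    have "(\<integral>\<^sup>+ r. w s * w r \<partial>leb) = (\<integral>\<^sup>+ r. w s * w r * indicator {x. snd x \<le> fst x} (s, r) +
       w s * w r * indicator {x. fst x < snd x} (s, r) \<partial>leb)"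
      by (intro nn_integral_cong) (auto simp: indicator_def)
    also have "\<dots> = (\<integral>\<^sup>+ r. w s * w r * indicator {x. snd x \<le> fst x} (s, r) \<partial>leb) +
      (\<integral>\<^sup>+ r. w s * w r * indicator {x. fst x < snd x} (s, r) \<partial>leb)"
      using measurable_compose[OF measurable_Pair1'[OF s] W] measurable_compose[OF measurable_Pair1'[OF s] W2]
      by (intro nn_integral_add) simp_all
    finally show "(\<integral>\<^sup>+ r. w s * w r \<partial>leb) = (\<integral>\<^sup>+ r. w s * w r * indicator {x. snd x \<le> fst x} (s, r) \<partial>leb) +
      (\<integral>\<^sup>+ r. w s * w r * indicator {x. fst x < snd x} (s, r) \<partial>leb)" .
  qed
  also have "\<dots> = ?P + ?P"
    using leb.borel_measurable_nn_integral[OF W] leb.borel_measurable_nn_integral[OF W2]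
    by (subst nn_integral_add) (simp_all add: N P)
  finally show ?thesis by (simp add: mult_2)
qed

text \<open>The mean intensity as an extended real, so that it can be used before it is known to be finite.\<close>

definition "mean s = (\<integral>\<^sup>+ \<omega>. rate s \<omega> \<partial>Q)"

lemma measurable_rate_at [measurable]: "0 \<le> s \<Longrightarrow> rate s \<in> borel_measurable Q"
  by (rule measurable_omega_predictable[OF measurable_rate])

lemma measurable_mean [measurable]: "mean \<in> borel_measurable leb"
  unfolding mean_def by (rule predictable_swap(2)[OF measurable_rate])

lemma past_claims_first_moment: "0 \<le> t \<Longrightarrow> (\<integral>\<^sup>+ \<omega>. past_claims t \<omega> \<partial>Q) < \<infinity>"
proof -
  assume t: "0 \<le> t"
  have [measurable]: "past_claims t \<in> borel_measurable Q"
    by (rule measurable_omega_predictable[OF predictable_past_claims t])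
  have le: "y \<le> 1 + y\<^sup>2" for y :: ennreal
  proof (cases "y \<le> 1")
    case True
    then show ?thesis by (simp add: add_increasing2)
  next
    case False
    then have "1 * y \<le> y * y" by (intro mult_right_mono) auto
    then show ?thesis by (simp add: power2_eq_square add_increasing)
  qed
  have "(\<integral>\<^sup>+ \<omega>. past_claims t \<omega> \<partial>Q) \<le> (\<integral>\<^sup>+ \<omega>. 1 + (past_claims t \<omega>)\<^sup>2 \<partial>Q)"
    by (intro nn_integral_mono le)
  also have "\<dots> = 1 + (\<integral>\<^sup>+ \<omega>. (past_claims t \<omega>)\<^sup>2 \<partial>Q)"
    by (subst nn_integral_add) (auto simp: emeasure_space_1)
  also have "\<dots> < \<infinity>" using past_claims_second_moment[OF t] by simp
  finally show ?thesis .
qed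

lemma mean_le:
  assumes "0 \<le> s" "s \<le> T"
  shows "mean s \<le> ennreal lam0 + ennreal \<Lambda> * (\<integral>\<^sup>+ \<omega>. past_claims T \<omega> \<partial>Q)"
proof -
  have [measurable]: "past_claims T \<in> borel_measurable Q"
    using assms by (intro measurable_omega_predictable[OF predictable_past_claims]) simp
  have "mean s \<le> (\<integral>\<^sup>+ \<omega>. ennreal lam0 + ennreal \<Lambda> * past_claims T \<omega> \<partial>Q)"
    unfolding mean_def
    by (intro nn_integral_mono order_trans[OF rate_le[OF assms(1)]] add_mono mult_left_mono past_claims_mono assms) auto
  also have "\<dots> = ennreal lam0 + ennreal \<Lambda> * (\<integral>\<^sup>+ \<omega>. past_claims T \<omega> \<partial>Q)"
    by (subst nn_integral_add) (auto simp: emeasure_space_1 nn_integral_cmult)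
  finally show ?thesis .
qed

lemma mean_bound_finite: "0 \<le> T \<Longrightarrow> ennreal lam0 + ennreal \<Lambda> * (\<integral>\<^sup>+ \<omega>. past_claims T \<omega> \<partial>Q) < \<infinity>"
  using past_claims_first_moment[of T] by (simp add: ennreal_mult_less_top)

lemma mean_ge: "ennreal (baseline s) \<le> mean s"
proof -
  have "ennreal (baseline s) = (\<integral>\<^sup>+ \<omega>. ennreal (baseline s) \<partial>Q)" by (simp add: emeasure_space_1)
  also have "\<dots> \<le> mean s" unfolding mean_def rate_def by (intro nn_integral_mono) auto
  finally show ?thesis .
qed

text \<open>Completeness of the probability space makes \<open>lam s\<close> measurable, as it is almost surely equal to the explicit
intensity.\<close>

lemma mean_intensity_eq:
  assumes "0 \<le> s"
  shows "ennreal (mean_intensity Q lam s) = mean s" and "0 \<le> mean_intensity Q lam s"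
proof -
  have ae: "AE \<omega> in Q. lam s \<omega> = enn2real (rate s \<omega>)"
    using lam_eq_rate
  proof eventually_elim
    case (elim \<omega>)
    then show ?case using assms by (metis enn2real_ennreal)
  qed
  interpret complete_measure Q by (rule complete_Q)
  have rm: "rate s \<in> borel_measurable Q" using assms by measurable
  have m: "(\<lambda>\<omega>. enn2real (rate s \<omega>)) \<in> borel_measurable Q" using rm by measurable
  have lm: "lam s \<in> borel_measurable Q"
    by (rule borel_measurable_AE_eq[OF m ae]) simp
  have "mean_intensity Q lam s = (\<integral>\<omega>. enn2real (rate s \<omega>) \<partial>Q)"
    unfolding mean_intensity_def using ae lm m by (intro integral_cong_AE) auto
  also have "\<dots> = enn2real (\<integral>\<^sup>+ \<omega>. ennreal (enn2real (rate s \<omega>)) \<partial>Q)"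
    using m by (intro integral_eq_nn_integral) auto
  also have "(\<integral>\<^sup>+ \<omega>. ennreal (enn2real (rate s \<omega>)) \<partial>Q) = mean s"
    unfolding mean_def using rate_finite by (intro nn_integral_cong) (auto simp: less_top)
  finally have eq: "mean_intensity Q lam s = enn2real (mean s)" .
  moreover have "mean s < \<infinity>"
    by (rule le_less_trans[OF mean_le[OF assms order.refl] mean_bound_finite[OF assms]])
  ultimately show "ennreal (mean_intensity Q lam s) = mean s" by (simp add: less_top)
  show "0 \<le> mean_intensity Q lam s" unfolding eq by simp
qed

end

locale linear_hawkes_horizon = linear_hawkes Q F \<tau> Z \<Theta> lam0 lam_base \<beta> \<Lambda> lam
  for Q :: "'a measure" and F and \<tau> and Z and \<Theta> and lam0 lam_base \<beta> \<Lambda> :: real and lam +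
  fixes T :: real
  assumes T_pos: "0 < T"
begin

text \<open>\<open>k(s) = \<integral> e^{-\<kappa>(t-s)} dt\<close> over \<open>[s,T]\<close>: the expected increase of the integral of the intensity over \<open>[s,T]\<close>
after a unit jump of the intensity at time \<open>s\<close>, counting all losses that it triggers.\<close>

definition "k s = (1 - exp (- \<kappa> * (T - s))) / \<kappa>"

definition "horizon s = (indicator {..T} s :: ennreal)"

lemma k_bounds: "s \<le> T \<Longrightarrow> 0 \<le> k s" "k s \<le> 1 / \<kappa>"
proof -
  show "s \<le> T \<Longrightarrow> 0 \<le> k s" using \<kappa>_pos by (simp add: k_def)
  show "k s \<le> 1 / \<kappa>" unfolding k_def using \<kappa>_pos by (intro divide_right_mono) auto
qed

lemma measurable_k [measurable]: "k \<in> borel_measurable borel"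
  unfolding k_def by measurable

lemma measurable_horizon [measurable]: "horizon \<in> borel_measurable borel"
  unfolding horizon_def[abs_def] by measurable

lemma mean_integral:
  fixes \<phi> :: "real \<Rightarrow> real"
  assumes [measurable]: "\<phi> \<in> borel_measurable borel"
    and \<phi>: "\<And>s. 0 \<le> s \<Longrightarrow> s \<le> T \<Longrightarrow> \<bar>\<phi> s\<bar> \<le> K"
  shows "set_integrable lborel {0..T} (\<lambda>s. mean_intensity Q lam s * \<phi> s)"
    and "(\<And>s. 0 \<le> s \<Longrightarrow> s \<le> T \<Longrightarrow> 0 \<le> \<phi> s) \<Longrightarrow> (\<integral>\<^sup>+ s. mean s * (ennreal (\<phi> s) * horizon s) \<partial>leb) =
     ennreal (LINT s:{0..T}|lborel. mean_intensity Q lam s * \<phi> s)"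
proof -
  let ?m = "mean_intensity Q lam"
  have "mean \<in> borel_measurable (restrict_space borel {0..})"
    using measurable_mean by (simp add: measurable_cong_sets[OF sets_leb refl])
  then have [measurable]: "(\<lambda>s. mean s * indicator {0..} s) \<in> borel_measurable borel"
    by (subst (asm) borel_measurable_restrict_space_iff_ennreal) auto
  define mb where "mb s = enn2real (mean s * indicator {0..} s)" for s
  have mb: "mb \<in> borel_measurable borel"
    unfolding mb_def by (rule borel_measurable_enn2real) fact
  have m: "indicator {0..T} s *\<^sub>R (?m s * \<phi> s) = indicator {0..T} s * (mb s * \<phi> s)" for s
  proof (cases "s \<in> {0..T}")
    case True
    then have "?m s = enn2real (mean s)"
      using mean_intensity_eq[of s] by (metis atLeastAtMost_iff enn2real_ennreal)
    then show ?thesis using True by (simp add: mb_def)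
  qed simp
  have meas: "(\<lambda>s. indicator {0..T} s *\<^sub>R (?m s * \<phi> s)) \<in> borel_measurable lborel"
  proof -
    have "(\<lambda>s. indicator {0..T} s * (mb s * \<phi> s)) \<in> borel_measurable borel"
      by (intro borel_measurable_times borel_measurable_indicator) (use mb assms(1) in auto)
    then show ?thesis unfolding m by simp
  qed
  define c where "c = enn2real (ennreal lam0 + ennreal \<Lambda> * (\<integral>\<^sup>+ \<omega>. past_claims T \<omega> \<partial>Q))"
  have c: "?m s \<le> c" if "0 \<le> s" "s \<le> T" for s
  proof -
    have "ennreal (?m s) \<le> ennreal c"
      using mean_le[OF that] mean_bound_finite[of T] T_pos mean_intensity_eq(1)[OF that(1)]
      unfolding c_def by (simp add: less_top)
    then show ?thesis unfolding c_def by (simp add: ennreal_le_iff)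
  qed
  show int: "set_integrable lborel {0..T} (\<lambda>s. ?m s * \<phi> s)"
    unfolding set_integrable_def
  proof (rule Bochner_Integration.integrable_bound[OF _ meas])
    have "set_integrable lborel {0..T} (\<lambda>s. c * K)"
      by (rule borel_integrable_atLeastAtMost') simp
    then show "integrable lborel (\<lambda>s. indicator {0..T} s *\<^sub>R (c * K))"
      by (simp add: set_integrable_def)
    have "\<bar>?m s * \<phi> s\<bar> \<le> \<bar>c * K\<bar>" if s: "0 \<le> s" "s \<le> T" for s
    proof -
      have "\<bar>?m s * \<phi> s\<bar> \<le> c * K"
        using c[OF s] \<phi>[OF s] mean_intensity_eq(2)[OF s(1)] unfolding abs_mult
        by (intro mult_mono) auto
      then show ?thesis by simp
    qed
    then show "AE s in lborel. norm (indicator {0..T} s *\<^sub>R (?m s * \<phi> s)) \<le> norm (indicator {0..T} s *\<^sub>R (c * K))"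
      by (intro AE_I2) (auto simp: indicator_def)
  qed
  assume nn: "\<And>s. 0 \<le> s \<Longrightarrow> s \<le> T \<Longrightarrow> 0 \<le> \<phi> s"
  have "(\<integral>\<^sup>+ s. mean s * (ennreal (\<phi> s) * horizon s) \<partial>leb) = (\<integral>\<^sup>+ s. mean s * (ennreal (\<phi> s) * horizon s) * indicator {0..} s \<partial>lborel)"
    by (rule nn_integral_restrict_space) simp
  also have "\<dots> = (\<integral>\<^sup>+ s. ennreal (indicator {0..T} s *\<^sub>R (?m s * \<phi> s)) \<partial>lborel)"
  proof (rule nn_integral_cong)
    fix s
    show "mean s * (ennreal (\<phi> s) * horizon s) * indicator {0..} s = ennreal (indicator {0..T} s *\<^sub>R (?m s * \<phi> s))"
      using mean_intensity_eq[of s] by (auto simp: horizon_def indicator_def ennreal_mult' mean_intensity_eq(1)[symmetric])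
  qed
  also have "\<dots> = ennreal (LINT s:{0..T}|lborel. ?m s * \<phi> s)"
    unfolding set_lebesgue_integral_def
    using int nn mean_intensity_eq(2) unfolding set_integrable_def
    by (intro nn_integral_eq_integral) (auto simp: indicator_def)
  finally show "(\<integral>\<^sup>+ s. mean s * (ennreal (\<phi> s) * horizon s) \<partial>leb) = ennreal (LINT s:{0..T}|lborel. ?m s * \<phi> s)" .
qed

lemma cumulative_nonneg: "0 \<le> cumulative_intensity Q lam T"
  unfolding cumulative_intensity_def set_lebesgue_integral_def
  by (intro integral_nonneg_AE AE_I2) (auto simp: indicator_def mean_intensity_eq(2))

end

section \<open>The martingale of the retained losses\<close>

text \<open>The function \<open>g\<close> is the part of each loss that the insurer keeps.\<close>

locale linear_hawkes_loss = linear_hawkes_horizon Q F \<tau> Z \<Theta> lam0 lam_base \<beta> \<Lambda> lam T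
  for Q :: "'a measure" and F and \<tau> and Z and \<Theta> and lam0 lam_base \<beta> \<Lambda> :: real and lam and T +
  fixes g :: "real \<Rightarrow> real"
  assumes g_measurable [measurable]: "g \<in> borel_measurable Rplus"
    and g_nonneg: "0 \<le> z \<Longrightarrow> 0 \<le> g z" and g_le: "0 \<le> z \<Longrightarrow> g z \<le> z"
begin

lemma g_measurable_\<Theta> [measurable]: "g \<in> borel_measurable \<Theta>"
  using g_measurable by (simp add: measurable_cong_sets[OF sets_\<Theta> refl])

definition "mean_retained = (\<integral>z. g z \<partial>\<Theta>)"

text \<open>A loss \<open>z\<close> at time \<open>s\<close> moves the conditional expectation of the retained total by \<open>w s z\<close>: the retained part
itself, and \<open>mean_retained\<close> for each further loss that it triggers on average. The functions \<open>h\<close> and \<open>h2\<close> are the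
first two moments of \<open>w s\<close>, and \<open>u\<close> is \<open>w\<close> cut off at \<open>T\<close>, after which \<open>k\<close> is negative.\<close>

definition "w s z = g z + mean_retained * k s * (\<Lambda> * z)"
definition "h s = mean_retained + mean_retained * k s * (\<Lambda> * mark_mean)"
definition "h2 s = (\<integral>z. (w s z)\<^sup>2 \<partial>\<Theta>)"
definition "u = (\<lambda>x. ennreal (w (fst x) (snd x)) * horizon (fst x))"

lemma abs_g_le: "0 \<le> z \<Longrightarrow> \<bar>g z\<bar> \<le> z"
  using g_nonneg g_le by simp

lemmas integrable_g = integrable_single[OF g_measurable_\<Theta> abs_g_le]

lemma mean_retained_nonneg: "0 \<le> mean_retained"
  unfolding mean_retained_def by (intro integral_nonneg_AE AE_I2) (auto simp: space_\<Theta> g_nonneg)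

lemma w_alt: "w s z = g z + mean_retained * k s * \<Lambda> * z"
  by (simp add: w_def mult.assoc)

lemma integrable_w_square: "integrable \<Theta> (\<lambda>z. (w s z)\<^sup>2)"
  unfolding w_alt by (rule shifted_square(1)[OF g_measurable_\<Theta> abs_g_le])

lemma h2_eq: "h2 s = (\<integral>z. (g z)\<^sup>2 \<partial>\<Theta>) + 2 * (mean_retained * k s * \<Lambda>) * (\<integral>z. z * g z \<partial>\<Theta>) + (mean_retained * k s * \<Lambda>)\<^sup>2 * mark_square"
  unfolding h2_def w_alt by (rule shifted_square(2)[OF g_measurable_\<Theta> abs_g_le])

lemma measurable_h [measurable]: "h \<in> borel_measurable borel" "h2 \<in> borel_measurable borel"
proof -
  show "h \<in> borel_measurable borel" unfolding h_def[abs_def] by measurable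
  show "h2 \<in> borel_measurable borel" unfolding h2_eq[abs_def] by measurable
qed

lemma w_bounds:
  assumes "s \<le> T" "0 \<le> z"
  shows "0 \<le> w s z" "w s z \<le> (1 + mean_retained / \<kappa> * \<Lambda>) * z"
proof -
  show "0 \<le> w s z" unfolding w_def
    using g_nonneg[OF assms(2)] mean_retained_nonneg k_bounds(1)[OF assms(1)] \<Lambda>_pos assms by simp
  have "mean_retained * k s * (\<Lambda> * z) \<le> mean_retained * (1 / \<kappa>) * (\<Lambda> * z)"
    using mean_retained_nonneg k_bounds(2) \<Lambda>_pos assms by (intro mult_right_mono mult_left_mono) auto
  then show "w s z \<le> (1 + mean_retained / \<kappa> * \<Lambda>) * z" unfolding w_def
    using g_le[OF assms(2)] by (simp add: algebra_simps)
qed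

lemma h_bounds:
  assumes "s \<le> T" shows "0 \<le> h s" "h s \<le> mean_retained + mean_retained / \<kappa> * \<Lambda> * mark_mean" "0 \<le> h2 s"
proof -
  show "0 \<le> h s" unfolding h_def using mean_retained_nonneg k_bounds(1)[OF assms] \<Lambda>_pos mark_moments_nonneg by simp
  have "mean_retained * k s * (\<Lambda> * mark_mean) \<le> mean_retained * (1 / \<kappa>) * (\<Lambda> * mark_mean)"
    using mean_retained_nonneg k_bounds(2) \<Lambda>_pos mark_moments_nonneg by (intro mult_right_mono mult_left_mono) auto
  then show "h s \<le> mean_retained + mean_retained / \<kappa> * \<Lambda> * mark_mean" unfolding h_def by simp
  show "0 \<le> h2 s" unfolding h2_def by simp
qed

lemma measurable_u [measurable]: "u \<in> borel_measurable (Rplus \<Otimes>\<^sub>M Rplus)"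
  unfolding u_def w_def by measurable

lemma measurable_u_section:
  assumes "0 \<le> s" shows "(\<lambda>z. u (s, z)) \<in> borel_measurable \<Theta>"
proof -
  have "s \<in> space (Rplus :: real measure)" using assms by simp
  from measurable_compose[OF measurable_Pair1'[OF this] measurable_u]
  show ?thesis by (simp add: measurable_cong_sets[OF sets_\<Theta> refl])
qed

definition "h_cut s = ennreal (h s) * horizon s"
definition "h2_cut s = ennreal (h2 s) * horizon s"

lemma integral_u:
  assumes "0 \<le> s"
  shows "(\<integral>\<^sup>+ z. u (s, z) \<partial>\<Theta>) = h_cut s" "(\<integral>\<^sup>+ z. (u (s, z))\<^sup>2 \<partial>\<Theta>) = h2_cut s"
proof -
  have im: "integrable \<Theta> (w s)" unfolding w_def[abs_def] using integrable_g by simp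
  have m[measurable]: "w s \<in> borel_measurable \<Theta>" using im by simp
  show "(\<integral>\<^sup>+ z. u (s, z) \<partial>\<Theta>) = h_cut s"
  proof (cases "s \<le> T")
    case True
    have "(\<integral>\<^sup>+ z. ennreal (w s z) \<partial>\<Theta>) = ennreal (\<integral>z. w s z \<partial>\<Theta>)"
      using True w_bounds(1) by (intro nn_integral_eq_integral im AE_I2) (auto simp: space_\<Theta>)
    also have "(\<integral>z. w s z \<partial>\<Theta>) = h s"
      unfolding w_def h_def mean_retained_def mark_mean_def using integrable_g by simp
    finally show ?thesis using True by (simp add: u_def h_cut_def horizon_def)
  qed (simp add: u_def h_cut_def horizon_def)
  show "(\<integral>\<^sup>+ z. (u (s, z))\<^sup>2 \<partial>\<Theta>) = h2_cut s"
  proof (cases "s \<le> T")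
    case True
    have "(\<integral>\<^sup>+ z. (u (s, z))\<^sup>2 \<partial>\<Theta>) = (\<integral>\<^sup>+ z. ennreal ((w s z)\<^sup>2) \<partial>\<Theta>)"
      using True w_bounds(1) by (intro nn_integral_cong) (auto simp: u_def horizon_def space_\<Theta> ennreal_power)
    also have "\<dots> = ennreal (h2 s)"
      unfolding h2_def by (intro nn_integral_eq_integral integrable_w_square) auto
    finally show ?thesis using True by (simp add: h2_cut_def horizon_def)
  qed (simp add: u_def h2_cut_def horizon_def)
qed

end

text \<open>The expectation of \<open>(A - C)^2\<close> from identities between extended reals: both squares are finite, hence
so is the mixed term, and subtraction is legitimate.\<close>

lemma (in prob_space) expectation_difference_square:
  fixes A C :: "'a \<Rightarrow> ennreal" and v :: real
  assumes [measurable]: "A \<in> borel_measurable M" "C \<in> borel_measurable M"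
    and A: "(\<integral>\<^sup>+ \<omega>. (A \<omega>)\<^sup>2 \<partial>M) < \<infinity>" and C: "(\<integral>\<^sup>+ \<omega>. (C \<omega>)\<^sup>2 \<partial>M) < \<infinity>"
    and eq: "(\<integral>\<^sup>+ \<omega>. (A \<omega>)\<^sup>2 \<partial>M) + (\<integral>\<^sup>+ \<omega>. (C \<omega>)\<^sup>2 \<partial>M) = 2 * (\<integral>\<^sup>+ \<omega>. A \<omega> * C \<omega> \<partial>M) + ennreal v"
    and v: "0 \<le> v"
  shows "integrable M (\<lambda>\<omega>. enn2real (A \<omega>))" "integrable M (\<lambda>\<omega>. enn2real (C \<omega>))"
    and "AE \<omega> in M. A \<omega> = ennreal (enn2real (A \<omega>))" "AE \<omega> in M. C \<omega> = ennreal (enn2real (C \<omega>))"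
    and "integrable M (\<lambda>\<omega>. (enn2real (A \<omega>) - enn2real (C \<omega>))\<^sup>2)"
    and "(\<integral>\<omega>. (enn2real (A \<omega>) - enn2real (C \<omega>))\<^sup>2 \<partial>M) = v"
proof -
  let ?a = "\<lambda>\<omega>. enn2real (A \<omega>)" and ?c = "\<lambda>\<omega>. enn2real (C \<omega>)"
  have fin: "AE \<omega> in M. B \<omega> = ennreal (enn2real (B \<omega>))"
    if [measurable]: "B \<in> borel_measurable M" and "(\<integral>\<^sup>+ \<omega>. (B \<omega>)\<^sup>2 \<partial>M) < \<infinity>" for B :: "'a \<Rightarrow> ennreal"
  proof -
    have "AE \<omega> in M. (B \<omega>)\<^sup>2 \<noteq> \<infinity>"
      using that by (intro nn_integral_PInf_AE) auto
    then show ?thesis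
      by eventually_elim (auto simp: power2_eq_square ennreal_enn2real_if)
  qed
  show Afin: "AE \<omega> in M. A \<omega> = ennreal (?a \<omega>)" by (rule fin) (use A in auto)
  show Cfin: "AE \<omega> in M. C \<omega> = ennreal (?c \<omega>)" by (rule fin) (use C in auto)
  have sqA: "(\<integral>\<^sup>+ \<omega>. ennreal ((?a \<omega>)\<^sup>2) \<partial>M) = (\<integral>\<^sup>+ \<omega>. (A \<omega>)\<^sup>2 \<partial>M)"
  proof (rule nn_integral_cong_AE)
    show "AE \<omega> in M. ennreal ((?a \<omega>)\<^sup>2) = (A \<omega>)\<^sup>2"
      using Afin by eventually_elim (metis ennreal_power enn2real_nonneg)
  qed
  have sqC: "(\<integral>\<^sup>+ \<omega>. ennreal ((?c \<omega>)\<^sup>2) \<partial>M) = (\<integral>\<^sup>+ \<omega>. (C \<omega>)\<^sup>2 \<partial>M)"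
  proof (rule nn_integral_cong_AE)
    show "AE \<omega> in M. ennreal ((?c \<omega>)\<^sup>2) = (C \<omega>)\<^sup>2"
      using Cfin by eventually_elim (metis ennreal_power enn2real_nonneg)
  qed
  have pAC: "(\<integral>\<^sup>+ \<omega>. ennreal (?a \<omega> * ?c \<omega>) \<partial>M) = (\<integral>\<^sup>+ \<omega>. A \<omega> * C \<omega> \<partial>M)"
  proof (rule nn_integral_cong_AE)
    show "AE \<omega> in M. ennreal (?a \<omega> * ?c \<omega>) = A \<omega> * C \<omega>"
      using Afin Cfin by eventually_elim (metis ennreal_mult enn2real_nonneg)
  qed
  have ia2: "integrable M (\<lambda>\<omega>. (?a \<omega>)\<^sup>2)" and ic2: "integrable M (\<lambda>\<omega>. (?c \<omega>)\<^sup>2)"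
    using A C sqA sqC by (auto intro!: integrableI_nonneg)
  show ia: "integrable M ?a" and ic: "integrable M ?c"
    by (rule square_integrable_imp_integrable; use ia2 ic2 in simp)+
  have iac: "integrable M (\<lambda>\<omega>. ?a \<omega> * ?c \<omega>)"
  proof (rule Bochner_Integration.integrable_bound)
    show "integrable M (\<lambda>\<omega>. (?a \<omega>)\<^sup>2 + (?c \<omega>)\<^sup>2)" using ia2 ic2 by simp
    have bound: "\<bar>x * y\<bar> \<le> x\<^sup>2 + y\<^sup>2" for x y :: real
      using sum_squares_bound[of "\<bar>x\<bar>" "\<bar>y\<bar>"] mult_nonneg_nonneg[of "\<bar>x\<bar>" "\<bar>y\<bar>"]
      unfolding abs_mult power2_abs by linarith
    have "norm (?a \<omega> * ?c \<omega>) \<le> norm ((?a \<omega>)\<^sup>2 + (?c \<omega>)\<^sup>2)" for \<omega>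
      using bound[of "?a \<omega>" "?c \<omega>"] by simp
    then show "AE \<omega> in M. norm (?a \<omega> * ?c \<omega>) \<le> norm ((?a \<omega>)\<^sup>2 + (?c \<omega>)\<^sup>2)"
      by (intro AE_I2)
  qed measurable
  have exp: "(\<lambda>\<omega>. (?a \<omega> - ?c \<omega>)\<^sup>2) = (\<lambda>\<omega>. (?a \<omega>)\<^sup>2 + (?c \<omega>)\<^sup>2 - 2 * (?a \<omega> * ?c \<omega>))"
    by (simp add: power2_eq_square algebra_simps)
  show "integrable M (\<lambda>\<omega>. (?a \<omega> - ?c \<omega>)\<^sup>2)"
    unfolding exp using ia2 ic2 iac by simp
  have "ennreal (\<integral>\<omega>. (?a \<omega>)\<^sup>2 \<partial>M) + ennreal (\<integral>\<omega>. (?c \<omega>)\<^sup>2 \<partial>M) = 2 * ennreal (\<integral>\<omega>. ?a \<omega> * ?c \<omega> \<partial>M) + ennreal v"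
    using eq unfolding sqA[symmetric] sqC[symmetric] pAC[symmetric]
    using ia2 ic2 iac by (simp add: nn_integral_eq_integral)
  then have "(\<integral>\<omega>. (?a \<omega>)\<^sup>2 \<partial>M) + (\<integral>\<omega>. (?c \<omega>)\<^sup>2 \<partial>M) = 2 * (\<integral>\<omega>. ?a \<omega> * ?c \<omega> \<partial>M) + v"
    using v by (simp add: ennreal_plus[symmetric] ennreal_mult'[symmetric] ennreal_numeral[symmetric] del: ennreal_plus ennreal_numeral)
  then show "(\<integral>\<omega>. (?a \<omega> - ?c \<omega>)\<^sup>2 \<partial>M) = v"
    unfolding exp using ia2 ic2 iac by simp
qed

context linear_hawkes_loss
begin

text \<open>\<open>jump_part - comp_part\<close> is the martingale at time \<open>T\<close>, written as a sum over the losses minus its compensator.\<close>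

definition "jump_part \<omega> = (\<integral>\<^sup>+ x. u x \<partial>\<nu> \<omega>)"
definition "comp_upto t \<omega> = (\<integral>\<^sup>+ x. u x * indicator {0..t} (fst x) \<partial>\<mu> \<omega>)"
definition "comp_rate s \<omega> = rate s \<omega> * h_cut s"

lemma measurable_h_cut [measurable]: "h_cut \<in> borel_measurable borel" "h2_cut \<in> borel_measurable borel"
  unfolding h_cut_def[abs_def] h2_cut_def[abs_def] by measurable

lemma h_cut_le: "h_cut s \<le> ennreal (mean_retained + mean_retained / \<kappa> * \<Lambda> * mark_mean) * horizon s"
  unfolding h_cut_def using h_bounds(2)[of s]
  by (auto simp: horizon_def indicator_def intro: ennreal_leI)

lemma comp_upto_eq: "AE \<omega> in Q. \<forall>t. comp_upto t \<omega> = (\<integral>\<^sup>+ s. comp_rate s \<omega> * indicator {..t} s \<partial>leb)"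
  using nn_integral_compensator
proof eventually_elim
  case (elim \<omega>)
  have "comp_upto t \<omega> = (\<integral>\<^sup>+ s. comp_rate s \<omega> * indicator {..t} s \<partial>leb)" for t
  proof -
    have [measurable]: "(\<lambda>x. indicator {0..t} (fst x) :: ennreal) \<in> borel_measurable (Rplus \<Otimes>\<^sub>M (Rplus :: real measure))"
      by (rule measurable_compose[OF measurable_fst_Rplus]) simp
    have "(\<lambda>x. u x * indicator {0..t} (fst x)) \<in> borel_measurable (Rplus \<Otimes>\<^sub>M Rplus)" by measurable
    then have "comp_upto t \<omega> = (\<integral>\<^sup>+ s. rate s \<omega> * (\<integral>\<^sup>+ z. u (s, z) * indicator {0..t} (fst (s, z)) \<partial>\<Theta>) \<partial>leb)"
      unfolding comp_upto_def using elim by blast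
    also have "\<dots> = (\<integral>\<^sup>+ s. comp_rate s \<omega> * indicator {..t} s \<partial>leb)"
      by (intro nn_integral_cong) (auto simp: comp_rate_def integral_u indicator_def)
    finally show ?thesis .
  qed
  then show ?case by blast
qed

text \<open>The definition of a compensator requires its integral processes to be predictable, and
\<open>comp_upto\<close> is one of them.\<close>

lemma predictable_comp_upto: "(\<lambda>(\<omega>, t). comp_upto t \<omega>) \<in> borel_measurable Pred"
proof -
  have "(\<lambda>x. u (snd (fst x), snd x)) \<in> borel_measurable (Pred \<Otimes>\<^sub>M (Rplus :: real measure))"
    by (rule measurable_det_predictable_pair) measurable
  from compensator[unfolded compensator_def, THEN spec, THEN mp, OF this, THEN conjunct1]
  show ?thesis by (simp add: comp_upto_def split_beta')
qed

lemma measurable_Pred_time [measurable (raw)]: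
  "f \<in> borel_measurable borel \<Longrightarrow> (\<lambda>x. f (snd x)) \<in> measurable Pred borel"
  by (rule measurable_compose[OF measurable_time_predictable'])

lemma predictable_comp_rate: "(\<lambda>(\<omega>, s). comp_rate s \<omega>) \<in> borel_measurable Pred"
proof -
  have [measurable]: "(\<lambda>x. rate (snd x) (fst x)) \<in> borel_measurable Pred"
    using measurable_rate by (simp add: split_beta')
  have [measurable]: "(\<lambda>x. h_cut (snd x)) \<in> borel_measurable Pred"
    by (rule measurable_Pred_time) measurable
  show ?thesis unfolding comp_rate_def split_beta' by measurable
qed

lemma predictable_past_sum_u: "(\<lambda>(\<omega>, s). past_sum u s \<omega>) \<in> borel_measurable Pred"
  by (rule predictable_past_sum) measurable

definition "comp_part \<omega> = (\<integral>\<^sup>+ s. comp_rate s \<omega> \<partial>leb)"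

lemma measurable_comp_part [measurable]: "comp_part \<in> borel_measurable Q"
  unfolding comp_part_def by (rule predictable_swap(4)[OF predictable_comp_rate])

text \<open>Past sums omit their own time, and \<open>u\<close> vanishes after \<open>T\<close>; time \<open>T + 1\<close> includes a loss at \<open>T\<close>.\<close>

lemma jump_part_eq_past_sum: "\<omega> \<in> space Q \<Longrightarrow> jump_part \<omega> = past_sum u (T + 1) \<omega>"
  unfolding jump_part_def past_sum_def by (intro nn_integral_cong) (auto simp: u_def horizon_def indicator_def)

lemma measurable_jump_part [measurable]: "jump_part \<in> borel_measurable Q"
proof -
  have "past_sum u (T + 1) \<in> borel_measurable Q"
    using T_pos by (intro measurable_omega_predictable[OF predictable_past_sum_u]) simp
  then show ?thesis by (rule measurable_cong[THEN iffD1, rotated]) (simp add: jump_part_eq_past_sum)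
qed

text \<open>The two mixed terms arise once from each square and together from the product, which is why they cancel.
The remaining \<open>bracket\<close> is the expected predictable quadratic variation.\<close>

definition "jump_cross = (\<integral>\<^sup>+ \<omega>. \<integral>\<^sup>+ s. past_sum u s \<omega> * comp_rate s \<omega> \<partial>leb \<partial>Q)"
definition "comp_cross = (\<integral>\<^sup>+ \<omega>. \<integral>\<^sup>+ s. comp_upto s \<omega> * comp_rate s \<omega> \<partial>leb \<partial>Q)"
definition "bracket = (\<integral>\<^sup>+ \<omega>. \<integral>\<^sup>+ s. rate s \<omega> * h2_cut s \<partial>leb \<partial>Q)"

lemma measurable_u_Pred: "(\<lambda>x. u (snd (fst x), snd x)) \<in> borel_measurable (Pred \<Otimes>\<^sub>M (Rplus :: real measure))"
  by (rule measurable_det_predictable_pair) measurable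

lemma jump_part_square: "(\<integral>\<^sup>+ \<omega>. (jump_part \<omega>)\<^sup>2 \<partial>Q) = 2 * jump_cross + bracket"
proof -
  note [measurable] = measurable_u_Pred measurable_predictable_fst_pair[OF predictable_past_sum_u]
  have "(\<integral>\<^sup>+ \<omega>. (jump_part \<omega>)\<^sup>2 \<partial>Q) = (\<integral>\<^sup>+ \<omega>. (\<integral>\<^sup>+ x. 2 * past_sum u (fst x) \<omega> * u x + (u x)\<^sup>2 \<partial>\<nu> \<omega>) \<partial>Q)"
    unfolding jump_part_def by (intro nn_integral_cong nn_integral_counting_square) measurable
  also have "\<dots> = (\<integral>\<^sup>+ \<omega>. (\<integral>\<^sup>+ s. rate s \<omega> * (\<integral>\<^sup>+ z. 2 * past_sum u (fst (s, z)) \<omega> * u (s, z) + (u (s, z))\<^sup>2 \<partial>\<Theta>) \<partial>leb) \<partial>Q)"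
  proof (rule compensation_formula)
    show "(\<lambda>((\<omega>, s), z). 2 * past_sum u (fst (s, z)) \<omega> * u (s, z) + (u (s, z))\<^sup>2) \<in> borel_measurable (Pred \<Otimes>\<^sub>M Rplus)"
      unfolding split_beta' fst_conv by measurable
  qed
  also have "\<dots> = (\<integral>\<^sup>+ \<omega>. (\<integral>\<^sup>+ s. 2 * (past_sum u s \<omega> * comp_rate s \<omega>) + rate s \<omega> * h2_cut s \<partial>leb) \<partial>Q)"
  proof (intro nn_integral_cong)
    fix \<omega> s assume "s \<in> space leb"
    then have s: "0 \<le> s" by simp
    note [measurable] = measurable_u_section[OF s]
    have "(\<integral>\<^sup>+ z. 2 * past_sum u (fst (s, z)) \<omega> * u (s, z) + (u (s, z))\<^sup>2 \<partial>\<Theta>) = 2 * past_sum u s \<omega> * h_cut s + h2_cut s"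
      by (simp add: nn_integral_add nn_integral_cmult integral_u[OF s])
    then show "rate s \<omega> * (\<integral>\<^sup>+ z. 2 * past_sum u (fst (s, z)) \<omega> * u (s, z) + (u (s, z))\<^sup>2 \<partial>\<Theta>) =
        2 * (past_sum u s \<omega> * comp_rate s \<omega>) + rate s \<omega> * h2_cut s"
      by (simp add: comp_rate_def algebra_simps)
  qed
  also have "\<dots> = 2 * jump_cross + bracket"
  proof -
    have p1: "(\<lambda>(\<omega>, s). 2 * (past_sum u s \<omega> * comp_rate s \<omega>)) \<in> borel_measurable Pred"
      using predictable_past_sum_u predictable_comp_rate unfolding split_beta' by measurable
    have p1': "(\<lambda>(\<omega>, s). past_sum u s \<omega> * comp_rate s \<omega>) \<in> borel_measurable Pred"
      using predictable_past_sum_u predictable_comp_rate unfolding split_beta' by measurable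
    have [measurable]: "(\<lambda>x. h2_cut (snd x)) \<in> borel_measurable Pred"
      by (rule measurable_Pred_time) measurable
    have p2: "(\<lambda>(\<omega>, s). rate s \<omega> * h2_cut s) \<in> borel_measurable Pred"
      using measurable_rate unfolding split_beta' by measurable
    have "(\<integral>\<^sup>+ \<omega>. (\<integral>\<^sup>+ s. 2 * (past_sum u s \<omega> * comp_rate s \<omega>) + rate s \<omega> * h2_cut s \<partial>leb) \<partial>Q) =
       (\<integral>\<^sup>+ \<omega>. 2 * (\<integral>\<^sup>+ s. past_sum u s \<omega> * comp_rate s \<omega> \<partial>leb) + (\<integral>\<^sup>+ s. rate s \<omega> * h2_cut s \<partial>leb) \<partial>Q)"
      using predictable_swap(3)[OF p1] predictable_swap(3)[OF p2] predictable_swap(3)[OF p1']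
      by (intro nn_integral_cong) (simp add: nn_integral_add nn_integral_cmult)
    also have "\<dots> = 2 * jump_cross + bracket"
      unfolding jump_cross_def bracket_def
      using predictable_swap(4)[OF p1'] predictable_swap(4)[OF p2]
      by (simp add: nn_integral_add nn_integral_cmult)
    finally show ?thesis .
  qed
  finally show ?thesis .
qed

lemma jump_comp_product: "(\<integral>\<^sup>+ \<omega>. jump_part \<omega> * comp_part \<omega> \<partial>Q) = comp_cross + jump_cross"
proof -
  note [measurable] = measurable_u_Pred measurable_predictable_fst_pair[OF predictable_comp_upto]
  have W: "(\<lambda>((\<omega>, s), z). comp_upto (fst (s, z)) \<omega> * u (s, z)) \<in> borel_measurable (Pred \<Otimes>\<^sub>M Rplus)"
    unfolding split_beta' fst_conv by measurable
  have p1: "(\<lambda>(\<omega>, s). past_sum u s \<omega> * comp_rate s \<omega>) \<in> borel_measurable Pred"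
    using predictable_past_sum_u predictable_comp_rate unfolding split_beta' by measurable
  have p2: "(\<lambda>(\<omega>, s). comp_upto s \<omega> * comp_rate s \<omega>) \<in> borel_measurable Pred"
    using predictable_comp_upto predictable_comp_rate unfolding split_beta' by measurable
  have ae: "AE \<omega> in Q. jump_part \<omega> * comp_part \<omega> = (\<integral>\<^sup>+ x. comp_upto (fst x) \<omega> * u x \<partial>\<nu> \<omega>) + (\<integral>\<^sup>+ s. past_sum u s \<omega> * comp_rate s \<omega> \<partial>leb)"
    using comp_upto_eq AE_space
  proof eventually_elim
    case (elim \<omega>)
    have "jump_part \<omega> * comp_part \<omega> = (\<integral>\<^sup>+ x. (\<integral>\<^sup>+ s. comp_rate s \<omega> * indicator {..fst x} s \<partial>leb) * u x \<partial>\<nu> \<omega>) + (\<integral>\<^sup>+ s. past_sum u s \<omega> * comp_rate s \<omega> \<partial>leb)"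
      unfolding jump_part_def comp_part_def
      by (rule nn_integral_counting_product[OF elim(2)]) (auto intro: predictable_swap(3)[OF predictable_comp_rate elim(2)])
    then show ?case using elim(1) by simp
  qed
  have eqi: "(\<integral>\<^sup>+ \<omega>. (\<integral>\<^sup>+ x. comp_upto (fst x) \<omega> * u x \<partial>\<nu> \<omega>) \<partial>Q) = comp_cross"
  proof -
    have "(\<integral>\<^sup>+ \<omega>. (\<integral>\<^sup>+ x. comp_upto (fst x) \<omega> * u x \<partial>\<nu> \<omega>) \<partial>Q) =
      (\<integral>\<^sup>+ \<omega>. (\<integral>\<^sup>+ s. rate s \<omega> * (\<integral>\<^sup>+ z. comp_upto (fst (s, z)) \<omega> * u (s, z) \<partial>\<Theta>) \<partial>leb) \<partial>Q)"
      by (rule compensation_formula[OF W])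
    also have "\<dots> = comp_cross"
      unfolding comp_cross_def
    proof (intro nn_integral_cong)
      fix \<omega> s assume "s \<in> space leb"
      then have s: "0 \<le> s" by simp
      note [measurable] = measurable_u_section[OF s]
      have "(\<integral>\<^sup>+ z. comp_upto (fst (s, z)) \<omega> * u (s, z) \<partial>\<Theta>) = comp_upto s \<omega> * h_cut s"
        by (simp add: nn_integral_cmult integral_u[OF s])
      then show "rate s \<omega> * (\<integral>\<^sup>+ z. comp_upto (fst (s, z)) \<omega> * u (s, z) \<partial>\<Theta>) = comp_upto s \<omega> * comp_rate s \<omega>"
        by (simp add: comp_rate_def ac_simps)
    qed
    finally show ?thesis .
  qed
  have mN: "(\<lambda>\<omega>. \<integral>\<^sup>+ x. comp_upto (fst x) \<omega> * u x \<partial>\<nu> \<omega>) \<in> borel_measurable Q"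
    by (rule measurable_counting_integral[OF predictable_comp_upto measurable_u])
  have "(\<integral>\<^sup>+ \<omega>. jump_part \<omega> * comp_part \<omega> \<partial>Q) = (\<integral>\<^sup>+ \<omega>. (\<integral>\<^sup>+ x. comp_upto (fst x) \<omega> * u x \<partial>\<nu> \<omega>) + (\<integral>\<^sup>+ s. past_sum u s \<omega> * comp_rate s \<omega> \<partial>leb) \<partial>Q)"
    by (rule nn_integral_cong_AE[OF ae])
  also have "\<dots> = comp_cross + jump_cross"
    unfolding jump_cross_def eqi[symmetric]
    by (rule nn_integral_add[OF mN predictable_swap(4)[OF p1]])
  finally show ?thesis .
qed

lemma comp_part_square: "(\<integral>\<^sup>+ \<omega>. (comp_part \<omega>)\<^sup>2 \<partial>Q) = 2 * comp_cross"
proof -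
  have p2: "(\<lambda>(\<omega>, s). comp_upto s \<omega> * comp_rate s \<omega>) \<in> borel_measurable Pred"
    using predictable_comp_upto predictable_comp_rate unfolding split_beta' by measurable
  have "(\<integral>\<^sup>+ \<omega>. (comp_part \<omega>)\<^sup>2 \<partial>Q) = (\<integral>\<^sup>+ \<omega>. 2 * (\<integral>\<^sup>+ s. comp_upto s \<omega> * comp_rate s \<omega> \<partial>leb) \<partial>Q)"
  proof (rule nn_integral_cong_AE)
    show "AE \<omega> in Q. (comp_part \<omega>)\<^sup>2 = 2 * (\<integral>\<^sup>+ s. comp_upto s \<omega> * comp_rate s \<omega> \<partial>leb)"
      using comp_upto_eq AE_space
    proof eventually_elim
      case (elim \<omega>)
      have "(comp_part \<omega>)\<^sup>2 = 2 * (\<integral>\<^sup>+ s. comp_rate s \<omega> * (\<integral>\<^sup>+ r. comp_rate r \<omega> * indicator {..s} r \<partial>leb) \<partial>leb)"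
        unfolding comp_part_def by (rule nn_integral_leb_square[OF predictable_swap(3)[OF predictable_comp_rate elim(2)]])
      then show ?case using elim(1) by (simp add: mult.commute)
    qed
  qed
  also have "\<dots> = 2 * comp_cross"
    unfolding comp_cross_def by (rule nn_integral_cmult[OF predictable_swap(4)[OF p2]])
  finally show ?thesis .
qed

lemma jump_part_expectation: "(\<integral>\<^sup>+ \<omega>. jump_part \<omega> \<partial>Q) = (\<integral>\<^sup>+ \<omega>. comp_part \<omega> \<partial>Q)"
proof -
  have "(\<integral>\<^sup>+ \<omega>. jump_part \<omega> \<partial>Q) = (\<integral>\<^sup>+ \<omega>. (\<integral>\<^sup>+ s. rate s \<omega> * (\<integral>\<^sup>+ z. u (s, z) \<partial>\<Theta>) \<partial>leb) \<partial>Q)"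
    unfolding jump_part_def using measurable_u_Pred by (intro compensation_formula) (simp add: split_beta')
  also have "\<dots> = (\<integral>\<^sup>+ \<omega>. comp_part \<omega> \<partial>Q)"
    unfolding comp_part_def comp_rate_def by (intro nn_integral_cong) (simp add: integral_u)
  finally show ?thesis .
qed

lemma jump_part_square_finite: "(\<integral>\<^sup>+ \<omega>. (jump_part \<omega>)\<^sup>2 \<partial>Q) < \<infinity>"
proof -
  let ?K = "ennreal (1 + mean_retained / \<kappa> * \<Lambda>)"
  have [measurable]: "past_claims (T + 1) \<in> borel_measurable Q"
    using T_pos by (intro measurable_omega_predictable[OF predictable_past_claims]) simp
  have "jump_part \<omega> \<le> ?K * past_claims (T + 1) \<omega>" if "\<omega> \<in> space Q" for \<omega>
  proof -
    have "jump_part \<omega> = past_sum u (T + 1) \<omega>" by (rule jump_part_eq_past_sum[OF that])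
    also have "\<dots> \<le> past_sum (\<lambda>x. ?K * ennreal (snd x)) (T + 1) \<omega>"
    proof (rule past_sum_mono_fun)
      fix r z :: real assume r: "0 \<le> r" "r < T + 1" "0 \<le> z"
      have p: "0 \<le> 1 + mean_retained / \<kappa> * \<Lambda>" using mean_retained_nonneg \<kappa>_pos \<Lambda>_pos by simp
      show "u (r, z) \<le> ?K * ennreal (snd (r, z))"
        using w_bounds(2)[of r z] r p
        by (auto simp: u_def horizon_def indicator_def ennreal_mult[symmetric] intro!: ennreal_leI)
    qed
    also have "\<dots> = ?K * past_claims (T + 1) \<omega>" unfolding past_claims_def by (rule past_sum_cmult) measurable
    finally show ?thesis .
  qed
  then have "(\<integral>\<^sup>+ \<omega>. (jump_part \<omega>)\<^sup>2 \<partial>Q) \<le> (\<integral>\<^sup>+ \<omega>. (?K * past_claims (T + 1) \<omega>)\<^sup>2 \<partial>Q)"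
    by (intro nn_integral_mono power_mono) auto
  also have "\<dots> = ?K\<^sup>2 * (\<integral>\<^sup>+ \<omega>. (past_claims (T + 1) \<omega>)\<^sup>2 \<partial>Q)"
    unfolding power_mult_distrib by (rule nn_integral_cmult) measurable
  also have "\<dots> < \<infinity>"
    using past_claims_second_moment[of "T + 1"] T_pos by (simp add: ennreal_mult_less_top power2_eq_square)
  finally show ?thesis .
qed

lemma comp_part_square_finite: "(\<integral>\<^sup>+ \<omega>. (comp_part \<omega>)\<^sup>2 \<partial>Q) < \<infinity>"
proof -
  let ?H = "ennreal (mean_retained + mean_retained / \<kappa> * \<Lambda> * mark_mean)"
  let ?K = "ennreal (lam0 + \<Lambda>) * ?H * ennreal T"
  have l0: "0 \<le> lam0" using base_less base_nonneg by simp
  have [measurable]: "past_claims T \<in> borel_measurable Q"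
    using T_pos by (intro measurable_omega_predictable[OF predictable_past_claims]) simp
  have "comp_part \<omega> \<le> ?K * (1 + past_claims T \<omega>)" for \<omega>
  proof -
    have "comp_part \<omega> \<le> (\<integral>\<^sup>+ s. (ennreal (lam0 + \<Lambda>) * (1 + past_claims T \<omega>) * ?H) * indicator {0..T} s \<partial>lborel)"
      unfolding comp_part_def
    proof (subst nn_integral_restrict_space; (rule nn_integral_mono)?)
      fix s :: real
      show "comp_rate s \<omega> * indicator {0..} s \<le> (ennreal (lam0 + \<Lambda>) * (1 + past_claims T \<omega>) * ?H) * indicator {0..T} s"
      proof (cases "s \<in> {0..T}")
        case True
        have "rate s \<omega> \<le> ennreal lam0 + ennreal \<Lambda> * past_claims s \<omega>" using True by (intro rate_le) simp
        also have "\<dots> \<le> ennreal lam0 + ennreal \<Lambda> * past_claims T \<omega>"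
          using True by (intro add_mono mult_left_mono past_claims_mono) auto
        also have "\<dots> \<le> ennreal (lam0 + \<Lambda>) * (1 + past_claims T \<omega>)"
          using l0 \<Lambda>_pos by (simp add: algebra_simps add_increasing2)
        finally have "rate s \<omega> * h_cut s \<le> ennreal (lam0 + \<Lambda>) * (1 + past_claims T \<omega>) * (?H * horizon s)"
          by (rule mult_mono[OF _ h_cut_le]) auto
        then show ?thesis using True by (simp add: comp_rate_def horizon_def)
      next
        case False
        then show ?thesis using h_cut_le[of s]
          by (auto simp: comp_rate_def horizon_def indicator_def h_cut_def)
      qed
    qed simp
    also have "\<dots> = (ennreal (lam0 + \<Lambda>) * (1 + past_claims T \<omega>) * ?H) * ennreal T"
      using T_pos by (subst nn_integral_cmult_indicator) auto
    finally show ?thesis by (simp add: ac_simps)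
  qed
  then have "(\<integral>\<^sup>+ \<omega>. (comp_part \<omega>)\<^sup>2 \<partial>Q) \<le> (\<integral>\<^sup>+ \<omega>. (?K * (1 + past_claims T \<omega>))\<^sup>2 \<partial>Q)"
    by (intro nn_integral_mono power_mono) auto
  also have "\<dots> \<le> (\<integral>\<^sup>+ \<omega>. ?K\<^sup>2 * (2 * (1 + (past_claims T \<omega>)\<^sup>2)) \<partial>Q)"
    unfolding power_mult_distrib by (intro nn_integral_mono mult_left_mono one_plus_square_le) auto
  also have "\<dots> = ?K\<^sup>2 * (2 * (1 + (\<integral>\<^sup>+ \<omega>. (past_claims T \<omega>)\<^sup>2 \<partial>Q)))"
    by (simp add: nn_integral_cmult nn_integral_add emeasure_space_1)
  also have "\<dots> < \<infinity>"
    using past_claims_second_moment[of T] T_pos by (simp add: ennreal_mult_less_top power2_eq_square)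
  finally show ?thesis .
qed

text \<open>The jump part exceeds the retained total by \<open>feedback\<close>, and the compensator exceeds a constant by the same
amount. So the martingale is the retained total minus a constant.\<close>

definition "retained_sum \<omega> = (\<integral>\<^sup>+ x. ennreal (g (snd x)) * horizon (fst x) \<partial>\<nu> \<omega>)"
definition "feedback \<omega> = (\<integral>\<^sup>+ x. ennreal (mean_retained * k (fst x) * (\<Lambda> * snd x)) * horizon (fst x) \<partial>\<nu> \<omega>)"
definition "base_comp = (\<integral>\<^sup>+ s. ennreal (baseline s) * h_cut s \<partial>leb)"

lemma jump_part_decomposition: "jump_part \<omega> = retained_sum \<omega> + feedback \<omega>"
proof -
  have "jump_part \<omega> = (\<integral>\<^sup>+ x. ennreal (g (snd x)) * horizon (fst x) + ennreal (mean_retained * k (fst x) * (\<Lambda> * snd x)) * horizon (fst x) \<partial>\<nu> \<omega>)"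
    unfolding jump_part_def
  proof (rule nn_integral_cong)
    fix x assume "x \<in> space (\<nu> \<omega>)"
    then have x: "0 \<le> fst x" "0 \<le> snd x" by auto
    show "u x = ennreal (g (snd x)) * horizon (fst x) + ennreal (mean_retained * k (fst x) * (\<Lambda> * snd x)) * horizon (fst x)"
    proof (cases "fst x \<le> T")
      case True
      then show ?thesis
        using g_nonneg[OF x(2)] mean_retained_nonneg k_bounds(1)[OF True] \<Lambda>_pos x
        by (simp add: u_def w_def horizon_def ennreal_plus)
    qed (simp add: u_def horizon_def)
  qed
  also have "\<dots> = retained_sum \<omega> + feedback \<omega>"
    unfolding retained_sum_def feedback_def by (rule nn_integral_add) measurable
  finally show ?thesis .
qed

text \<open>The choice of \<open>k\<close> enters here: \<open>- e^{-\<beta> s} H[g] k(s)\<close> is a primitive of \<open>e^{-\<beta> s} h(s)\<close> because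
\<open>k' = \<kappa> k - 1\<close> and \<open>\<beta> - \<kappa> = H[f]\<close>, and \<open>k(T) = 0\<close>.\<close>

lemma kernel_tail_integral:
  assumes r: "0 \<le> r"
  shows "(\<integral>\<^sup>+ s. ennreal (exp (- \<beta> * s)) * h_cut s * indicator {r<..} s \<partial>leb) =
    ennreal (exp (- \<beta> * r) * (mean_retained * k r)) * horizon r"
proof (cases "r \<le> T")
  case True
  have "(\<integral>\<^sup>+ s. ennreal (exp (- \<beta> * s)) * h_cut s * indicator {r<..} s \<partial>leb) =
     (\<integral>\<^sup>+ s. ennreal (exp (- \<beta> * s)) * h_cut s * indicator {r<..} s * indicator {0..} s \<partial>lborel)"
    by (rule nn_integral_restrict_space) simp
  also have "\<dots> = (\<integral>\<^sup>+ s. ennreal (exp (- \<beta> * s) * h s) * indicator {r..T} s \<partial>lborel)"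
  proof (rule nn_integral_cong_AE)
    have "AE s in lborel. s \<noteq> r" by (rule AE_lborel_singleton)
    then show "AE s in lborel. ennreal (exp (- \<beta> * s)) * h_cut s * indicator {r<..} s * indicator {0..} s =
       ennreal (exp (- \<beta> * s) * h s) * indicator {r..T} s"
    proof eventually_elim
      case (elim s)
      then show ?case using r h_bounds(1)[of s]
        by (auto simp: h_cut_def horizon_def indicator_def ennreal_mult)
    qed
  qed
  also have "\<dots> = ennreal (- (exp (- \<beta> * T) * (mean_retained * k T)) - - (exp (- \<beta> * r) * (mean_retained * k r)))"
  proof (rule nn_integral_FTC_Icc[OF _ _ _ True])
    show "(\<lambda>s. exp (- \<beta> * s) * h s) \<in> borel_measurable borel" by measurable
    fix s assume s: "s \<in> {r..T}"
    then show "0 \<le> exp (- \<beta> * s) * h s" using h_bounds(1)[of s] by simp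
    have "((\<lambda>s. - (exp (- \<beta> * s) * (mean_retained * k s))) has_real_derivative
        exp (- \<beta> * s) * (\<beta> * (mean_retained * k s) + mean_retained * exp (- \<kappa> * (T - s)))) (at s)"
    proof -
      have "(k has_real_derivative - exp (- \<kappa> * (T - s))) (at s)"
        unfolding k_def[abs_def] using \<kappa>_pos by (auto intro!: derivative_eq_intros simp: field_simps)
      then show ?thesis by (auto intro!: derivative_eq_intros simp: algebra_simps)
    qed
    also have "\<beta> * (mean_retained * k s) + mean_retained * exp (- \<kappa> * (T - s)) = h s"
    proof -
      have e: "exp (- \<kappa> * (T - s)) = 1 - \<kappa> * k s" using \<kappa>_pos by (simp add: k_def)
      show ?thesis unfolding e by (simp add: h_def \<kappa>_def algebra_simps)
    qed
    finally show "((\<lambda>s. - (exp (- \<beta> * s) * (mean_retained * k s))) has_real_derivative exp (- \<beta> * s) * h s) (at s)" .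
  qed
  also have "- (exp (- \<beta> * T) * (mean_retained * k T)) - - (exp (- \<beta> * r) * (mean_retained * k r)) = exp (- \<beta> * r) * (mean_retained * k r)"
    by (simp add: k_def)
  finally show ?thesis using True by (simp add: horizon_def)
next
  case False
  then have "ennreal (exp (- \<beta> * s)) * h_cut s * indicator {r<..} s = 0" for s
    by (auto simp: h_cut_def horizon_def indicator_def)
  then have "(\<integral>\<^sup>+ s. ennreal (exp (- \<beta> * s)) * h_cut s * indicator {r<..} s \<partial>leb) = (\<integral>\<^sup>+ s. 0 \<partial>leb)"
    by (intro nn_integral_cong) (simp only:)
  then show ?thesis using False by (simp add: horizon_def)
qed

text \<open>Each loss raises the later intensity, and the compensator accumulates this rise up to \<open>T\<close>; by
\<open>kernel_tail_integral\<close> the accumulated amount is the feedback of that loss.\<close>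

lemma comp_part_decomposition:
  assumes \<omega>: "\<omega> \<in> space Q"
  shows "comp_part \<omega> = base_comp + feedback \<omega>"
proof -
  let ?w = "\<lambda>s. ennreal (exp (- \<beta> * s)) * h_cut s"
  have [measurable]: "?w \<in> borel_measurable leb" "(\<lambda>s. ennreal (baseline s) * h_cut s) \<in> borel_measurable leb"
    "(\<lambda>s. past_sum kernel_mark s \<omega>) \<in> borel_measurable leb"
    using measurable_past_sum_time[OF \<omega> measurable_kernel_mark] by (auto intro!: measurable_restrict_space1)
  have "comp_part \<omega> = (\<integral>\<^sup>+ s. ennreal (baseline s) * h_cut s + past_sum kernel_mark s \<omega> * ?w s \<partial>leb)"
    unfolding comp_part_def comp_rate_def rate_def by (intro nn_integral_cong) (simp add: algebra_simps)
  also have "\<dots> = base_comp + (\<integral>\<^sup>+ s. past_sum kernel_mark s \<omega> * ?w s \<partial>leb)"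
    unfolding base_comp_def by (rule nn_integral_add) measurable
  also have "(\<integral>\<^sup>+ s. past_sum kernel_mark s \<omega> * ?w s \<partial>leb) =
      (\<integral>\<^sup>+ x. kernel_mark x * (\<integral>\<^sup>+ s. ?w s * indicator {fst x<..} s \<partial>leb) \<partial>\<nu> \<omega>)"
    by (rule nn_integral_past_sum[OF \<omega>]) measurable
  also have "\<dots> = feedback \<omega>"
    unfolding feedback_def
  proof (rule nn_integral_cong)
    fix x assume "x \<in> space (\<nu> \<omega>)"
    then have x: "0 \<le> fst x" "0 \<le> snd x" by auto
    have "exp (\<beta> * fst x) * exp (- \<beta> * fst x) = 1" by (simp add: exp_add[symmetric])
    moreover have "e * \<Lambda> * snd x * (e' * (mean_retained * k (fst x))) = (e * e') * (mean_retained * k (fst x) * (\<Lambda> * snd x))" for e e'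
      by (simp add: ac_simps)
    ultimately have "exp (\<beta> * fst x) * \<Lambda> * snd x * (exp (- \<beta> * fst x) * (mean_retained * k (fst x))) = mean_retained * k (fst x) * (\<Lambda> * snd x)"
      by (simp only: mult_1)
    then have "ennreal (exp (\<beta> * fst x) * \<Lambda> * snd x) * ennreal (exp (- \<beta> * fst x) * (mean_retained * k (fst x)))
       = ennreal (mean_retained * k (fst x) * (\<Lambda> * snd x))"
      using \<Lambda>_pos x by (subst ennreal_mult'[symmetric]) (simp_all only: mult_nonneg_nonneg exp_ge_zero less_imp_le)
    then show "kernel_mark x * (\<integral>\<^sup>+ s. ?w s * indicator {fst x<..} s \<partial>leb) =
        ennreal (mean_retained * k (fst x) * (\<Lambda> * snd x)) * horizon (fst x)"
      unfolding kernel_tail_integral[OF x(1)] kernel_mark_def by (simp add: mult.assoc[symmetric])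
  qed
  finally show ?thesis .
qed

lemma h2_bounded: "0 \<le> s \<Longrightarrow> s \<le> T \<Longrightarrow> \<bar>h2 s\<bar> \<le> (\<integral>z. ((1 + mean_retained / \<kappa> * \<Lambda>) * z)\<^sup>2 \<partial>\<Theta>)"
proof -
  assume s: "0 \<le> s" "s \<le> T"
  have "h2 s \<le> (\<integral>z. ((1 + mean_retained / \<kappa> * \<Lambda>) * z)\<^sup>2 \<partial>\<Theta>)"
    unfolding h2_def
  proof (rule integral_mono_AE)
    show "integrable \<Theta> (\<lambda>z. (w s z)\<^sup>2)" by (rule integrable_w_square)
    show "integrable \<Theta> (\<lambda>z. ((1 + mean_retained / \<kappa> * \<Lambda>) * z)\<^sup>2)" unfolding power_mult_distrib by simp
    show "AE z in \<Theta>. (w s z)\<^sup>2 \<le> ((1 + mean_retained / \<kappa> * \<Lambda>) * z)\<^sup>2"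
      using w_bounds[OF s(2)] by (intro AE_I2 power_mono) (auto simp: space_\<Theta>)
  qed
  then show ?thesis using h_bounds(3)[OF s(2)] by simp
qed

lemma bracket_eq: "bracket = ennreal (LINT s:{0..T}|lborel. mean_intensity Q lam s * h2 s)"
proof -
  have [measurable]: "(\<lambda>x. h2_cut (snd x)) \<in> borel_measurable Pred"
    by (rule measurable_Pred_time) measurable
  have p2: "(\<lambda>(\<omega>, s). rate s \<omega> * h2_cut s) \<in> borel_measurable Pred"
    using measurable_rate unfolding split_beta' by measurable
  have "bracket = (\<integral>\<^sup>+ s. \<integral>\<^sup>+ \<omega>. rate s \<omega> * h2_cut s \<partial>Q \<partial>leb)"
    unfolding bracket_def by (rule predictable_swap(1)[OF p2])
  also have "\<dots> = (\<integral>\<^sup>+ s. mean s * (ennreal (h2 s) * horizon s) \<partial>leb)"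
  proof (rule nn_integral_cong)
    fix s assume "s \<in> space leb"
    then have [measurable]: "rate s \<in> borel_measurable Q" by (intro measurable_rate_at) simp
    show "(\<integral>\<^sup>+ \<omega>. rate s \<omega> * h2_cut s \<partial>Q) = mean s * (ennreal (h2 s) * horizon s)"
      by (simp add: nn_integral_multc mean_def h2_cut_def)
  qed
  also have "\<dots> = ennreal (LINT s:{0..T}|lborel. mean_intensity Q lam s * h2 s)"
    by (rule mean_integral(2)[OF _ h2_bounded]) (auto simp: h_bounds(3))
  finally show ?thesis .
qed

lemma expectation_retained_sum: "(\<integral>\<^sup>+ \<omega>. retained_sum \<omega> \<partial>Q) = ennreal (mean_retained * cumulative_intensity Q lam T)"
proof -
  have "(\<lambda>x. ennreal (g (snd x)) * horizon (fst x)) \<in> borel_measurable (Rplus \<Otimes>\<^sub>M Rplus)" by measurable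
  from measurable_det_predictable_pair[OF this]
  have W: "(\<lambda>((\<omega>, s), z). ennreal (g (snd (s, z))) * horizon (fst (s, z))) \<in> borel_measurable (Pred \<Otimes>\<^sub>M Rplus)"
    by (simp add: split_beta')
  have p: "(\<lambda>(\<omega>, s). rate s \<omega> * (ennreal mean_retained * horizon s)) \<in> borel_measurable Pred"
  proof -
    have [measurable]: "(\<lambda>x. horizon (snd x)) \<in> borel_measurable Pred"
      by (rule measurable_Pred_time) measurable
    show ?thesis using measurable_rate unfolding split_beta' by measurable
  qed
  have "(\<integral>\<^sup>+ \<omega>. retained_sum \<omega> \<partial>Q) = (\<integral>\<^sup>+ \<omega>. (\<integral>\<^sup>+ s. rate s \<omega> * (\<integral>\<^sup>+ z. ennreal (g (snd (s, z))) * horizon (fst (s, z)) \<partial>\<Theta>) \<partial>leb) \<partial>Q)"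
    unfolding retained_sum_def by (rule compensation_formula[OF W])
  also have "\<dots> = (\<integral>\<^sup>+ \<omega>. (\<integral>\<^sup>+ s. rate s \<omega> * (ennreal mean_retained * horizon s) \<partial>leb) \<partial>Q)"
  proof (intro nn_integral_cong)
    fix \<omega> s
    have "(\<integral>\<^sup>+ z. ennreal (g z) \<partial>\<Theta>) = ennreal mean_retained"
      unfolding mean_retained_def using integrable_g
      by (intro nn_integral_eq_integral AE_I2) (auto simp: space_\<Theta> g_nonneg)
    then show "rate s \<omega> * (\<integral>\<^sup>+ z. ennreal (g (snd (s, z))) * horizon (fst (s, z)) \<partial>\<Theta>) = rate s \<omega> * (ennreal mean_retained * horizon s)"
      by (simp add: nn_integral_multc)
  qed
  also have "\<dots> = (\<integral>\<^sup>+ s. \<integral>\<^sup>+ \<omega>. rate s \<omega> * (ennreal mean_retained * horizon s) \<partial>Q \<partial>leb)"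
    by (rule predictable_swap(1)[OF p])
  also have "\<dots> = (\<integral>\<^sup>+ s. mean s * (ennreal mean_retained * horizon s) \<partial>leb)"
  proof (rule nn_integral_cong)
    fix s assume "s \<in> space leb"
    then have [measurable]: "rate s \<in> borel_measurable Q" by (intro measurable_rate_at) simp
    show "(\<integral>\<^sup>+ \<omega>. rate s \<omega> * (ennreal mean_retained * horizon s) \<partial>Q) = mean s * (ennreal mean_retained * horizon s)"
      by (simp add: nn_integral_multc mean_def)
  qed
  also have "\<dots> = ennreal (LINT s:{0..T}|lborel. mean_intensity Q lam s * mean_retained)"
    by (rule mean_integral(2)[of "\<lambda>_. mean_retained" mean_retained]) (auto simp: mean_retained_nonneg)
  also have "(LINT s:{0..T}|lborel. mean_intensity Q lam s * mean_retained) = mean_retained * cumulative_intensity Q lam T"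
    unfolding cumulative_intensity_def by (simp add: mult.commute)
  finally show ?thesis .
qed

definition "loss \<omega> = (LINT x:{0<..T} \<times> {0..}|\<nu> \<omega>. g (snd x))"

lemma loss_eq:
  assumes \<omega>: "\<omega> \<in> space Q" shows "loss \<omega> = enn2real (retained_sum \<omega>)"
proof -
  have S: "{0<..T} \<times> {0..} \<in> sets (\<nu> \<omega>)"
    unfolding sets_counting by (intro pair_measureI) (auto simp: sets_restrict_space_iff)
  have [measurable]: "(\<lambda>x. g (snd x)) \<in> borel_measurable (\<nu> \<omega>)"
    by (subst measurable_cong_sets[OF sets_counting refl]) measurable
  have "loss \<omega> = enn2real (\<integral>\<^sup>+ x. ennreal (indicator ({0<..T} \<times> {0..}) x *\<^sub>R g (snd x)) \<partial>\<nu> \<omega>)"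
    unfolding loss_def set_lebesgue_integral_def
    using S by (intro integral_eq_nn_integral) (auto simp: indicator_def g_nonneg)
  also have "(\<integral>\<^sup>+ x. ennreal (indicator ({0<..T} \<times> {0..}) x *\<^sub>R g (snd x)) \<partial>\<nu> \<omega>) = retained_sum \<omega>"
  proof -
    have m1: "(\<lambda>x. ennreal (indicator ({0<..T} \<times> {0..}) x *\<^sub>R g (snd x))) \<in> borel_measurable (Rplus \<Otimes>\<^sub>M Rplus)"
      using S unfolding sets_counting by measurable
    have "(\<integral>\<^sup>+ x. ennreal (indicator ({0<..T} \<times> {0..}) x *\<^sub>R g (snd x)) \<partial>\<nu> \<omega>) =
       (\<Sum>i. jump (\<lambda>x. ennreal (indicator ({0<..T} \<times> {0..}) x *\<^sub>R g (snd x))) i \<omega>)"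
      by (rule nn_integral_counting[OF \<omega> m1])
    also have "\<dots> = (\<Sum>i. jump (\<lambda>x. ennreal (g (snd x)) * horizon (fst x)) i \<omega>)"
    proof (rule suminf_cong)
      fix i
      show "jump (\<lambda>x. ennreal (indicator ({0<..T} \<times> {0..}) x *\<^sub>R g (snd x))) i \<omega> =
        jump (\<lambda>x. ennreal (g (snd x)) * horizon (fst x)) i \<omega>"
      proof (cases "\<tau> i \<omega> < \<infinity>")
        case True
        obtain r where "\<tau> i \<omega> = ereal r" "0 < r" using real_time[OF \<omega> True] .
        then show ?thesis using mark_nonneg[OF \<omega>, of i]
          by (auto simp: jump_def horizon_def indicator_def)
      qed (simp add: jump_def)
    qed
    also have "\<dots> = retained_sum \<omega>"
      unfolding retained_sum_def by (rule nn_integral_counting[OF \<omega>, symmetric]) measurable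
    finally show ?thesis .
  qed
  finally show ?thesis .
qed

text \<open>Both parts of the martingale have the same mean, so the retained total has mean \<open>base_comp\<close>, and its centred
value is the martingale. The mean is also computed directly from the compensation formula.\<close>

theorem loss_moments:
  shows "integrable Q loss" and "(\<integral>\<omega>. loss \<omega> \<partial>Q) = mean_retained * cumulative_intensity Q lam T"
    and "(\<integral>\<omega>. (loss \<omega> - (\<integral>\<omega>. loss \<omega> \<partial>Q))\<^sup>2 \<partial>Q) = (LINT s:{0..T}|lborel. mean_intensity Q lam s * h2 s)"
proof -
  let ?v = "LINT s:{0..T}|lborel. mean_intensity Q lam s * h2 s"
  have v0: "0 \<le> ?v"
    unfolding set_lebesgue_integral_def
    by (intro integral_nonneg_AE AE_I2) (auto simp: indicator_def mean_intensity_eq(2) h_bounds(3))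
  have id: "(\<integral>\<^sup>+ \<omega>. (jump_part \<omega>)\<^sup>2 \<partial>Q) + (\<integral>\<^sup>+ \<omega>. (comp_part \<omega>)\<^sup>2 \<partial>Q) = 2 * (\<integral>\<^sup>+ \<omega>. jump_part \<omega> * comp_part \<omega> \<partial>Q) + ennreal ?v"
    unfolding jump_part_square comp_part_square jump_comp_product bracket_eq by (simp add: algebra_simps)
  note diff = expectation_difference_square[OF measurable_jump_part measurable_comp_part jump_part_square_finite comp_part_square_finite id v0]
  let ?a = "\<lambda>\<omega>. enn2real (jump_part \<omega>)" and ?c = "\<lambda>\<omega>. enn2real (comp_part \<omega>)"
  have base_comp_finite: "base_comp < \<infinity>"
  proof -
    have "AE \<omega> in Q. base_comp < \<infinity>"
      using diff(4) AE_space
    proof eventually_elim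
      case (elim \<omega>)
      have "base_comp \<le> comp_part \<omega>" unfolding comp_part_decomposition[OF elim(2)] by simp
      also have "comp_part \<omega> < \<infinity>" by (subst elim(1)) simp
      finally show ?case .
    qed
    then show ?thesis by simp
  qed
  have ae: "AE \<omega> in Q. loss \<omega> = ?a \<omega> - ?c \<omega> + enn2real base_comp"
    using diff(3,4) AE_space
  proof eventually_elim
    case (elim \<omega>)
    have Af: "jump_part \<omega> < top" by (subst elim(1)) simp
    then have fin: "retained_sum \<omega> < top" "feedback \<omega> < top" by (auto simp: jump_part_decomposition)
    have "?a \<omega> = enn2real (retained_sum \<omega>) + enn2real (feedback \<omega>)"
      unfolding jump_part_decomposition using fin by (intro enn2real_plus) auto
    moreover have "?c \<omega> = enn2real base_comp + enn2real (feedback \<omega>)"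
      unfolding comp_part_decomposition[OF elim(3)] using fin base_comp_finite by (intro enn2real_plus) auto
    ultimately show ?case by (simp add: loss_eq[OF elim(3)])
  qed
  have m: "loss \<in> borel_measurable Q"
  proof -
    have "(\<lambda>x. ennreal (g (snd x)) * horizon (fst x)) \<in> borel_measurable (Rplus \<Otimes>\<^sub>M Rplus)" by measurable
    from measurable_counting_integral[OF _ this, of "\<lambda>_ _. 1"]
    have [measurable]: "retained_sum \<in> borel_measurable Q" by (simp add: retained_sum_def[abs_def] split_beta')
    have "(\<lambda>\<omega>. enn2real (retained_sum \<omega>)) \<in> borel_measurable Q" by measurable
    then show ?thesis by (rule measurable_cong[THEN iffD1, rotated]) (simp add: loss_eq)
  qed
  have "integrable Q (\<lambda>\<omega>. ?a \<omega> - ?c \<omega> + enn2real base_comp)" using diff(1,2) by simp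
  then show int: "integrable Q loss"
    using ae m by (subst integrable_cong_AE) auto
  have "(\<integral>\<omega>. loss \<omega> \<partial>Q) = enn2real (\<integral>\<^sup>+ \<omega>. ennreal (loss \<omega>) \<partial>Q)"
    using m by (intro integral_eq_nn_integral AE_I2) (simp_all add: loss_eq)
  also have "(\<integral>\<^sup>+ \<omega>. ennreal (loss \<omega>) \<partial>Q) = (\<integral>\<^sup>+ \<omega>. retained_sum \<omega> \<partial>Q)"
  proof (rule nn_integral_cong_AE)
    show "AE \<omega> in Q. ennreal (loss \<omega>) = retained_sum \<omega>"
      using diff(3) AE_space
    proof eventually_elim
      case (elim \<omega>)
      have "jump_part \<omega> < top" by (subst elim(1)) simp
      then have "retained_sum \<omega> < top" by (auto simp: jump_part_decomposition)
      then show ?case by (simp add: loss_eq[OF elim(2)])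
    qed
  qed
  also have "enn2real \<dots> = mean_retained * cumulative_intensity Q lam T"
    unfolding expectation_retained_sum
    by (rule enn2real_ennreal[OF mult_nonneg_nonneg[OF mean_retained_nonneg cumulative_nonneg]])
  finally show "(\<integral>\<omega>. loss \<omega> \<partial>Q) = mean_retained * cumulative_intensity Q lam T" .
  have "(\<integral>\<omega>. ?a \<omega> \<partial>Q) = (\<integral>\<omega>. ?c \<omega> \<partial>Q)"
  proof -
    have "(\<integral>\<^sup>+ \<omega>. ennreal (?a \<omega>) \<partial>Q) = (\<integral>\<^sup>+ \<omega>. jump_part \<omega> \<partial>Q)"
      using diff(3) by (intro nn_integral_cong_AE) auto
    moreover have "(\<integral>\<^sup>+ \<omega>. ennreal (?c \<omega>) \<partial>Q) = (\<integral>\<^sup>+ \<omega>. comp_part \<omega> \<partial>Q)"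
      using diff(4) by (intro nn_integral_cong_AE) auto
    ultimately show ?thesis
      using jump_part_expectation by (simp add: integral_eq_nn_integral)
  qed
  then have E: "(\<integral>\<omega>. loss \<omega> \<partial>Q) = enn2real base_comp"
    using diff(1,2) ae m by (subst integral_cong_AE[of _ _ "\<lambda>\<omega>. ?a \<omega> - ?c \<omega> + enn2real base_comp"]) (auto simp: prob_space)
  have "(\<integral>\<omega>. (loss \<omega> - (\<integral>\<omega>. loss \<omega> \<partial>Q))\<^sup>2 \<partial>Q) = (\<integral>\<omega>. (?a \<omega> - ?c \<omega>)\<^sup>2 \<partial>Q)"
    unfolding E using ae m by (intro integral_cong_AE) auto
  also have "\<dots> = ?v" by (rule diff(6))
  finally show "(\<integral>\<omega>. (loss \<omega> - (\<integral>\<omega>. loss \<omega> \<partial>Q))\<^sup>2 \<partial>Q) = ?v" .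
qed

end

section \<open>The quadratic retention problem\<close>

text \<open>The affine function \<open>q - p z\<close> clipped to \<open>[0,z]\<close>; the pointwise first-order condition singles out retentions of this shape.\<close>

definition layer :: "real \<Rightarrow> real \<Rightarrow> real \<Rightarrow> real" where
  "layer p q z = max 0 (min z (q - p * z))"

lemma layer_bounds: "0 \<le> z \<Longrightarrow> 0 \<le> layer p q z" "0 \<le> z \<Longrightarrow> layer p q z \<le> z"
  by (auto simp: layer_def)

context loss_severity
begin

lemma measurable_layer [measurable]: "layer p q \<in> borel_measurable \<Theta>"
  unfolding layer_def[abs_def] by measurable

lemma abs_layer: "0 \<le> z \<Longrightarrow> \<bar>layer p q z\<bar> \<le> z"
  using layer_bounds[of z p q] by simp

lemmas integrable_layer = integrable_single[OF measurable_layer abs_layer]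

lemma continuous_layer_integral:
  fixes e :: "real \<Rightarrow> real"
  assumes [measurable]: "e \<in> borel_measurable \<Theta>" and int: "integrable \<Theta> (\<lambda>z. \<bar>e z\<bar> * z)"
  shows "continuous_on S (\<lambda>x. \<integral>z. e z * layer (fst x) (snd x) z \<partial>\<Theta>)"
  unfolding continuous_on_sequentially o_def
proof (intro allI ballI impI)
  fix x :: "nat \<Rightarrow> real \<times> real" and a
  assume "a \<in> S" and x: "(\<forall>n. x n \<in> S) \<and> x \<longlonglongrightarrow> a"
  show "(\<lambda>n. \<integral>z. e z * layer (fst (x n)) (snd (x n)) z \<partial>\<Theta>) \<longlonglongrightarrow> (\<integral>z. e z * layer (fst a) (snd a) z \<partial>\<Theta>)"
  proof (rule integral_dominated_convergence[OF _ _ int])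
    show "AE z in \<Theta>. (\<lambda>n. e z * layer (fst (x n)) (snd (x n)) z) \<longlonglongrightarrow> e z * layer (fst a) (snd a) z"
      unfolding layer_def using x by (intro AE_I2 tendsto_intros) auto
    show "AE z in \<Theta>. norm (e z * layer (fst (x n)) (snd (x n)) z) \<le> \<bar>e z\<bar> * z" for n
      by (intro AE_I2) (auto simp: abs_mult space_\<Theta> intro!: mult_left_mono abs_layer)
  qed measurable
qed

text \<open>Both right-hand sides depend continuously on \<open>(p,q)\<close> by dominated convergence. They map the box
\<open>[0, b H[z]/(2M)] \<times> [0, K/(2M)]\<close> into itself, since a layer lies between \<open>0\<close> and \<open>z\<close>; the positive part keeps the
second coordinate in the box.\<close>

lemma layer_fixed_point:
  fixes M b V K :: real
  assumes M: "0 < M" and b: "0 < b" and V: "0 \<le> V" and K: "0 < K"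
  obtains p q where "0 \<le> p" "0 \<le> q" "p = b * (\<integral>z. layer p q z \<partial>\<Theta>) / (2 * M)"
    "q = max 0 (K - b * (\<integral>z. z * layer p q z \<partial>\<Theta>) - 2 * V * (\<integral>z. layer p q z \<partial>\<Theta>)) / (2 * M)"
proof -
  let ?G = "\<lambda>x. \<integral>z. layer (fst x) (snd x) z \<partial>\<Theta>" and ?H = "\<lambda>x. \<integral>z. z * layer (fst x) (snd x) z \<partial>\<Theta>"
  let ?f = "\<lambda>x. (b * ?G x / (2 * M), max 0 (K - b * ?H x - 2 * V * ?G x) / (2 * M))"
  let ?S = "{0..b * mark_mean / (2 * M)} \<times> {0..K / (2 * M)}"
  have G: "continuous_on ?S ?G"
    using continuous_layer_integral[of "\<lambda>_. 1" ?S] by simp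
  have H: "continuous_on ?S ?H"
  proof -
    have "integrable \<Theta> (\<lambda>z. \<bar>z\<bar> * z)" by (rule integrable_product) auto
    then show ?thesis by (intro continuous_layer_integral) auto
  qed
  have pos: "0 \<le> ?G x" "0 \<le> ?H x" "?G x \<le> mark_mean" for x
    unfolding mark_mean_def
    by (auto intro!: integral_nonneg_AE integral_mono_AE AE_I2 integrable_layer simp: space_\<Theta> layer_bounds)
  have ne: "?S \<noteq> {}" using M b K mark_moments_nonneg by (auto simp: divide_nonneg_pos)
  have cont: "continuous_on ?S ?f"
    using M by (intro continuous_intros G H) auto
  have maps: "?f \<in> ?S \<rightarrow> ?S"
  proof
    fix x
    have "0 \<le> b * ?H x" "0 \<le> 2 * V * ?G x" "0 \<le> b * ?G x" "b * ?G x \<le> b * mark_mean"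
      using pos[of x] b V by auto
    then show "?f x \<in> ?S" using M K
      by (auto intro!: divide_right_mono divide_nonneg_pos)
  qed
  obtain x where x: "x \<in> ?S" "?f x = x"
    by (rule brouwer[OF _ _ ne cont maps]) (auto intro: compact_Times convex_Times)
  show thesis
    using x by (intro that[of "fst x" "snd x"]) (auto simp: prod_eq_iff)
qed

text \<open>With the coefficients of \<open>qform_eq\<close> this is the variance of the retained total, extended to signed \<open>d\<close>.\<close>

definition "qform M b V d = M * (\<integral>z. (d z)\<^sup>2 \<partial>\<Theta>) + b * (\<integral>z. d z \<partial>\<Theta>) * (\<integral>z. z * d z \<partial>\<Theta>) + V * (\<integral>z. d z \<partial>\<Theta>)\<^sup>2"

lemma qform_expansion:
  fixes g d :: "real \<Rightarrow> real"
  assumes g: "g \<in> borel_measurable \<Theta>" "\<And>z. 0 \<le> z \<Longrightarrow> \<bar>g z\<bar> \<le> z"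
    and d: "d \<in> borel_measurable \<Theta>" "\<And>z. 0 \<le> z \<Longrightarrow> \<bar>d z\<bar> \<le> z"
  shows "qform M b V (\<lambda>z. g z + d z) = qform M b V g + qform M b V d +
    (\<integral>z. (2 * M * g z + b * (\<integral>z. g z \<partial>\<Theta>) * z + (b * (\<integral>z. z * g z \<partial>\<Theta>) + 2 * V * (\<integral>z. g z \<partial>\<Theta>))) * d z \<partial>\<Theta>)"
proof -
  note ints = integrable_single[OF g] integrable_single[OF d] integrable_product[OF g(1) d(1) g(2) d(2)]
  have "(\<integral>z. (g z + d z)\<^sup>2 \<partial>\<Theta>) = (\<integral>z. (g z)\<^sup>2 + (d z)\<^sup>2 + 2 * (g z * d z) \<partial>\<Theta>)"
    by (simp add: power2_eq_square algebra_simps)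
  also have "\<dots> = (\<integral>z. (g z)\<^sup>2 \<partial>\<Theta>) + (\<integral>z. (d z)\<^sup>2 \<partial>\<Theta>) + 2 * (\<integral>z. g z * d z \<partial>\<Theta>)"
    using ints by simp
  finally have sq: "(\<integral>z. (g z + d z)\<^sup>2 \<partial>\<Theta>) = (\<integral>z. (g z)\<^sup>2 \<partial>\<Theta>) + (\<integral>z. (d z)\<^sup>2 \<partial>\<Theta>) + 2 * (\<integral>z. g z * d z \<partial>\<Theta>)" .
  have zs: "(\<integral>z. z * (g z + d z) \<partial>\<Theta>) = (\<integral>z. z * g z \<partial>\<Theta>) + (\<integral>z. z * d z \<partial>\<Theta>)"
    using ints by (simp add: distrib_left)
  have s: "(\<integral>z. g z + d z \<partial>\<Theta>) = (\<integral>z. g z \<partial>\<Theta>) + (\<integral>z. d z \<partial>\<Theta>)"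
    using ints by simp
  have lin: "(\<integral>z. (2 * M * g z + x * z + y) * d z \<partial>\<Theta>) =
    2 * M * (\<integral>z. g z * d z \<partial>\<Theta>) + x * (\<integral>z. z * d z \<partial>\<Theta>) + y * (\<integral>z. d z \<partial>\<Theta>)" for x y
  proof -
    have "(\<integral>z. (2 * M * g z + x * z + y) * d z \<partial>\<Theta>) = (\<integral>z. 2 * M * (g z * d z) + x * (z * d z) + y * d z \<partial>\<Theta>)"
      by (simp add: algebra_simps)
    also have "\<dots> = 2 * M * (\<integral>z. g z * d z \<partial>\<Theta>) + x * (\<integral>z. z * d z \<partial>\<Theta>) + y * (\<integral>z. d z \<partial>\<Theta>)"
      using ints by simp
    finally show ?thesis .
  qed
  show ?thesis
    unfolding qform_def sq zs s lin by (simp add: power2_eq_square algebra_simps)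
qed

text \<open>The derivative of the objective at the layer is \<open>2 M (q - p z - layer p q z)\<close>. It vanishes where the layer
is interior, is nonpositive where the layer is \<open>0\<close> and nonnegative where it is \<open>z\<close>; so no admissible change improves
the objective to first order, and the second-order term is minus a definite form.\<close>

theorem quadratic_optimum:
  fixes M b V K :: real
  assumes M: "0 < M" and b: "0 < b" and V: "0 \<le> V" and K: "0 < K"
    and heavy: "\<not> (AE z in \<Theta>. z \<le> 0)"
    and nonneg: "\<And>d. d \<in> borel_measurable \<Theta> \<Longrightarrow> (\<And>z. 0 \<le> z \<Longrightarrow> \<bar>d z\<bar> \<le> z) \<Longrightarrow> 0 \<le> qform M b V d"
    and definite: "\<And>d. d \<in> borel_measurable \<Theta> \<Longrightarrow> (\<And>z. 0 \<le> z \<Longrightarrow> \<bar>d z\<bar> \<le> z) \<Longrightarrow> qform M b V d = 0 \<Longrightarrow>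
       AE z in \<Theta>. d z = 0"
  obtains p q where "0 < p" "0 < q" "2 * M * p = b * (\<integral>z. layer p q z \<partial>\<Theta>)"
    "\<And>g. g \<in> borel_measurable \<Theta> \<Longrightarrow> (\<And>z. 0 \<le> z \<Longrightarrow> 0 \<le> g z \<and> g z \<le> z) \<Longrightarrow>
       K * (\<integral>z. g z \<partial>\<Theta>) - qform M b V g \<le> K * (\<integral>z. layer p q z \<partial>\<Theta>) - qform M b V (layer p q)"
    "\<And>g. g \<in> borel_measurable \<Theta> \<Longrightarrow> (\<And>z. 0 \<le> z \<Longrightarrow> 0 \<le> g z \<and> g z \<le> z) \<Longrightarrow>
       K * (\<integral>z. g z \<partial>\<Theta>) - qform M b V g = K * (\<integral>z. layer p q z \<partial>\<Theta>) - qform M b V (layer p q) \<Longrightarrow>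
       AE z in \<Theta>. g z = layer p q z"
proof -
  obtain p q where pq: "0 \<le> p" "0 \<le> q" and p: "p = b * (\<integral>z. layer p q z \<partial>\<Theta>) / (2 * M)"
    and q: "q = max 0 (K - b * (\<integral>z. z * layer p q z \<partial>\<Theta>) - 2 * V * (\<integral>z. layer p q z \<partial>\<Theta>)) / (2 * M)"
    by (rule layer_fixed_point[OF M b V K])
  let ?g = "layer p q"
  let ?I = "\<integral>z. ?g z \<partial>\<Theta>" and ?H = "\<integral>z. z * ?g z \<partial>\<Theta>"
  \<comment> \<open>with \<open>q = 0\<close> nothing is retained, and then the equation for \<open>q\<close> reads \<open>2 M q = K > 0\<close>\<close>
  have q0: "0 < q"
  proof (rule ccontr)
    assume "\<not> 0 < q"
    then have "q = 0" using pq by simp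
    have zero: "?g z = 0" if "0 \<le> z" for z
    proof -
      have "0 \<le> p * z" using that pq by simp
      then show ?thesis using that \<open>q = 0\<close> by (auto simp: layer_def)
    qed
    have "?I = (\<integral>z. 0 \<partial>\<Theta>)" "?H = (\<integral>z. 0 \<partial>\<Theta>)"
      by (rule Bochner_Integration.integral_cong; simp add: space_\<Theta> zero)+
    then have "q = K / (2 * M)" using q K by simp
    then show False using \<open>q = 0\<close> K M by simp
  qed
  then have q': "2 * M * q = K - b * ?H - 2 * V * ?I"
    using q M by (auto simp: max_def field_simps split: if_splits)
  have p': "2 * M * p = b * ?I" using p M by (simp add: field_simps)
  \<comment> \<open>with \<open>p = 0\<close> the retention is \<open>min z q\<close>, whose integral vanishes only if all losses do\<close>
  have p0: "0 < p"
  proof (rule ccontr)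
    assume "\<not> 0 < p"
    then have p00: "p = 0" using pq by simp
    then have "?I = 0" using p' b by simp
    then have "AE z in \<Theta>. ?g z = 0"
      using integrable_layer(1) by (subst (asm) integral_nonneg_eq_0_iff_AE) (auto intro!: AE_I2 simp: space_\<Theta> layer_bounds)
    then have "AE z in \<Theta>. z \<le> 0"
    proof eventually_elim
      case (elim z)
      then show ?case using q0 p00 by (auto simp: layer_def max_def min_def split: if_splits)
    qed
    then show False using heavy by simp
  qed
  have expand: "K * (\<integral>z. g z \<partial>\<Theta>) - qform M b V g =
      K * ?I - qform M b V ?g + (\<integral>z. 2 * M * (q - p * z - ?g z) * (g z - ?g z) \<partial>\<Theta>) - qform M b V (\<lambda>z. g z - ?g z)"
    and dd: "(\<lambda>z. g z - ?g z) \<in> borel_measurable \<Theta>" "\<And>z. 0 \<le> z \<Longrightarrow> \<bar>g z - ?g z\<bar> \<le> z"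
    and corr: "(\<integral>z. 2 * M * (q - p * z - ?g z) * (g z - ?g z) \<partial>\<Theta>) \<le> 0"
    if mean_retained[measurable]: "g \<in> borel_measurable \<Theta>" and gb: "\<And>z. 0 \<le> z \<Longrightarrow> 0 \<le> g z \<and> g z \<le> z" for g
  proof -
    let ?d = "\<lambda>z. g z - ?g z"
    show dm: "?d \<in> borel_measurable \<Theta>" by measurable
    show db: "\<bar>?d z\<bar> \<le> z" if "0 \<le> z" for z
      using gb[OF that] layer_bounds[OF that, of p q] by auto
    note ints = integrable_single[OF dm db] integrable_product[OF measurable_layer dm abs_layer db]
    have ga: "\<bar>g z\<bar> \<le> z" if "0 \<le> z" for z using gb[OF that] by simp
    have gi: "(\<integral>z. g z \<partial>\<Theta>) = ?I + (\<integral>z. ?d z \<partial>\<Theta>)"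
      using integrable_single(1)[OF mean_retained ga] integrable_layer(1) by simp
    have "qform M b V g = qform M b V (\<lambda>z. ?g z + ?d z)" by simp
    also have "\<dots> = qform M b V ?g + qform M b V ?d +
       (\<integral>z. (2 * M * ?g z + b * ?I * z + (b * ?H + 2 * V * ?I)) * ?d z \<partial>\<Theta>)"
      by (rule qform_expansion[OF measurable_layer abs_layer dm db])
    also have "(\<integral>z. (2 * M * ?g z + b * ?I * z + (b * ?H + 2 * V * ?I)) * ?d z \<partial>\<Theta>) =
       (\<integral>z. K * ?d z - 2 * M * (q - p * z - ?g z) * ?d z \<partial>\<Theta>)"
    proof (rule Bochner_Integration.integral_cong[OF refl])
      fix z
      have e: "b * ?H + 2 * V * ?I = K - 2 * M * q" using q' by simp
      then show "(2 * M * ?g z + b * ?I * z + (b * ?H + 2 * V * ?I)) * ?d z = K * ?d z - 2 * M * (q - p * z - ?g z) * ?d z"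
        unfolding p'[symmetric] e by (simp add: algebra_simps)
    qed
    also have "\<dots> = K * (\<integral>z. ?d z \<partial>\<Theta>) - (\<integral>z. 2 * M * (q - p * z - ?g z) * ?d z \<partial>\<Theta>)"
    proof -
      have "(\<lambda>z. 2 * M * (q - p * z - ?g z) * ?d z) = (\<lambda>z. 2 * M * q * ?d z - 2 * M * p * (z * ?d z) - 2 * M * (?g z * ?d z))"
        by (simp add: algebra_simps)
      then have "integrable \<Theta> (\<lambda>z. 2 * M * (q - p * z - ?g z) * ?d z)" using ints by simp
      then show ?thesis using ints by (subst Bochner_Integration.integral_diff) auto
    qed
    finally show "K * (\<integral>z. g z \<partial>\<Theta>) - qform M b V g =
      K * ?I - qform M b V ?g + (\<integral>z. 2 * M * (q - p * z - ?g z) * ?d z \<partial>\<Theta>) - qform M b V ?d"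
      unfolding gi by (simp add: algebra_simps)
    have "0 \<le> (\<integral>z. - (2 * M * (q - p * z - ?g z) * ?d z) \<partial>\<Theta>)"
    proof (intro integral_nonneg_AE AE_I2)
      fix z assume "z \<in> space \<Theta>"
      then have z: "0 \<le> z" by (simp add: space_\<Theta>)
      have "(q - p * z - ?g z) * ?d z \<le> 0"
        using gb[OF z] unfolding layer_def max_def min_def
        by (auto simp: mult_le_0_iff)
      then show "0 \<le> - (2 * M * (q - p * z - ?g z) * ?d z)"
        using M by (simp add: mult.assoc mult_nonneg_nonpos)
    qed
    then show "(\<integral>z. 2 * M * (q - p * z - ?g z) * ?d z \<partial>\<Theta>) \<le> 0" by simp
  qed
  show thesis
  proof (rule that[OF p0 q0 p'])
    fix g assume g: "g \<in> borel_measurable \<Theta>" "\<And>z. 0 \<le> z \<Longrightarrow> 0 \<le> g z \<and> g z \<le> z"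
    have nn: "0 \<le> qform M b V (\<lambda>z. g z - ?g z)" by (rule nonneg[OF dd[OF g]])
    show "K * (\<integral>z. g z \<partial>\<Theta>) - qform M b V g \<le> K * ?I - qform M b V ?g"
      using expand[OF g] corr[OF g] nn by linarith
    assume "K * (\<integral>z. g z \<partial>\<Theta>) - qform M b V g = K * ?I - qform M b V ?g"
    then have "qform M b V (\<lambda>z. g z - ?g z) = 0"
      using expand[OF g] corr[OF g] nn by linarith
    from definite[OF dd[OF g] this] show "AE z in \<Theta>. g z = ?g z" by simp
  qed
qed

text \<open>The retained part of the threshold contract follows the diagonal up to \<open>a = q/(1+p)\<close>, where \<open>z = q - p z\<close>,
and then falls with slope \<open>- p\<close> to reach \<open>0\<close> at \<open>b = q/p\<close>.\<close>

lemma threshold_layer: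
  assumes "0 < p" "0 < q"
  defines "a \<equiv> q / (1 + p)" and "b \<equiv> q / p"
  shows "0 \<le> a" "a < b" "a / (b - a) = p"
    and "\<And>z. 0 \<le> z \<Longrightarrow> z - threshold_contract a b z = layer p q z"
    and "(LINT z:{0..b}|\<Theta>. z - b / (b - a) * max (z - a) 0) = (\<integral>z. layer p q z \<partial>\<Theta>)"
proof -
  have p1: "0 < 1 + p" using assms by simp
  show "0 \<le> a" "a < b" using assms(1,2) unfolding a_def b_def by (auto intro: divide_strict_left_mono)
  have ba: "b - a = q / (p * (1 + p))" using assms(1) p1 unfolding a_def b_def by (simp add: field_simps)
  have "a / (b - a) = a / (q / (p * (1 + p)))" by (simp only: ba)
  also have "\<dots> = p" using assms(1,2) p1 by (simp add: a_def)
  finally show ap: "a / (b - a) = p" .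
  have bp: "b / (b - a) = 1 + p" unfolding ba using assms(1,2) p1 by (simp add: b_def field_simps)
  have aq: "(1 + p) * a = q" "p * b = q" using assms(1) p1 by (auto simp: a_def b_def)
  have ramp: "z - (1 + p) * max (z - a) 0 = min z (q - p * z)" for z
  proof (cases "z \<le> a")
    case True
    then have "(1 + p) * z \<le> (1 + p) * a" using p1 by (intro mult_left_mono) auto
    then show ?thesis using True aq by (simp add: algebra_simps)
  next
    case False
    then have "(1 + p) * a \<le> (1 + p) * z" using p1 by (intro mult_left_mono) auto
    moreover have "z - (1 + p) * (z - a) = (1 + p) * a - p * z" by (simp add: algebra_simps)
    ultimately show ?thesis using False aq by (simp add: algebra_simps)
  qed
  show "z - threshold_contract a b z = layer p q z" if "0 \<le> z" for z
    unfolding threshold_contract_def bp layer_def ramp[symmetric] by auto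
  show "(LINT z:{0..b}|\<Theta>. z - b / (b - a) * max (z - a) 0) = (\<integral>z. layer p q z \<partial>\<Theta>)"
    unfolding set_lebesgue_integral_def bp ramp
  proof (rule Bochner_Integration.integral_cong[OF refl])
    fix z assume "z \<in> space \<Theta>"
    then have z: "0 \<le> z" by (simp add: space_\<Theta>)
    have "q - p * z \<ge> 0 \<longleftrightarrow> z \<le> b" using assms(1) by (simp add: b_def field_simps)
    then show "indicator {0..b} z *\<^sub>R min z (q - p * z) = layer p q z"
      using z by (auto simp: layer_def indicator_def)
  qed
qed

end

section \<open>The optimal contract\<close>

context linear_hawkes
begin

text \<open>Contracts are only determined up to \<open>\<Theta>\<close>-null sets; almost surely no loss falls into a given null set, so the
wealth does not see the difference.\<close>

lemma marks_AE:
  assumes P: "AE z in \<Theta>. P z" and [measurable]: "{z \<in> space Rplus. P z} \<in> sets Rplus"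
  shows "AE \<omega> in Q. AE x in \<nu> \<omega>. P (snd x)"
proof -
  let ?N = "{z \<in> space Rplus. \<not> P z}"
  have N[measurable]: "?N \<in> sets (Rplus :: real measure)"
  proof -
    have "space Rplus - {z \<in> space Rplus. P z} \<in> sets (Rplus :: real measure)" by measurable
    also have "space Rplus - {z \<in> space Rplus. P z} = ?N" by auto
    finally show ?thesis .
  qed
  let ?u = "\<lambda>x :: real \<times> real. indicator ?N (snd x) :: ennreal"
  have u[measurable]: "?u \<in> borel_measurable (Rplus \<Otimes>\<^sub>M Rplus)"
    by (rule measurable_compose[OF measurable_snd]) (use N in simp)
  have W: "(\<lambda>((\<omega> :: 'a, s), z). ?u (s, z)) \<in> borel_measurable (Pred \<Otimes>\<^sub>M Rplus)"
    using measurable_det_predictable_pair[OF u] by (simp add: split_beta')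
  have "emeasure \<Theta> ?N = 0"
    using P N unfolding sets_\<Theta>[symmetric]
    by (subst (asm) AE_iff_measurable[of ?N]) (auto simp: space_\<Theta>)
  then have z: "(\<integral>\<^sup>+ z. indicator ?N z \<partial>\<Theta>) = 0"
    using N unfolding sets_\<Theta>[symmetric] by simp
  have "(\<integral>\<^sup>+ \<omega>. (\<integral>\<^sup>+ x. ?u x \<partial>\<nu> \<omega>) \<partial>Q) = (\<integral>\<^sup>+ \<omega>. (\<integral>\<^sup>+ s. rate s \<omega> * (\<integral>\<^sup>+ z. ?u (s, z) \<partial>\<Theta>) \<partial>leb) \<partial>Q)"
    by (rule compensation_formula[OF W])
  also have "\<dots> = 0" unfolding snd_conv z by simp
  finally have "(\<integral>\<^sup>+ \<omega>. (\<integral>\<^sup>+ x. ?u x \<partial>\<nu> \<omega>) \<partial>Q) = 0" .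
  moreover have "(\<lambda>\<omega>. \<integral>\<^sup>+ x. ?u x \<partial>\<nu> \<omega>) \<in> borel_measurable Q"
    using measurable_counting_integral[of "\<lambda>_ _. 1" ?u] u by simp
  ultimately have "AE \<omega> in Q. (\<integral>\<^sup>+ x. ?u x \<partial>\<nu> \<omega>) = 0"
    by (subst (asm) nn_integral_0_iff_AE) auto
  then show ?thesis
  proof eventually_elim
    case (elim \<omega>)
    have "?u \<in> borel_measurable (\<nu> \<omega>)"
      by (subst measurable_cong_sets[OF sets_counting refl]) (rule u)
    then have "AE x in \<nu> \<omega>. ?u x = 0"
      using elim by (subst (asm) nn_integral_0_iff_AE) auto
    then show ?case
      using AE_space by eventually_elim (auto simp: indicator_def split: if_splits)
  qed
qed

end

context linear_hawkes_horizon
begin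

abbreviation "m \<equiv> mean_intensity Q lam"
abbreviation "M \<equiv> cumulative_intensity Q lam T"

lemma continuous_k: "continuous_on S k"
  unfolding k_def using \<kappa>_pos by (intro continuous_intros) auto

text \<open>The mean intensity is bounded below by a positive constant on \<open>[0,T]\<close>, because \<open>lam_base < lam0\<close>. So a
continuous nonnegative function with vanishing weighted integral vanishes.\<close>

lemma mean_integral_positive:
  fixes \<phi> :: "real \<Rightarrow> real"
  assumes [measurable]: "\<phi> \<in> borel_measurable borel" and cont: "continuous_on {0..T} \<phi>"
    and nn: "\<And>s. 0 \<le> s \<Longrightarrow> s \<le> T \<Longrightarrow> 0 \<le> \<phi> s"
  shows "set_integrable lborel {0..T} (\<lambda>s. m s * \<phi> s)"
    and "0 \<le> (LINT s:{0..T}|lborel. m s * \<phi> s)"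
    and "(LINT s:{0..T}|lborel. m s * \<phi> s) = 0 \<Longrightarrow> 0 \<le> s \<Longrightarrow> s \<le> T \<Longrightarrow> \<phi> s = 0"
proof -
  obtain K where K: "\<And>s. s \<in> {0..T} \<Longrightarrow> \<bar>\<phi> s\<bar> \<le> K"
  proof -
    have "bounded (\<phi> ` {0..T})" by (intro compact_imp_bounded compact_continuous_image cont) simp
    then obtain a where "\<forall>y\<in>\<phi> ` {0..T}. norm y \<le> a" using bounded_iff by metis
    then show thesis by (intro that[of a]) auto
  qed
  show int: "set_integrable lborel {0..T} (\<lambda>s. m s * \<phi> s)"
    by (rule mean_integral(1)[of \<phi> K]) (use K in auto)
  show n: "0 \<le> (LINT s:{0..T}|lborel. m s * \<phi> s)"
    unfolding set_lebesgue_integral_def using nn mean_intensity_eq(2)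
    by (intro integral_nonneg_AE AE_I2) (auto simp: indicator_def)
  assume zero: "(LINT s:{0..T}|lborel. m s * \<phi> s) = 0" and s: "0 \<le> s" "s \<le> T"
  define c where "c = (lam0 - lam_base) * exp (- \<beta> * T)"
  have c: "0 < c" unfolding c_def using base_less by simp
  have mc: "c \<le> m s" if "0 \<le> s" "s \<le> T" for s
  proof -
    have "\<beta> * s \<le> \<beta> * T" using that \<beta>_pos by simp
    then have "c \<le> baseline s" unfolding c_def baseline_def using base_less base_nonneg
      by (intro add_increasing mult_left_mono) auto
    moreover have "ennreal (baseline s) \<le> ennreal (m s)"
      using mean_ge mean_intensity_eq(1)[OF that(1)] by simp
    then have "baseline s \<le> m s" using mean_intensity_eq(2)[OF that(1)] by (simp add: ennreal_le_iff)
    ultimately show ?thesis by simp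
  qed
  have \<phi>i: "set_integrable lborel {0..T} \<phi>" by (rule borel_integrable_atLeastAtMost'[OF cont])
  have "(LINT s:{0..T}|lborel. c * \<phi> s) \<le> (LINT s:{0..T}|lborel. m s * \<phi> s)"
    using nn mc by (intro set_integral_mono set_integrable_mult_right \<phi>i int) (auto intro!: mult_right_mono)
  then have "c * (LINT s:{0..T}|lborel. \<phi> s) \<le> 0" using zero by simp
  moreover have "0 \<le> (LINT s:{0..T}|lborel. \<phi> s)"
    unfolding set_lebesgue_integral_def using nn
    by (intro integral_nonneg_AE AE_I2) (auto simp: indicator_def)
  ultimately have "(LINT s:{0..T}|lborel. \<phi> s) = 0"
    using c by (simp add: mult_le_0_iff)
  then have "(\<phi> has_integral 0) (cbox 0 T)"
    using set_borel_integral_eq_integral[OF \<phi>i] by (auto simp: has_integral_iff)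
  then show "\<phi> s = 0"
    using cont nn s T_pos by (intro has_integral_0_cbox_imp_0[of 0 T \<phi>]) auto
qed

lemma M_pos: "0 < M"
proof -
  have M1: "M = (LINT s:{0..T}|lborel. m s * 1)" by (simp add: cumulative_intensity_def)
  have "0 \<le> M" unfolding M1 by (rule mean_integral_positive(2)) auto
  moreover have "M \<noteq> 0"
  proof
    assume "M = 0"
    from mean_integral_positive(3)[of "\<lambda>_. 1", OF _ _ _ this[unfolded M1] order.refl] T_pos
    show False by simp
  qed
  ultimately show ?thesis by simp
qed

text \<open>The moments of \<open>k\<close> against the mean intensity are the coefficients of the variance; \<open>B\<close> is twice the first.\<close>

definition "k1 = (LINT s:{0..T}|lborel. m s * k s)"
definition "k2 = (LINT s:{0..T}|lborel. m s * (k s)\<^sup>2)"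

lemma k1_pos: "0 < k1"
proof -
  have "0 \<le> k1" unfolding k1_def by (rule mean_integral_positive(2)) (auto intro: continuous_k k_bounds)
  moreover have "k1 \<noteq> 0"
  proof
    assume "k1 = 0"
    then have "k 0 = 0"
      using T_pos by (intro mean_integral_positive(3)[of k]) (auto intro: continuous_k k_bounds simp: k1_def)
    moreover have "exp (- \<kappa> * T) < 1" using \<kappa>_pos T_pos by simp
    ultimately show False using \<kappa>_pos by (simp add: k_def)
  qed
  ultimately show ?thesis by simp
qed

lemma k2_nonneg: "0 \<le> k2"
  unfolding k2_def by (rule mean_integral_positive(2)) (auto intro!: continuous_intros continuous_k)

text \<open>Fubini on the triangle \<open>0 \<le> s \<le> t \<le> T\<close>: the inner integral over \<open>t\<close> is \<open>k(s)\<close>.\<close>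

lemma B_coeff_eq: "B_coeff Q \<Theta> \<beta> (\<lambda>z. \<Lambda> * z) lam T = 2 * k1"
proof -
  have kap: "\<beta> - (\<integral>z. \<Lambda> * z \<partial>\<Theta>) = \<kappa>" by (simp add: \<kappa>_def mark_mean_def)
  define mb where "mb s = indicator {0..T} s *\<^sub>R (m s * 1)" for s
  have mb_int: "integrable lborel mb"
    using mean_integral_positive(1)[of "\<lambda>_. 1"] by (simp add: mb_def[abs_def] set_integrable_def)
  define f where "f t s = indicator {x. 0 \<le> snd x \<and> snd x \<le> fst x \<and> fst x \<le> T} (t, s) * exp (- \<kappa> * (t - s)) * mb s" for t s :: real
  have [measurable]: "mb \<in> borel_measurable borel" using mb_int by simp
  have f_int: "integrable (lborel \<Otimes>\<^sub>M lborel) (case_prod f)"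
  proof (rule Bochner_Integration.integrable_bound)
    have "integrable (lborel \<Otimes>\<^sub>M lborel) (\<lambda>(t, s). indicator {0..T} t * mb s)"
    proof (rule lborel_pair.Fubini_integrable)
      show "(\<lambda>(t, s). indicator {0..T} t * mb s) \<in> borel_measurable (lborel \<Otimes>\<^sub>M lborel)" by measurable
      have "integrable lborel (\<lambda>t. indicator {0..T} t * (\<integral>s. norm (mb s) \<partial>lborel))"
        using borel_integrable_atLeastAtMost'[of 0 T "\<lambda>_. 1::real"] by (simp add: set_integrable_def)
      then show "integrable lborel (\<lambda>t. \<integral>s. norm ((\<lambda>(t, s). indicator {0..T} t * mb s) (t, s)) \<partial>lborel)"
        by (simp add: abs_mult)
      show "AE t in lborel. integrable lborel (\<lambda>s. (\<lambda>(t, s). indicator {0..T} t * mb s) (t, s))"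
        using mb_int by simp
    qed
    then show "integrable (lborel \<Otimes>\<^sub>M lborel) (\<lambda>(t, s). indicator {0..T} t * mb s)" .
    show "case_prod f \<in> borel_measurable (lborel \<Otimes>\<^sub>M lborel)"
      unfolding f_def[abs_def] by measurable
    have "norm (f t s) \<le> norm (indicator {0..T} t * mb s)" for t s
    proof (cases "0 \<le> s \<and> s \<le> t \<and> t \<le> T")
      case True
      then have "exp (- \<kappa> * (t - s)) * \<bar>mb s\<bar> \<le> 1 * \<bar>mb s\<bar>"
        using \<kappa>_pos by (intro mult_right_mono) auto
      then show ?thesis using True by (simp add: f_def abs_mult)
    qed (auto simp: f_def)
    then show "AE x in lborel \<Otimes>\<^sub>M lborel. norm (case_prod f x) \<le> norm (case x of (t, s) \<Rightarrow> indicator {0..T} t * mb s)"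
      by (intro AE_I2) (auto simp: split_beta)
  qed
  have "(LINT t:{0..T}|lborel. LINT s:{0..t}|lborel. exp (- \<kappa> * (t - s)) * m s) = (\<integral>t. \<integral>s. f t s \<partial>lborel \<partial>lborel)"
    unfolding set_lebesgue_integral_def
  proof (rule Bochner_Integration.integral_cong[OF refl])
    fix t :: real
    show "indicator {0..T} t *\<^sub>R (\<integral>s. indicator {0..t} s *\<^sub>R (exp (- \<kappa> * (t - s)) * m s) \<partial>lborel) = (\<integral>s. f t s \<partial>lborel)"
      unfolding integral_scaleR_right[symmetric]
      by (rule Bochner_Integration.integral_cong[OF refl]) (auto simp: f_def mb_def indicator_def)
  qed
  also have "\<dots> = (\<integral>s. \<integral>t. f t s \<partial>lborel \<partial>lborel)"
    by (rule lborel_pair.Fubini_integral[OF f_int, symmetric])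
  also have "\<dots> = k1"
    unfolding k1_def set_lebesgue_integral_def
  proof (rule Bochner_Integration.integral_cong[OF refl])
    fix s :: real
    show "(\<integral>t. f t s \<partial>lborel) = indicator {0..T} s *\<^sub>R (m s * k s)"
    proof (cases "s \<in> {0..T}")
      case True
      have "(\<integral>t. f t s \<partial>lborel) = (\<integral>t. (exp (- \<kappa> * (t - s)) * indicator {s..T} t) * m s \<partial>lborel)"
        using True by (intro Bochner_Integration.integral_cong) (auto simp: f_def mb_def indicator_def)
      also have "\<dots> = (\<integral>t. exp (- \<kappa> * (t - s)) * indicator {s..T} t \<partial>lborel) * m s"
        by simp
      also have "(\<integral>t. exp (- \<kappa> * (t - s)) * indicator {s..T} t \<partial>lborel) =
          - exp (- \<kappa> * (T - s)) / \<kappa> - (- exp (- \<kappa> * (s - s)) / \<kappa>)"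
        using True \<kappa>_pos by (intro integral_FTC_Icc_real) (auto intro!: derivative_eq_intros continuous_intros)
      also have "\<dots> = k s" by (simp add: k_def diff_divide_distrib)
      finally show ?thesis using True by (simp add: mult.commute)
    qed (auto simp: f_def mb_def)
  qed
  finally show ?thesis unfolding B_coeff_def kap by simp
qed

abbreviation "V \<equiv> \<Lambda>\<^sup>2 * mark_square * k2"

lemma qform_eq:
  fixes d :: "real \<Rightarrow> real"
  assumes d: "d \<in> borel_measurable \<Theta>" "\<And>z. 0 \<le> z \<Longrightarrow> \<bar>d z\<bar> \<le> z"
  shows "qform M (2 * k1 * \<Lambda>) V d =
    (LINT s:{0..T}|lborel. m s * (\<integral>z. (d z + (\<integral>z. d z \<partial>\<Theta>) * k s * \<Lambda> * z)\<^sup>2 \<partial>\<Theta>))"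
proof -
  let ?e = "\<integral>z. d z \<partial>\<Theta>" and ?d2 = "\<integral>z. (d z)\<^sup>2 \<partial>\<Theta>" and ?zd = "\<integral>z. z * d z \<partial>\<Theta>"
  have i1: "set_integrable lborel {0..T} (\<lambda>s. m s * 1)" by (rule mean_integral_positive(1)) auto
  have i2: "set_integrable lborel {0..T} (\<lambda>s. m s * k s)"
    by (rule mean_integral_positive(1)) (auto intro: continuous_k k_bounds)
  have i3: "set_integrable lborel {0..T} (\<lambda>s. m s * (k s)\<^sup>2)"
    by (rule mean_integral_positive(1)) (auto intro!: continuous_intros continuous_k)
  have "(LINT s:{0..T}|lborel. m s * (\<integral>z. (d z + ?e * k s * \<Lambda> * z)\<^sup>2 \<partial>\<Theta>)) =
     (LINT s:{0..T}|lborel. ?d2 * (m s * 1) + 2 * ?e * \<Lambda> * ?zd * (m s * k s) + (?e * \<Lambda>)\<^sup>2 * mark_square * (m s * (k s)\<^sup>2))"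
    by (simp only: shifted_square(2)[OF d]) (simp add: power2_eq_square algebra_simps)
  also have "\<dots> = ?d2 * (LINT s:{0..T}|lborel. m s * 1) + 2 * ?e * \<Lambda> * ?zd * k1 + (?e * \<Lambda>)\<^sup>2 * mark_square * k2"
    unfolding k1_def k2_def using i1 i2 i3
    by (subst set_integral_add; (subst set_integral_add)?) (auto intro!: set_integral_add set_integrable_mult_right)
  also have "\<dots> = qform M (2 * k1 * \<Lambda>) V d"
    by (simp add: qform_def cumulative_intensity_def power2_eq_square algebra_simps)
  finally show ?thesis by simp
qed

text \<open>The variance formula shows that the form is an integral of squares. If it vanishes, then the continuous
integrand vanishes up to the end of the interval, where \<open>k(T) = 0\<close> leaves \<open>H[d^2]\<close>.\<close>

lemma qform_definite:
  fixes d :: "real \<Rightarrow> real"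
  assumes d: "d \<in> borel_measurable \<Theta>" "\<And>z. 0 \<le> z \<Longrightarrow> \<bar>d z\<bar> \<le> z"
  shows "0 \<le> qform M (2 * k1 * \<Lambda>) V d"
    and "qform M (2 * k1 * \<Lambda>) V d = 0 \<Longrightarrow> AE z in \<Theta>. d z = 0"
proof -
  let ?\<phi> = "\<lambda>s. \<integral>z. (d z + (\<integral>z. d z \<partial>\<Theta>) * k s * \<Lambda> * z)\<^sup>2 \<partial>\<Theta>"
  have profile: "?\<phi> = (\<lambda>s. (\<integral>z. (d z)\<^sup>2 \<partial>\<Theta>) + 2 * ((\<integral>z. d z \<partial>\<Theta>) * k s * \<Lambda>) * (\<integral>z. z * d z \<partial>\<Theta>)
      + ((\<integral>z. d z \<partial>\<Theta>) * k s * \<Lambda>)\<^sup>2 * mark_square)"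
    by (simp only: shifted_square(2)[OF d])
  have m: "?\<phi> \<in> borel_measurable borel" unfolding profile by measurable
  have c: "continuous_on {0..T} ?\<phi>" unfolding profile by (intro continuous_intros continuous_k)
  have nn: "0 \<le> ?\<phi> s" for s by simp
  have q: "qform M (2 * k1 * \<Lambda>) V d = (LINT s:{0..T}|lborel. m s * ?\<phi> s)"
    by (rule qform_eq[OF d])
  show "0 \<le> qform M (2 * k1 * \<Lambda>) V d"
    unfolding q by (rule mean_integral_positive(2)[OF m c nn])
  assume "qform M (2 * k1 * \<Lambda>) V d = 0"
  then have "?\<phi> T = 0"
    unfolding q using T_pos by (intro mean_integral_positive(3)[OF m c nn]) auto
  then have "(\<integral>z. (d z)\<^sup>2 \<partial>\<Theta>) = 0" by (simp add: k_def)
  then have "AE z in \<Theta>. (d z)\<^sup>2 = 0"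
    using integrable_single(3)[OF d] by (subst (asm) integral_nonneg_eq_0_iff_AE) auto
  then show "AE z in \<Theta>. d z = 0" by simp
qed

text \<open>Up to a constant, the criterion is a linear minus a quadratic functional of the retained part.\<close>

theorem criterion_eq:
  assumes \<phi>[measurable]: "\<phi> \<in> borel_measurable Rplus" and g[measurable]: "g \<in> borel_measurable Rplus"
    and gb: "\<And>z. 0 \<le> z \<Longrightarrow> 0 \<le> g z" "\<And>z. 0 \<le> z \<Longrightarrow> g z \<le> z"
    and \<phi>g: "AE z in \<Theta>. \<phi> z = z - g z"
  shows "criterion Q \<nu> \<Theta> R0 \<rho> c \<gamma> T \<phi> = R0 + \<rho> * mark_mean * T - c * T * mark_mean + (c * T - M) * (\<integral>z. g z \<partial>\<Theta>)
     - \<gamma> * qform M (2 * k1 * \<Lambda>) V g"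
proof -
  interpret L: linear_hawkes_loss Q F \<tau> Z \<Theta> lam0 lam_base \<beta> \<Lambda> lam T g
    by unfold_locales (use gb in auto)
  interpret complete_measure Q by (rule complete_Q)
  have gT: "g \<in> borel_measurable \<Theta>" by (rule L.g_measurable_\<Theta>)
  have ga: "\<bar>g z\<bar> \<le> z" if "0 \<le> z" for z using gb[OF that] by simp
  have \<phi>T: "\<phi> \<in> borel_measurable \<Theta>" by (simp add: measurable_cong_sets[OF sets_\<Theta> refl])
  have int\<phi>: "(\<integral>z. \<phi> z \<partial>\<Theta>) = mark_mean - (\<integral>z. g z \<partial>\<Theta>)"
  proof -
    have "(\<integral>z. \<phi> z \<partial>\<Theta>) = (\<integral>z. z - g z \<partial>\<Theta>)"
      using \<phi>g \<phi>T gT by (intro integral_cong_AE) auto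
    then show ?thesis using integrable_single(1)[OF gT ga] by (simp add: mark_mean_def)
  qed
  define C where "C = R0 + \<rho> * mark_mean * T - c * T * (mark_mean - (\<integral>z. g z \<partial>\<Theta>))"
  let ?W = "wealth \<nu> \<Theta> R0 \<rho> c T \<phi>"
  have id[measurable]: "(\<lambda>z. z) \<in> borel_measurable (Rplus :: real measure)"
    by (simp add: measurable_restrict_space1)
  have set: "{z \<in> space Rplus. \<phi> z = z - g z} \<in> sets (Rplus :: real measure)" by measurable
  have W: "AE \<omega> in Q. ?W \<omega> = C - L.loss \<omega>"
    using marks_AE[OF \<phi>g set] AE_space
  proof eventually_elim
    case (elim \<omega>)
    have S: "{0<..T} \<times> {0..} \<in> sets (\<nu> \<omega>)"
      unfolding sets_counting by (intro pair_measureI) (auto simp: sets_restrict_space_iff)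
    have [measurable]: "(\<lambda>x. g (snd x)) \<in> borel_measurable (\<nu> \<omega>)" "(\<lambda>x. \<phi> (snd x)) \<in> borel_measurable (\<nu> \<omega>)"
      "(\<lambda>x. snd x) \<in> borel_measurable (\<nu> \<omega>)"
      by (subst measurable_cong_sets[OF sets_counting refl]; measurable)+
    have "(LINT x:{0<..T} \<times> {0..}|\<nu> \<omega>. \<phi> (snd x) - snd x) = (LINT x:{0<..T} \<times> {0..}|\<nu> \<omega>. - g (snd x))"
      unfolding set_lebesgue_integral_def using elim(1) S by (intro integral_cong_AE) auto
    also have "\<dots> = - L.loss \<omega>" unfolding L.loss_def set_lebesgue_integral_def by simp
    finally show ?case unfolding wealth_def int\<phi> C_def mark_mean_def by simp
  qed
  have lm: "L.loss \<in> borel_measurable Q" using L.loss_moments(1) by simp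
  have Wm: "?W \<in> borel_measurable Q"
    by (rule borel_measurable_AE_eq[OF _ W]) (use lm in auto)
  have E: "(\<integral>\<omega>. ?W \<omega> \<partial>Q) = C - L.mean_retained * M"
  proof -
    have "(\<integral>\<omega>. ?W \<omega> \<partial>Q) = (\<integral>\<omega>. C - L.loss \<omega> \<partial>Q)"
      using W Wm lm by (intro integral_cong_AE) auto
    then show ?thesis using L.loss_moments(1,2) by (simp add: prob_space)
  qed
  have "(\<integral>\<omega>. (?W \<omega> - (\<integral>\<omega>. ?W \<omega> \<partial>Q))\<^sup>2 \<partial>Q) = (\<integral>\<omega>. (L.loss \<omega> - (\<integral>\<omega>. L.loss \<omega> \<partial>Q))\<^sup>2 \<partial>Q)"
    unfolding E L.loss_moments(2)
  proof (rule integral_cong_AE)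
    show "AE \<omega> in Q. (?W \<omega> - (C - L.mean_retained * M))\<^sup>2 = (L.loss \<omega> - L.mean_retained * M)\<^sup>2"
      using W
    proof eventually_elim
      case (elim \<omega>)
      then have "?W \<omega> - (C - L.mean_retained * M) = - (L.loss \<omega> - L.mean_retained * M)" by simp
      then show ?case by (simp only: power2_minus)
    qed
  qed (use Wm lm in auto)
  also have "\<dots> = (LINT s:{0..T}|lborel. m s * L.h2 s)" by (rule L.loss_moments(3))
  also have "\<dots> = qform M (2 * k1 * \<Lambda>) V g"
    by (simp only: qform_eq[OF gT ga] L.h2_def L.w_alt L.mean_retained_def)
  finally have "(\<integral>\<omega>. (?W \<omega> - (\<integral>\<omega>. ?W \<omega> \<partial>Q))\<^sup>2 \<partial>Q) = qform M (2 * k1 * \<Lambda>) V g" .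
  then show ?thesis
    unfolding criterion_def E by (simp add: C_def L.mean_retained_def algebra_simps)
qed

theorem optimal_threshold_contract:
  assumes \<gamma>: "0 < \<gamma>" and load: "0 < c * T - M" and unbounded: "\<not> bounded (measure_support \<Theta>)"
  shows "\<exists>a b. 0 \<le> a \<and> a < b \<and>
     \<Lambda> * (LINT z:{0..b}|\<Theta>. z - b / (b - a) * max (z - a) 0) = 2 * M / B_coeff Q \<Theta> \<beta> (\<lambda>z. \<Lambda> * z) lam T * (a / (b - a)) \<and>
     is_the_optimal_contract \<Theta> (criterion Q \<nu> \<Theta> R0 \<rho> c \<gamma> T) (threshold_contract a b)"
proof -
  define K where "K = (c * T - M) / \<gamma>"
  have K: "0 < K" unfolding K_def using \<gamma> load by simp
  let ?q = "qform M (2 * k1 * \<Lambda>) V"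
  \<comment> \<open>a support beyond \<open>{0}\<close> means that losses of positive size have positive mass\<close>
  have heavy: "\<not> (AE z in \<Theta>. z \<le> 0)"
  proof
    assume ae: "AE z in \<Theta>. z \<le> 0"
    have "measure_support \<Theta> \<subseteq> {0}"
    proof
      fix z assume z: "z \<in> measure_support \<Theta>"
      have "{z \<in> space \<Theta>. \<not> z \<le> 0} \<in> null_sets \<Theta>"
        using ae by (subst (asm) AE_iff_null) auto
      moreover have "{z \<in> space \<Theta>. \<not> z \<le> 0} = {0<..} \<inter> space \<Theta>" by auto
      ultimately have "emeasure \<Theta> ({0<..} \<inter> space \<Theta>) = 0" by auto
      then have "z \<notin> {0<..}" using z unfolding measure_support_def by (auto dest: spec[of _ "{0<..}"])
      then show "z \<in> {0}" using z unfolding measure_support_def by (auto simp: space_\<Theta>)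
    qed
    then have "bounded (measure_support \<Theta>)" by (rule bounded_subset[rotated]) simp
    then show False using unbounded by simp
  qed
  have b: "0 < 2 * k1 * \<Lambda>" using k1_pos \<Lambda>_pos by simp
  have V0: "0 \<le> V" using mark_moments_nonneg k2_nonneg by simp
  obtain p q where pq: "0 < p" "0 < q" and eq: "2 * M * p = 2 * k1 * \<Lambda> * (\<integral>z. layer p q z \<partial>\<Theta>)"
    and best: "\<And>g. g \<in> borel_measurable \<Theta> \<Longrightarrow> (\<And>z. 0 \<le> z \<Longrightarrow> 0 \<le> g z \<and> g z \<le> z) \<Longrightarrow>
       K * (\<integral>z. g z \<partial>\<Theta>) - ?q g \<le> K * (\<integral>z. layer p q z \<partial>\<Theta>) - ?q (layer p q)"
    and unique: "\<And>g. g \<in> borel_measurable \<Theta> \<Longrightarrow> (\<And>z. 0 \<le> z \<Longrightarrow> 0 \<le> g z \<and> g z \<le> z) \<Longrightarrow>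
       K * (\<integral>z. g z \<partial>\<Theta>) - ?q g = K * (\<integral>z. layer p q z \<partial>\<Theta>) - ?q (layer p q) \<Longrightarrow> AE z in \<Theta>. g z = layer p q z"
    by (rule quadratic_optimum[OF M_pos b V0 K heavy qform_definite]) blast+
  let ?a = "q / (1 + p)" and ?b = "q / p"
  note thr = threshold_layer[OF pq]
  let ?U = "criterion Q \<nu> \<Theta> R0 \<rho> c \<gamma> T" and ?\<phi> = "threshold_contract ?a ?b"
  define D where "D = R0 + \<rho> * mark_mean * T - c * T * mark_mean"
  have criterion_value: "?U \<phi> = D + \<gamma> * (K * (\<integral>z. g z \<partial>\<Theta>) - ?q g)"
    if "\<phi> \<in> borel_measurable Rplus" "g \<in> borel_measurable Rplus"
      "\<And>z. 0 \<le> z \<Longrightarrow> 0 \<le> g z" "\<And>z. 0 \<le> z \<Longrightarrow> g z \<le> z" "AE z in \<Theta>. \<phi> z = z - g z" for \<phi> g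
  proof -
    have "\<gamma> * K = c * T - M" using \<gamma> by (simp add: K_def)
    then show ?thesis using criterion_eq[OF that, of R0 \<rho> c \<gamma>]
      by (simp add: D_def right_diff_distrib mult.assoc[symmetric])
  qed
  have id[measurable]: "(\<lambda>z. z) \<in> borel_measurable (Rplus :: real measure)"
    by (simp add: measurable_restrict_space1)
  have lR: "layer p q \<in> borel_measurable Rplus" unfolding layer_def[abs_def] by measurable
  have tR: "?\<phi> \<in> borel_measurable Rplus" unfolding threshold_contract_def[abs_def] by measurable
  have t\<phi>: "AE z in \<Theta>. ?\<phi> z = z - layer p q z"
  proof (rule AE_I2)
    fix z assume "z \<in> space \<Theta>"
    then show "?\<phi> z = z - layer p q z" using thr(4)[of z] by (simp add: space_\<Theta>)
  qed
  have U\<phi>: "?U ?\<phi> = D + \<gamma> * (K * (\<integral>z. layer p q z \<partial>\<Theta>) - ?q (layer p q))"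
    by (rule criterion_value[OF tR lR _ _ t\<phi>]) (auto simp: layer_bounds)
  have in_contracts: "?\<phi> \<in> contracts \<Theta>"
    unfolding contracts_def
  proof (intro CollectI conjI tR)
    show "AE z in \<Theta>. 0 \<le> ?\<phi> z \<and> ?\<phi> z \<le> z"
      using t\<phi> AE_space by eventually_elim (auto simp: space_\<Theta> layer_bounds)
  qed
  have contract: "\<exists>g. g \<in> borel_measurable \<Theta> \<and> (\<forall>z\<ge>0. 0 \<le> g z \<and> g z \<le> z) \<and> (AE z in \<Theta>. h z = z - g z) \<and>
      ?U h = D + \<gamma> * (K * (\<integral>z. g z \<partial>\<Theta>) - ?q g)" if h: "h \<in> contracts \<Theta>" for h
  proof -
    \<comment> \<open>clipping makes the bounds of a contract hold everywhere instead of almost everywhere\<close>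
    let ?g = "\<lambda>z. z - max 0 (min z (h z))"
    have hR[measurable]: "h \<in> borel_measurable Rplus" and hb: "AE z in \<Theta>. 0 \<le> h z \<and> h z \<le> z"
      using h by (auto simp: contracts_def)
    have gR: "?g \<in> borel_measurable Rplus" by measurable
    have ae: "AE z in \<Theta>. h z = z - ?g z" using hb by eventually_elim auto
    have "?U h = D + \<gamma> * (K * (\<integral>z. ?g z \<partial>\<Theta>) - ?q ?g)"
      by (rule criterion_value[OF hR gR _ _ ae]) auto
    moreover have "?g \<in> borel_measurable \<Theta>" using gR by (simp add: measurable_cong_sets[OF sets_\<Theta> refl])
    ultimately show ?thesis using ae by (intro exI[of _ ?g]) auto
  qed
  have le: "?U h \<le> ?U ?\<phi>" if hc: "h \<in> contracts \<Theta>" for h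
  proof -
    obtain g where g: "g \<in> borel_measurable \<Theta>" "\<And>z. 0 \<le> z \<Longrightarrow> 0 \<le> g z \<and> g z \<le> z"
      and U: "?U h = D + \<gamma> * (K * (\<integral>z. g z \<partial>\<Theta>) - ?q g)"
      using contract[OF hc] by blast
    show ?thesis unfolding U U\<phi> using best[OF g] \<gamma> by simp
  qed
  have opt: "is_the_optimal_contract \<Theta> ?U ?\<phi>"
    unfolding is_the_optimal_contract_def is_arg_max_def
  proof (intro conjI allI impI)
    show "?\<phi> \<in> contracts \<Theta>" by (rule in_contracts)
    show "\<nexists>y. y \<in> contracts \<Theta> \<and> ?U ?\<phi> < ?U y" using le by (meson not_le)
    fix h assume h: "h \<in> contracts \<Theta> \<and> (\<nexists>y. y \<in> contracts \<Theta> \<and> ?U h < ?U y)"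
    then have "?U h = ?U ?\<phi>" using le[of h] in_contracts by (meson antisym not_le)
    obtain g where g: "g \<in> borel_measurable \<Theta>" "\<And>z. 0 \<le> z \<Longrightarrow> 0 \<le> g z \<and> g z \<le> z"
      and hg: "AE z in \<Theta>. h z = z - g z" and U: "?U h = D + \<gamma> * (K * (\<integral>z. g z \<partial>\<Theta>) - ?q g)"
      using contract h by blast
    have "K * (\<integral>z. g z \<partial>\<Theta>) - ?q g = K * (\<integral>z. layer p q z \<partial>\<Theta>) - ?q (layer p q)"
      using \<open>?U h = ?U ?\<phi>\<close> \<gamma> unfolding U U\<phi> by simp
    from unique[OF g this] have "AE z in \<Theta>. g z = layer p q z" by simp
    then show "AE z in \<Theta>. h z = ?\<phi> z" using hg t\<phi> by eventually_elim simp
  qed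
  have "\<Lambda> * (LINT z:{0..?b}|\<Theta>. z - ?b / (?b - ?a) * max (z - ?a) 0) =
      2 * M / B_coeff Q \<Theta> \<beta> (\<lambda>z. \<Lambda> * z) lam T * (?a / (?b - ?a))"
    unfolding thr(3,5) B_coeff_eq using eq k1_pos by (simp add: field_simps)
  then show ?thesis using thr(1,2) opt by blast
qed

end

theorem corollary3:
  fixes Q :: "'a measure" and F :: "real \<Rightarrow> 'a measure"
    and \<tau> :: "nat \<Rightarrow> 'a \<Rightarrow> ereal" and Z :: "nat \<Rightarrow> 'a \<Rightarrow> real"
    and \<Theta> :: "real measure" and f :: "real \<Rightarrow> real" and lam :: "real \<Rightarrow> 'a \<Rightarrow> real"
    and \<Lambda> \<beta> lam0 lam_base R0 \<rho> c \<gamma> T :: real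
  assumes "sets \<Theta> = sets Rplus"
    and "(\<integral>\<^sup>+ z. ennreal (1 + z + z\<^sup>2) \<partial>\<Theta>) < \<infinity>"
    and "f = (\<lambda>z. \<Lambda> * z)" and "\<Lambda> > 0" and "(\<integral>z. f z \<partial>\<Theta>) < \<beta>"
    and "lam0 > lam_base" and "lam_base \<ge> 0"
    and "marked_hawkes_process Q F \<tau> Z \<Theta> lam0 lam_base \<beta> f lam"
    and "\<gamma> > 0" and "T > 0"
    and "\<not> bounded (measure_support \<Theta>)"
    and "c * T - cumulative_intensity Q lam T > 0"
  shows "\<exists>a b. 0 \<le> a \<and> a < b \<and>
     \<Lambda> * (LINT z:{0..b}|\<Theta>. z - b / (b - a) * max (z - a) 0) =
       2 * cumulative_intensity Q lam T / B_coeff Q \<Theta> \<beta> f lam T * (a / (b - a)) \<and>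
     is_the_optimal_contract \<Theta>
       (criterion Q (counting_measure \<tau> Z) \<Theta> R0 \<rho> c \<gamma> T)
       (threshold_contract a b)"
proof -
  interpret marked_hawkes_process Q F \<tau> Z \<Theta> lam0 lam_base \<beta> "\<lambda>z. \<Lambda> * z" lam
    using assms(8) unfolding assms(3) .
  interpret linear_hawkes_horizon Q F \<tau> Z \<Theta> lam0 lam_base \<beta> \<Lambda> lam T
    using assms(1,2,4-7,10) unfolding assms(3) by unfold_locales
  show ?thesis
    unfolding assms(3) by (rule optimal_threshold_contract[OF assms(9,12,11)])
qed

end
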